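(* Let $D\subset \mathbb{R}^n$ be a bounded domain for which $$\lim_{t\to\infty} e^{\lambda_D t}\,P_z[\tau_D>t]=\psi(z)\int_D\psi(y)\,dy$$ holds for every $z\in D$, where $\tau_D$ is the first exit time from $D$ of $n$-dimensional Brownian motion started at $z$, $\lambda_D$ is the first eigenvalue of $\frac12\Delta$ on $D$ with Dirichlet boundary conditions, and $\psi$ is its corresponding eigenfunction. Let $\tau_D(Z^1)=\inf\{t\ge0: Z^1_t\notin D\}$ be the first exit time of the Brownian-time Brownian motion $Z^1$ started at $z$ from $D$. Then for $z\in D$, $$\lim_{t\to\infty} t^{-1/6}\exp\Big(\tfrac32\, 2^{-2/3}\pi^{2/3}\lambda_D^{2/3}t^{1/3}\Big)P_z[\tau_D(Z^1)>t]=C(\lambda_D)\,\psi(z)\int_D\psi(y)\,dy,$$ where $C(\lambda_D)=\pi^{-1/6}2^{13/6}3^{-1/2}\lambda_D^{1/3}$. This limit is uniform on compact subsets of $D$.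
   Context: Brownian-time Brownian motion (BTBM) in $\mathbb{R}^n$ started at $z$: let $X_t$ be an $n$-dimensional Brownian motion started at $0$ and $Y_t$ an independent one-dimensional Brownian motion started at $0$; then $Z^1_t=z+X(|Y_t|)$, $t\ge0$. *)

theory Defs
  imports "HOL-Probability.Probability"
begin

definition gauss_density :: "real \<Rightarrow> 'a::euclidean_space \<Rightarrow> real" where
  "gauss_density s x = (2 * pi * s) powr (- real DIM('a) / 2) * exp (- (norm x)\<^sup>2 / (2 * s))"

definition brownian_motion :: "'w measure \<Rightarrow> (real \<Rightarrow> 'w \<Rightarrow> 'a::euclidean_space) \<Rightarrow> bool" where
  "brownian_motion M B \<longleftrightarrow>
     prob_space M \<and>
     (\<forall>t. B t \<in> borel_measurable M) \<and>
     (\<forall>\<omega>\<in>space M. B 0 \<omega> = 0 \<and> continuous_on {0..} (\<lambda>t. B t \<omega>)) \<and>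
     (\<forall>s t. 0 \<le> s \<and> s < t \<longrightarrow>
        distributed M lborel (\<lambda>\<omega>. B t \<omega> - B s \<omega>) (\<lambda>x. ennreal (gauss_density (t - s) x))) \<and>
     (\<forall>ts :: nat \<Rightarrow> real. \<forall>k. 0 \<le> ts 0 \<and> strict_mono ts \<longrightarrow>
        prob_space.indep_vars M (\<lambda>_. borel) (\<lambda>i \<omega>. B (ts (Suc i)) \<omega> - B (ts i) \<omega>) {..<k})"

definition indep_processes ::
  "'w measure \<Rightarrow> (real \<Rightarrow> 'w \<Rightarrow> 'a::topological_space) \<Rightarrow> (real \<Rightarrow> 'w \<Rightarrow> 'b::topological_space) \<Rightarrow> bool" where
  "indep_processes M X Y \<longleftrightarrow>
     prob_space.indep_set M
       (sets (vimage_algebra (space M) (\<lambda>\<omega> t. X t \<omega>) (PiM UNIV (\<lambda>_. borel))))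
       (sets (vimage_algebra (space M) (\<lambda>\<omega> t. Y t \<omega>) (PiM UNIV (\<lambda>_. borel))))"

text \<open>First exit time from D of a path, inf {t >= 0. path t notin D}, valued in the extended reals
 (= +oo if the path never leaves D).\<close>
definition exit_time :: "(real \<Rightarrow> 'a) \<Rightarrow> 'a set \<Rightarrow> ereal" where
  "exit_time p D = Inf (ereal ` {t. 0 \<le> t \<and> p t \<notin> D})"

definition pderiv1 :: "('a::euclidean_space \<Rightarrow> real) \<Rightarrow> 'a \<Rightarrow> 'a \<Rightarrow> real" where
  "pderiv1 f b x = frechet_derivative f (at x) b"

definition C2_on :: "'a::euclidean_space set \<Rightarrow> ('a \<Rightarrow> real) \<Rightarrow> bool" where
  "C2_on D f \<longleftrightarrow>
     (\<forall>x\<in>D. f differentiable (at x)) \<and>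
     (\<forall>b\<in>Basis. continuous_on D (pderiv1 f b)) \<and>
     (\<forall>b\<in>Basis. \<forall>x\<in>D. pderiv1 f b differentiable (at x)) \<and>
     (\<forall>b\<in>Basis. \<forall>c\<in>Basis. continuous_on D (pderiv1 (pderiv1 f b) c))"

definition laplacian :: "('a::euclidean_space \<Rightarrow> real) \<Rightarrow> 'a \<Rightarrow> real" where
  "laplacian f x = (\<Sum>b\<in>Basis. pderiv1 (pderiv1 f b) b x)"

definition C1c :: "'a::euclidean_space set \<Rightarrow> ('a \<Rightarrow> real) \<Rightarrow> bool" where
  "C1c D g \<longleftrightarrow>
     (\<forall>x. g differentiable (at x)) \<and> (\<forall>b\<in>Basis. continuous_on UNIV (pderiv1 g b)) \<and>
     (\<exists>K. compact K \<and> K \<subseteq> D \<and> (\<forall>x. x \<notin> K \<longrightarrow> g x = 0))"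

text \<open>f (C^1 in D) belongs to H^1_0(D): it is the H^1(D)-limit of C^1 functions with compact
 support in D.\<close>
definition in_H10 :: "'a::euclidean_space set \<Rightarrow> ('a \<Rightarrow> real) \<Rightarrow> bool" where
  "in_H10 D f \<longleftrightarrow>
     (\<exists>g :: nat \<Rightarrow> 'a \<Rightarrow> real. (\<forall>k. C1c D (g k)) \<and>
        ((\<lambda>k. \<integral>\<^sup>+ x. indicator D x * ennreal ((g k x - f x)\<^sup>2) \<partial>lborel) \<longlonglongrightarrow> 0) \<and>
        ((\<lambda>k. \<integral>\<^sup>+ x. indicator D x *
              ennreal (\<Sum>b\<in>Basis. (pderiv1 (g k) b x - pderiv1 f b x)\<^sup>2) \<partial>lborel) \<longlonglongrightarrow> 0))"

definition dirichlet_eigenpair :: "'a::euclidean_space set \<Rightarrow> real \<Rightarrow> ('a \<Rightarrow> real) \<Rightarrow> bool" where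
  "dirichlet_eigenpair D \<mu> f \<longleftrightarrow>
     C2_on D f \<and> (\<forall>x\<in>D. laplacian f x / 2 = - \<mu> * f x) \<and> in_H10 D f \<and> (\<exists>x\<in>D. f x \<noteq> 0)"

definition first_dirichlet_eigen :: "'a::euclidean_space set \<Rightarrow> real \<Rightarrow> ('a \<Rightarrow> real) \<Rightarrow> bool" where
  "first_dirichlet_eigen D lam psi \<longleftrightarrow>
     dirichlet_eigenpair D lam psi \<and>
     (\<forall>\<mu> f. dirichlet_eigenpair D \<mu> f \<longrightarrow> lam \<le> \<mu>) \<and>
     (\<forall>x\<in>D. psi x > 0) \<and>
     (\<integral>\<^sup>+ x. indicator D x * ennreal ((psi x)\<^sup>2) \<partial>lborel) = 1"

end

theory Submission
  imports Defs "HOL-Real_Asymp.Real_Asymp"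
begin

text \<open>
  Let \<open>R\<^sub>t\<close> be the maximum of \<open>\<bar>Y\<bar>\<close> on \<open>[0, t]\<close>. Since \<open>\<bar>Y\<bar>\<close> runs through all of \<open>[0, R\<^sub>t]\<close>, the
  Brownian-time Brownian motion is still in \<open>D\<close> at time \<open>t\<close> iff \<open>z + X\<close> does not leave \<open>D\<close> before time
  \<open>R\<^sub>t\<close>; by independence its survival probability is the expectation of \<open>P\<^sub>z(\<tau>\<^sub>D > R\<^sub>t)\<close>, which behaves like
  \<open>\<psi>(z) \<integral>\<psi>\<close> times the expectation of \<open>exp (- \<lambda> R\<^sub>t)\<close>.

  Optional stopping of \<open>exp (c\<^sup>2 t / 2) cos (c Y\<^sub>t)\<close> for \<open>c = (2k + 1) \<pi> / (2u)\<close>, combined with the Abel means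
  of the Fourier series of a square wave, gives \<open>P(R\<^sub>t < u) = (4/\<pi>) q + O(q\<^sup>9)\<close> with
  \<open>q = exp (- \<pi>\<^sup>2 t / (8 u\<^sup>2))\<close>. Laplace's method at the scale \<open>u = v\<^sub>0 t\<^bsup>1/3\<^esup> + x t\<^bsup>1/6\<^esup>\<close> then yields the
  constant and the exponent.

  For uniformity, let \<open>P\<^sub>t\<close> be the semigroup of Brownian motion killed outside \<open>D\<close>. By symmetry
  \<open>\<langle>1\<^sub>A, P\<^sub>t 1\<^sub>A\<rangle>\<^sup>2 \<le> \<bar>A\<bar> \<langle>1\<^sub>A, P\<^sub>2\<^sub>t 1\<^sub>A\<rangle>\<close>, which upgrades the pointwise decay to \<open>\<integral> P\<^sub>t 1 \<le> \<bar>D\<bar> exp (- \<lambda> t)\<close>.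
  Hence \<open>exp (\<lambda> t) P\<^sub>t 1\<close> is bounded, converges in \<open>L\<^sup>1\<close>, and, as \<open>P\<^sub>1\<close> maps \<open>L\<^sup>1\<close> to \<open>L\<^sup>\<infinity>\<close>, converges
  uniformly on \<open>D\<close>. The first eigenvalue is positive because the Gaussian density tends to zero.
\<close>

section \<open>Paths and exit times\<close>

text \<open>\<open>brownian_motion\<close> speaks of finitely many increments only. The Markov
  property, the symmetry and the optional stopping identity are therefore proved on time grids,
  where they are statements about iterated integrals, and reach continuous time through two limits:
  dyadic refinement for a closed set inside the domain, then exhaustion of the domain by such sets.
  Dyadic times alone cannot decide an open set, since a path may touch the boundary at a single
  non-dyadic time.

  The constants come from writing the expectation of \<open>exp (- lam * R)\<close> as the integral
  of \<open>lam * exp (- lam * u) * P(R < u)\<close>. Its exponent is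
  \<open>-(lam * u + pi^2 * t / (8 * u^2))\<close>, which is largest at
  \<open>u = v0 * t^(1/3)\<close> with \<open>lam * v0^3 = pi^2 / 4\<close>; there it equals
  \<open>-(3/2) * lam * v0 * t^(1/3)\<close>. The peak has width of order \<open>t^(1/6)\<close>,
  the source of the power in the theorem, and its curvature supplies a Gaussian integral, the source
  of the square root in \<open>C\<close>.\<close>

lemma exit_time_greater_iff:
  fixes p :: "real \<Rightarrow> 'a::topological_space"
  assumes p: "continuous_on {0..} p" and D: "open D" and t: "0 \<le> t"
  shows "ereal t < exit_time p D \<longleftrightarrow> (\<forall>s\<in>{0..t}. p s \<in> D)"
proof
  assume *: "ereal t < exit_time p D"
  show "\<forall>s\<in>{0..t}. p s \<in> D"
  proof (rule ccontr)
    assume "\<not> ?thesis"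
    then obtain s where s: "0 \<le> s" "s \<le> t" "p s \<notin> D" by auto
    then have "exit_time p D \<le> ereal s"
      unfolding exit_time_def by (intro Inf_lower) auto
    with * s(2) show False
      by (meson ereal_less_eq(3) leD order_trans)
  qed
next
  assume *: "\<forall>s\<in>{0..t}. p s \<in> D"
  \<comment> \<open>Strictness comes from openness of \<open>D\<close>: the path remains in
    \<open>D\<close> a little beyond \<open>t\<close>, so the infimum exceeds \<open>t\<close> by a
    margin \<open>d\<close>.\<close>
  have "(p \<longlongrightarrow> p t) (at t within {0..})"
    using p t by (auto simp: continuous_on_def)
  then have "\<forall>\<^sub>F s in at t within {0..}. p s \<in> D"
    using D * t by (intro topological_tendstoD) auto
  then obtain d where d: "d > 0" "\<And>s. 0 \<le> s \<Longrightarrow> s \<noteq> t \<Longrightarrow> dist s t < d \<Longrightarrow> p s \<in> D"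
    by (auto simp: eventually_at)
  have "ereal (t + d) \<le> exit_time p D"
    unfolding exit_time_def
  proof (rule Inf_greatest, clarify)
    fix s assume s: "0 \<le> s" "p s \<notin> D"
    have "\<not> s < t + d"
      using d(2)[of s] s * by (cases "s \<le> t") (auto simp: dist_real_def)
    then show "ereal (t + d) \<le> ereal s" by simp
  qed
  with d(1) show "ereal t < exit_time p D"
    by (metis ereal_less(2) ereal_less_eq(3) less_add_same_cancel1 less_ereal.simps(1) order_less_le_trans)
qed

text \<open>Staying in an open set up to time \<open>t\<close> means staying in one of these closed sets, and for a
  closed set this is decided by the path on dyadic grids. All path events are reduced to finitely many
  increments in this way.\<close>

definition inner_part :: "'a::metric_space set \<Rightarrow> nat \<Rightarrow> 'a set" where
  "inner_part D m = {x. \<forall>y. y \<notin> D \<longrightarrow> 1 / (real m + 1) \<le> dist x y}"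

lemma closed_inner_part: "closed (inner_part D m)"
proof -
  have "inner_part D m = (\<Inter>y\<in>-D. {x. 1 / (real m + 1) \<le> dist x y})"
    by (auto simp: inner_part_def)
  also have "closed \<dots>"
    by (intro closed_INT ballI closed_Collect_le continuous_intros)
  finally show ?thesis .
qed

lemma inner_part_borel [measurable]: "inner_part D m \<in> sets borel"
  using closed_inner_part by (rule borel_closed)

lemma inner_part_subset: "inner_part D m \<subseteq> D"
proof
  fix x assume x: "x \<in> inner_part D m"
  show "x \<in> D"
  proof (rule ccontr)
    assume "x \<notin> D"
    with x have "1 / (real m + 1) \<le> dist x x" unfolding inner_part_def by blast
    then show False by (simp add: field_simps)
  qed
qed

lemma inner_part_mono: "m \<le> n \<Longrightarrow> inner_part D m \<subseteq> inner_part D n"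
proof -
  assume "m \<le> n"
  then have "1 / (real n + 1) \<le> 1 / (real m + 1)" by (simp add: frac_le)
  then show ?thesis unfolding inner_part_def using order_trans by blast
qed

lemma compact_subset_inner_part:
  fixes D :: "'a::heine_borel set"
  assumes "compact C" "C \<subseteq> D" "open D"
  shows "\<exists>m. C \<subseteq> inner_part D m"
proof -
  obtain d where d: "d > 0" "\<And>x y. x \<in> C \<Longrightarrow> y \<in> - D \<Longrightarrow> d \<le> dist x y"
    using separate_compact_closed[of C "- D"] assms by (metis ComplD closed_Compl disjoint_eq_subset_Compl double_complement)
  obtain m where "inverse (real (Suc m)) < d"
    using reals_Archimedean[OF d(1)] by blast
  then have "C \<subseteq> inner_part D m"
    using d(2) by (force simp: inner_part_def inverse_eq_divide add.commute)
  then show ?thesis ..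
qed

text \<open>A violation at any time is seen at some grid point, since otherwise closedness of
  \<open>K\<close> would carry membership from the grid to its limits; the dyadic grids are nested,
  so every finer grid sees it too. The horizon is a whole multiple of \<open>s\<close> so that grids
  for consecutive stretches of time fit together.\<close>

lemma grid_stays_eventually:
  fixes p :: "real \<Rightarrow> 'a::metric_space"
  assumes p: "continuous_on {0..} p" and K: "closed K" and s: "0 \<le> s"
  shows "\<forall>\<^sub>F n in sequentially. (\<forall>i\<le>q * 2 ^ n. p (real i * (s / 2 ^ n)) \<in> K) \<longleftrightarrow>
           (\<forall>r\<in>{0..real q * s}. p r \<in> K)"
proof (cases "\<forall>r\<in>{0..real q * s}. p r \<in> K")
  case True
  have "real i * (s / 2 ^ n) \<in> {0..real q * s}" if "i \<le> q * 2 ^ n" for i n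
  proof -
    have "real i \<le> real q * 2 ^ n" using that by (metis of_nat_le_iff of_nat_mult of_nat_numeral of_nat_power)
    then have "real i * (s / 2 ^ n) \<le> (real q * 2 ^ n) * (s / 2 ^ n)"
      using s by (intro mult_right_mono) auto
    then show ?thesis using s by simp
  qed
  with True show ?thesis by simp
next
  case False
  have "\<exists>n i. i \<le> q * 2 ^ n \<and> p (real i * (s / 2 ^ n)) \<notin> K"
  proof (rule ccontr)
    assume "\<not> ?thesis"
    then have grid: "p (real i * (s / 2 ^ n)) \<in> K" if "i \<le> q * 2 ^ n" for i n
      using that by blast
    have "p r \<in> K" if r: "0 \<le> r" "r \<le> real q * s" for r
    proof (cases "s = 0")
      case True
      then show ?thesis using grid[of 0 0] r by simp
    next
      case False
      then have s': "s > 0" using s by simp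
      \<comment> \<open>Rounding \<open>r\<close> down to the grid of mesh
        \<open>s / 2 ^ n\<close>.\<close>
      define i where "i n = nat \<lfloor>r * 2 ^ n / s\<rfloor>" for n
      have i_le: "real (i n) \<le> r * 2 ^ n / s" for n
        using r s' by (simp add: i_def)
      have i_gt: "r * 2 ^ n / s < real (i n) + 1" for n
        using r s' by (simp add: i_def)
      have "real (i n) \<le> real (q * 2 ^ n)" for n
      proof -
        have "r * 2 ^ n / s \<le> real q * 2 ^ n"
          using mult_right_mono[OF r(2), of "2 ^ n"] s' by (simp add: divide_simps mult_ac)
        then show ?thesis using i_le[of n] by simp
      qed
      then have in_K: "p (real (i n) * (s / 2 ^ n)) \<in> K" for n
        by (intro grid) (metis of_nat_le_iff)
      have lim: "(\<lambda>n. real (i n) * (s / 2 ^ n)) \<longlonglongrightarrow> r"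
      proof (rule tendsto_sandwich)
        have "(\<lambda>n. r - s * (1 / 2) ^ n) \<longlonglongrightarrow> r - s * 0"
          by (intro tendsto_intros LIMSEQ_power_zero) auto
        then show "(\<lambda>n. r - s * (1 / 2) ^ n) \<longlonglongrightarrow> r" by simp
        show "\<forall>\<^sub>F n in sequentially. r - s * (1 / 2) ^ n \<le> real (i n) * (s / 2 ^ n)"
        proof (intro always_eventually allI)
          fix n
          have "r = r * 2 ^ n / s * (s / 2 ^ n)" using s' by simp
          also have "\<dots> \<le> (real (i n) + 1) * (s / 2 ^ n)"
            using i_gt[of n] s' by (intro mult_right_mono) auto
          finally show "r - s * (1 / 2) ^ n \<le> real (i n) * (s / 2 ^ n)"
            by (simp add: algebra_simps power_one_over add_divide_distrib)
        qed
        show "\<forall>\<^sub>F n in sequentially. real (i n) * (s / 2 ^ n) \<le> r"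
          using i_le s' by (intro always_eventually allI) (simp add: field_simps)
      qed auto
      have "(\<lambda>n. p (real (i n) * (s / 2 ^ n))) \<longlonglongrightarrow> p r"
        using continuous_on_tendsto_compose[OF p lim] r s by simp
      from closed_sequentially[OF K in_K this] show ?thesis .
    qed
    with False show False by simp
  qed
  then obtain n0 i0 where i0: "i0 \<le> q * 2 ^ n0" "p (real i0 * (s / 2 ^ n0)) \<notin> K" by blast
  \<comment> \<open>The bad point with index \<open>i0\<close> on the coarse grid has index
    \<open>i0 * 2 ^ k\<close> on the grid that is finer by \<open>k\<close> halvings.\<close>
  have "\<not> (\<forall>i\<le>q * 2 ^ n. p (real i * (s / 2 ^ n)) \<in> K)" if "n0 \<le> n" for n
  proof -
    obtain k where n: "n = n0 + k" using \<open>n0 \<le> n\<close> by (rule less_eqE)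
    have "i0 * 2 ^ k \<le> q * 2 ^ n"
      using mult_right_mono[OF i0(1), of "2 ^ k"] by (simp add: n power_add mult.assoc)
    moreover have "real (i0 * 2 ^ k) * (s / 2 ^ n) = real i0 * (s / 2 ^ n0)"
      by (simp add: n power_add)
    ultimately show ?thesis using i0(2) by (metis (no_types))
  qed
  then have "\<forall>\<^sub>F n in sequentially. \<not> (\<forall>i\<le>q * 2 ^ n. p (real i * (s / 2 ^ n)) \<in> K)"
    by (rule eventually_sequentiallyI)
  then show ?thesis using False by (auto elim: eventually_mono)
qed

text \<open>The trace of the path on \<open>{0..t}\<close> is compact, hence has positive distance
  from the complement of \<open>D\<close> as soon as it lies in \<open>D\<close>.\<close>

lemma inner_part_stays_eventually:
  fixes p :: "real \<Rightarrow> 'a::heine_borel"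
  assumes p: "continuous_on {0..} p" and D: "open D"
  shows "\<forall>\<^sub>F m in sequentially. (\<forall>r\<in>{0..t}. p r \<in> inner_part D m) \<longleftrightarrow> (\<forall>r\<in>{0..t}. p r \<in> D)"
proof (cases "\<forall>r\<in>{0..t}. p r \<in> D")
  case True
  have "compact (p ` {0..t})"
    by (intro compact_continuous_image continuous_on_subset[OF p]) auto
  then obtain m where m: "p ` {0..t} \<subseteq> inner_part D m"
    using compact_subset_inner_part[of _ D] True D by blast
  have "\<forall>r\<in>{0..t}. p r \<in> inner_part D n" if "m \<le> n" for n
    using inner_part_mono[OF that, of D] m by blast
  then show ?thesis using True eventually_sequentially by auto
next
  case False
  then have "\<not> (\<forall>r\<in>{0..t}. p r \<in> inner_part D n)" for n
    using inner_part_subset[of D n] by blast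
  then show ?thesis using False by (intro always_eventually) blast
qed

text \<open>An intersection over uncountably many times is replaced by the countable one over all
  dyadic grids.\<close>

lemma pred_path_stays_closed:
  fixes V :: "real \<Rightarrow> 'w \<Rightarrow> 'a::euclidean_space"
  assumes V [measurable]: "\<And>r. V r \<in> borel_measurable N"
    and cont: "\<And>w. w \<in> space N \<Longrightarrow> continuous_on {0..} (\<lambda>r. V r w)"
    and K: "closed K"
  shows "Measurable.pred N (\<lambda>w. \<forall>r\<in>{0..t}. V r w \<in> K)"
proof (cases "0 \<le> t")
  case True
  have [measurable]: "K \<in> sets borel" using K by (rule borel_closed)
  have "(\<forall>r\<in>{0..t}. V r w \<in> K) \<longleftrightarrow> (\<forall>n. \<forall>i\<le>1 * 2 ^ n. V (real i * (t / 2 ^ n)) w \<in> K)"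
    if w: "w \<in> space N" for w
  proof
    assume *: "\<forall>r\<in>{0..t}. V r w \<in> K"
    show "\<forall>n. \<forall>i\<le>1 * 2 ^ n. V (real i * (t / 2 ^ n)) w \<in> K"
    proof (intro allI impI)
      fix n i :: nat assume "i \<le> 1 * 2 ^ n"
      then have "real i \<le> 2 ^ n" by (metis mult_1 of_nat_le_iff of_nat_numeral of_nat_power)
      then have "real i * (t / 2 ^ n) \<le> 2 ^ n * (t / 2 ^ n)"
        using True by (intro mult_right_mono) auto
      then show "V (real i * (t / 2 ^ n)) w \<in> K" using * True by simp
    qed
  next
    assume *: "\<forall>n. \<forall>i\<le>1 * 2 ^ n. V (real i * (t / 2 ^ n)) w \<in> K"
    have "\<forall>\<^sub>F n in sequentially. (\<forall>i\<le>1 * 2 ^ n. V (real i * (t / 2 ^ n)) w \<in> K) \<longleftrightarrow>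
           (\<forall>r\<in>{0..real 1 * t}. V r w \<in> K)"
      by (rule grid_stays_eventually[OF cont[OF w] K True])
    then have "\<exists>n. (\<forall>i\<le>1 * 2 ^ n. V (real i * (t / 2 ^ n)) w \<in> K) \<longleftrightarrow>
           (\<forall>r\<in>{0..real 1 * t}. V r w \<in> K)"
      by (rule eventually_happens'[OF sequentially_bot])
    with * show "\<forall>r\<in>{0..t}. V r w \<in> K" by simp
  qed
  moreover have "Measurable.pred N (\<lambda>w. \<forall>n. \<forall>i\<le>1 * 2 ^ n. V (real i * (t / 2 ^ n)) w \<in> K)"
    by measurable
  ultimately show ?thesis by (subst measurable_cong)
qed simp

lemma pred_path_stays_open:
  fixes V :: "real \<Rightarrow> 'w \<Rightarrow> 'a::euclidean_space"
  assumes V: "\<And>r. V r \<in> borel_measurable N"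
    and cont: "\<And>w. w \<in> space N \<Longrightarrow> continuous_on {0..} (\<lambda>r. V r w)"
    and D: "open D"
  shows "Measurable.pred N (\<lambda>w. \<forall>r\<in>{0..t}. V r w \<in> D)"
proof -
  have "(\<forall>r\<in>{0..t}. V r w \<in> D) \<longleftrightarrow> (\<exists>m. \<forall>r\<in>{0..t}. V r w \<in> inner_part D m)"
    if w: "w \<in> space N" for w
  proof
    assume "\<forall>r\<in>{0..t}. V r w \<in> D"
    then show "\<exists>m. \<forall>r\<in>{0..t}. V r w \<in> inner_part D m"
      using eventually_happens'[OF sequentially_bot inner_part_stays_eventually[OF cont[OF w] D, of t]]
      by blast
  qed (use inner_part_subset[of D] in blast)
  moreover have "Measurable.pred N (\<lambda>w. \<exists>m. \<forall>r\<in>{0..t}. V r w \<in> inner_part D m)"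
    by (intro pred_intros_countable pred_path_stays_closed V cont closed_inner_part)
  ultimately show ?thesis by (subst measurable_cong)
qed

lemma pred_path_stays:
  fixes V :: "real \<Rightarrow> 'w \<Rightarrow> 'a::euclidean_space"
  assumes "\<And>r. V r \<in> borel_measurable N" "\<And>w. w \<in> space N \<Longrightarrow> continuous_on {0..} (\<lambda>r. V r w)"
    and "open D \<or> closed D"
  shows "Measurable.pred N (\<lambda>w. \<forall>r\<in>{0..t}. V r w \<in> D)"
  using assms(3) pred_path_stays_open[OF assms(1,2)] pred_path_stays_closed[OF assms(1,2)] by blast

section \<open>The killed Brownian semigroup\<close>

text \<open>Dominated convergence for the pairings in which symmetry is expressed; the finite volume
  of \<open>D\<close> makes the constant majorant integrable.\<close>

lemma nn_integral_mult_tendsto: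
  fixes D :: "'a::euclidean_space set"
  assumes D [measurable]: "D \<in> sets borel" "emeasure lborel D < \<infinity>"
    and d: "\<And>x. g x \<le> d" "d < \<infinity>" and c: "c < \<infinity>" "\<And>n x. u n x \<le> c * indicator D x"
    and lim: "\<And>x. (\<lambda>n. u n x) \<longlonglongrightarrow> u' x"
    and [measurable]: "g \<in> borel_measurable borel" "\<And>n. u n \<in> borel_measurable borel" "u' \<in> borel_measurable borel"
  shows "(\<lambda>n. \<integral>\<^sup>+x. g x * u n x \<partial>lborel) \<longlonglongrightarrow> (\<integral>\<^sup>+x. g x * u' x \<partial>lborel)"
proof (rule nn_integral_dominated_convergence[where w="\<lambda>x. d * c * indicator D x"])
  show "AE x in lborel. (\<lambda>n. g x * u n x) \<longlonglongrightarrow> g x * u' x"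
    using d by (intro AE_I2 ennreal_tendsto_cmult lim) (metis order_le_less_trans infinity_ennreal_def)
  show "AE x in lborel. g x * u n x \<le> d * c * indicator D x" for n
    unfolding mult.assoc by (intro AE_I2 mult_mono d c) auto
  show "(\<integral>\<^sup>+x. d * c * indicator D x \<partial>lborel) < \<infinity>"
    using c(1) d(2) D(2) by (simp add: nn_integral_cmult_indicator ennreal_mult_less_top)
qed measurable

lemma indicator_mult_le: "(f::ennreal) \<le> c \<Longrightarrow> indicator A x * f \<le> c"
  by (auto simp: indicator_def)

section \<open>Gaussian steps with killing on a time grid\<close>

lemma gauss_density_borel [measurable]: "gauss_density h \<in> borel_measurable borel"
  unfolding gauss_density_def by measurable

lemma gauss_density_nonneg: "0 \<le> gauss_density h x"
  by (simp add: gauss_density_def)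

lemma gauss_density_minus_commute: "gauss_density h (x - y) = gauss_density h (y - x)"
  by (simp add: gauss_density_def norm_minus_commute)

text \<open>One step of a Gaussian random walk of variance \<open>h\<close> per coordinate. The
  indicator stands at both ends of the step so that the kernel is symmetric.\<close>

definition step_kill :: "'a::euclidean_space set \<Rightarrow> real \<Rightarrow> ('a \<Rightarrow> ennreal) \<Rightarrow> 'a \<Rightarrow> ennreal" where
  "step_kill K h f x =
     indicator K x * (\<integral>\<^sup>+y. ennreal (gauss_density h (y - x)) * (indicator K y * f y) \<partial>lborel)"

lemma step_kill_borel [measurable]:
  assumes [measurable]: "K \<in> sets borel" "f \<in> borel_measurable borel"
  shows "step_kill K h f \<in> borel_measurable borel"
  unfolding step_kill_def by measurable

lemma funpow_step_kill_borel [measurable]: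
  assumes [measurable]: "K \<in> sets borel" "f \<in> borel_measurable borel"
  shows "(step_kill K h ^^ N) f \<in> borel_measurable borel"
  by (induction N) auto

lemma indicator_step_kill: "indicator K x * step_kill K h f x = step_kill K h f x"
  by (simp add: step_kill_def indicator_def)

lemma step_kill_indicator: "step_kill K h (\<lambda>x. indicator K x * f x) = step_kill K h f"
  by (auto simp: step_kill_def fun_eq_iff indicator_def intro!: nn_integral_cong)

lemma indicator_funpow_step_kill:
  "indicator K x * (step_kill K h ^^ N) (\<lambda>x. indicator K x * f x) x = (step_kill K h ^^ N) (\<lambda>x. indicator K x * f x) x"
  by (cases N) (auto simp: indicator_step_kill, simp add: indicator_def)

text \<open>Tonelli, together with the evenness of the Gaussian density.\<close>

lemma step_kill_symmetric:
  assumes [measurable]: "K \<in> sets borel" "f \<in> borel_measurable borel" "g \<in> borel_measurable borel"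
  shows "(\<integral>\<^sup>+x. g x * step_kill K h f x \<partial>lborel) = (\<integral>\<^sup>+x. step_kill K h g x * f x \<partial>lborel)"
proof -
  have "(\<integral>\<^sup>+x. g x * step_kill K h f x \<partial>lborel) =
      (\<integral>\<^sup>+x. \<integral>\<^sup>+y. g x * indicator K x * ennreal (gauss_density h (y - x)) * indicator K y * f y \<partial>lborel \<partial>lborel)"
    unfolding step_kill_def
    by (subst nn_integral_cmult[symmetric]; (simp add: mult_ac)?)+
  also have "\<dots> =
      (\<integral>\<^sup>+y. \<integral>\<^sup>+x. g x * indicator K x * ennreal (gauss_density h (y - x)) * indicator K y * f y \<partial>lborel \<partial>lborel)"
    by (rule lborel_pair.Fubini') measurable
  also have "\<dots> = (\<integral>\<^sup>+y. step_kill K h g y * f y \<partial>lborel)"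
  proof (rule nn_integral_cong)
    fix y
    have "step_kill K h g y * f y =
        (\<integral>\<^sup>+x. ennreal (gauss_density h (x - y)) * (indicator K x * g x) \<partial>lborel) * (indicator K y * f y)"
      by (simp add: step_kill_def mult_ac)
    also have "\<dots> = (\<integral>\<^sup>+x. ennreal (gauss_density h (x - y)) * (indicator K x * g x) * (indicator K y * f y) \<partial>lborel)"
      by (rule nn_integral_multc[symmetric]) measurable
    also have "\<dots> = (\<integral>\<^sup>+x. g x * indicator K x * ennreal (gauss_density h (y - x)) * indicator K y * f y \<partial>lborel)"
      by (subst gauss_density_minus_commute) (simp add: mult_ac)
    finally show "(\<integral>\<^sup>+x. g x * indicator K x * ennreal (gauss_density h (y - x)) * indicator K y * f y \<partial>lborel) =
        step_kill K h g y * f y" ..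
  qed
  finally show ?thesis .
qed

lemma funpow_step_kill_symmetric:
  assumes [measurable]: "K \<in> sets borel" "f \<in> borel_measurable borel" "g \<in> borel_measurable borel"
  shows "(\<integral>\<^sup>+x. g x * (step_kill K h ^^ N) f x \<partial>lborel) = (\<integral>\<^sup>+x. (step_kill K h ^^ N) g x * f x \<partial>lborel)"
  using assms(3)
proof (induction N arbitrary: g)
  case 0
  then show ?case by simp
next
  case (Suc N)
  note [measurable] = Suc.prems
  have "(\<integral>\<^sup>+x. g x * (step_kill K h ^^ Suc N) f x \<partial>lborel) =
      (\<integral>\<^sup>+x. step_kill K h g x * (step_kill K h ^^ N) f x \<partial>lborel)"
    by (simp, rule step_kill_symmetric) measurable
  also have "\<dots> = (\<integral>\<^sup>+x. (step_kill K h ^^ N) (step_kill K h g) x * f x \<partial>lborel)"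
    by (rule Suc.IH) measurable
  finally show ?case by (simp add: funpow_swap1)
qed

section \<open>From independent increments to the Markov property\<close>

locale brownian =
  fixes M :: "'w measure" and X :: "real \<Rightarrow> 'w \<Rightarrow> 'a::euclidean_space"
  assumes bm: "brownian_motion M X"
begin

sublocale prob_space M
  using bm by (simp add: brownian_motion_def)

lemma X_borel [measurable]: "X t \<in> borel_measurable M"
  using bm by (simp add: brownian_motion_def)

lemma X_zero: "w \<in> space M \<Longrightarrow> X 0 w = 0"
  using bm by (simp add: brownian_motion_def)

lemma X_continuous: "w \<in> space M \<Longrightarrow> continuous_on {0..} (\<lambda>t. X t w)"
  using bm by (simp add: brownian_motion_def)

lemma shifted_X_continuous: "w \<in> space M \<Longrightarrow> continuous_on {0..} (\<lambda>t. z + X t w)"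
  by (intro continuous_intros X_continuous)

lemma nn_integral_increment:
  assumes "0 \<le> s" "s < t" and [measurable]: "f \<in> borel_measurable borel"
  shows "(\<integral>\<^sup>+w. f (X t w - X s w) \<partial>M) = (\<integral>\<^sup>+y. ennreal (gauss_density (t - s) y) * f y \<partial>lborel)"
proof -
  have "distributed M lborel (\<lambda>w. X t w - X s w) (\<lambda>x. ennreal (gauss_density (t - s) x))"
    using bm assms by (simp add: brownian_motion_def)
  from distributed_nn_integral[OF this, of f] show ?thesis by simp
qed

text \<open>Independence makes the joint law of the first \<open>N\<close> increments and the next
  one a product, so the next increment can be integrated out against its density with the past held
  fixed.\<close>

lemma grid_increment_independent:
  fixes \<Phi> :: "(nat \<Rightarrow> 'a) \<times> 'a \<Rightarrow> ennreal"
  assumes h: "0 < h" and [measurable]: "\<Phi> \<in> borel_measurable (PiM {..<N} (\<lambda>_. borel) \<Otimes>\<^sub>M borel)"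
  defines "\<xi> \<equiv> \<lambda>i w. X (real (Suc i) * h) w - X (real i * h) w"
  shows "(\<integral>\<^sup>+w. \<Phi> (\<lambda>i\<in>{..<N}. \<xi> i w, \<xi> N w) \<partial>M) =
     (\<integral>\<^sup>+w. \<integral>\<^sup>+y. ennreal (gauss_density h y) * \<Phi> (\<lambda>i\<in>{..<N}. \<xi> i w, y) \<partial>lborel \<partial>M)"
proof -
  let ?A = "PiM {..<N} (\<lambda>_. borel :: 'a measure)" and ?B = "PiM {N} (\<lambda>_. borel :: 'a measure)"
  define \<alpha> where "\<alpha> w = (\<lambda>i\<in>{..<N}. \<xi> i w)" for w
  \<comment> \<open>The next increment is kept as a function on the one-point index set
    \<open>{N}\<close>, because independence of groups of increments is stated for such
    families.\<close>
  define \<beta> where "\<beta> w = (\<lambda>i\<in>{N}. \<xi> i w)" for w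
  have \<xi> [measurable]: "\<xi> i \<in> borel_measurable M" for i
    unfolding \<xi>_def by measurable
  have "strict_mono (\<lambda>i. real i * h)"
    using h by (simp add: strict_mono_def)
  then have "indep_vars (\<lambda>_. borel) \<xi> {..<Suc N}"
    using bm h unfolding brownian_motion_def \<xi>_def by (elim conjE allE[of _ "\<lambda>i. real i * h"]) auto
  then have "indep_var (?A) (\<lambda>w. \<lambda>i\<in>{..<N}. \<xi> i w) (?B) (\<lambda>w. \<lambda>i\<in>{N}. \<xi> i w)"
    by (rule indep_var_restrict) auto
  then have ind: "indep_var (?A) \<alpha> (?B) \<beta>"
    by (simp only: \<alpha>_def[abs_def] \<beta>_def[abs_def])
  have [measurable]: "\<alpha> \<in> measurable M (?A)" "\<beta> \<in> measurable M (?B)"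
    using ind by (auto dest: indep_var_rv1 indep_var_rv2)
  have joint: "distr M (?A) \<alpha> \<Otimes>\<^sub>M distr M (?B) \<beta> =
      distr M (?A \<Otimes>\<^sub>M ?B) (\<lambda>w. (\<alpha> w, \<beta> w))"
    using ind indep_var_distribution_eq by blast
  interpret P: pair_prob_space "distr M (?A) \<alpha>" "distr M (?B) \<beta>"
    by (intro pair_prob_space.intro pair_sigma_finite.intro prob_space_imp_sigma_finite prob_space_distr) auto
  have [measurable]: "(\<lambda>x. \<Phi> (fst x, snd x N)) \<in> borel_measurable (?A \<Otimes>\<^sub>M ?B)"
    by measurable
  have "(\<integral>\<^sup>+w. \<Phi> (\<alpha> w, \<xi> N w) \<partial>M) = (\<integral>\<^sup>+w. \<Phi> (fst (\<alpha> w, \<beta> w), snd (\<alpha> w, \<beta> w) N) \<partial>M)"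
    by (simp add: \<beta>_def)
  also have "\<dots> = (\<integral>\<^sup>+x. \<Phi> (fst x, snd x N) \<partial>(distr M (?A) \<alpha> \<Otimes>\<^sub>M distr M (?B) \<beta>))"
    unfolding joint by (subst nn_integral_distr) measurable
  also have "\<dots> = (\<integral>\<^sup>+a. \<integral>\<^sup>+b. \<Phi> (a, b N) \<partial>distr M (?B) \<beta> \<partial>distr M (?A) \<alpha>)"
    by (subst P.M2.nn_integral_fst[symmetric]) auto
  also have "\<dots> = (\<integral>\<^sup>+w. \<integral>\<^sup>+b. \<Phi> (\<alpha> w, b N) \<partial>distr M (?B) \<beta> \<partial>M)"
    by (subst nn_integral_distr) auto
  also have "\<dots> = (\<integral>\<^sup>+w. \<integral>\<^sup>+y. ennreal (gauss_density h y) * \<Phi> (\<alpha> w, y) \<partial>lborel \<partial>M)"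
  proof (rule nn_integral_cong)
    fix w assume w: "w \<in> space M"
    have [measurable]: "(\<lambda>y. \<Phi> (\<alpha> w, y)) \<in> borel_measurable borel"
    proof -
      have "\<alpha> w \<in> space (?A)"
        using w by (rule measurable_space[rotated]) measurable
      then have "Pair (\<alpha> w) \<in> measurable borel (?A \<Otimes>\<^sub>M borel)"
        by (rule measurable_Pair1')
      from measurable_compose[OF this assms(2)] show ?thesis .
    qed
    show "(\<integral>\<^sup>+b. \<Phi> (\<alpha> w, b N) \<partial>distr M (?B) \<beta>) = (\<integral>\<^sup>+y. ennreal (gauss_density h y) * \<Phi> (\<alpha> w, y) \<partial>lborel)"
      using nn_integral_increment[of "real N * h" "real (Suc N) * h" "\<lambda>y. \<Phi> (\<alpha> w, y)"] h
      by (subst nn_integral_distr) (simp_all add: \<xi>_def \<beta>_def ring_distribs)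
  qed
  finally show ?thesis unfolding \<alpha>_def .
qed

definition grid_stays :: "'a set \<Rightarrow> 'a \<Rightarrow> real \<Rightarrow> nat \<Rightarrow> 'w set" where
  "grid_stays K z h N = {w. \<forall>i\<le>N. z + X (real i * h) w \<in> K}"

text \<open>Positions are partial sums of increments, so survival up to step \<open>N\<close> is a
  function of the first \<open>N\<close> increments and the preceding lemma applies.\<close>

lemma grid_markov_step:
  assumes h: "0 < h" and [measurable]: "K \<in> sets borel" "f \<in> borel_measurable borel"
  shows "(\<integral>\<^sup>+w. indicator (grid_stays K z h N) w * f (z + X (real (Suc N) * h) w) \<partial>M) =
    (\<integral>\<^sup>+w. indicator (grid_stays K z h N) w *
        (\<integral>\<^sup>+y. ennreal (gauss_density h (y - (z + X (real N * h) w))) * f y \<partial>lborel) \<partial>M)"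
proof -
  define \<xi> where "\<xi> i w = X (real (Suc i) * h) w - X (real i * h) w" for i w
  \<comment> \<open>The survival indicator and the payoff, rewritten as a function of the increment
    vector \<open>a\<close> and the next increment \<open>y\<close>.\<close>
  define \<Phi> where "\<Phi> = (\<lambda>(a::nat \<Rightarrow> 'a, y). (if \<forall>i\<le>N. z + (\<Sum>j<i. a j) \<in> K then 1 else 0) * f (z + (\<Sum>j<N. a j) + y))"
  have sum_meas [measurable]: "(\<lambda>a. \<Sum>j<i. a j) \<in> borel_measurable (PiM {..<N} (\<lambda>_. borel :: 'a measure))" if "i \<le> N" for i
    using that by (intro borel_measurable_sum measurable_component_singleton) auto
  have [measurable]: "(\<lambda>a. \<Sum>j<i. fst a j) \<in> borel_measurable (PiM {..<N} (\<lambda>_. borel :: 'a measure) \<Otimes>\<^sub>M (borel :: 'a measure))" if "i \<le> N" for i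
    using that by (intro measurable_compose[OF measurable_fst sum_meas])
  have [measurable]: "\<Phi> \<in> borel_measurable (PiM {..<N} (\<lambda>_. borel) \<Otimes>\<^sub>M borel)"
    unfolding \<Phi>_def split_beta' by measurable
  have tele: "(\<Sum>j<i. (\<lambda>i\<in>{..<N}. \<xi> i w) j) = X (real i * h) w" if "i \<le> N" "w \<in> space M" for i w
  proof -
    have "(\<Sum>j<i. (\<lambda>i\<in>{..<N}. \<xi> i w) j) = (\<Sum>j<i. \<xi> j w)"
      using that by (intro sum.cong) auto
    also have "\<dots> = X (real i * h) w"
      using sum_lessThan_telescope[of "\<lambda>j. X (real j * h) w" i] X_zero[OF that(2)] by (simp add: \<xi>_def)
    finally show ?thesis .
  qed
  have \<Phi>: "\<Phi> (\<lambda>i\<in>{..<N}. \<xi> i w, y) = indicator (grid_stays K z h N) w * f (z + X (real N * h) w + y)"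
    if "w \<in> space M" for w y
    using that by (simp add: \<Phi>_def tele grid_stays_def indicator_def del: restrict_apply sum.lessThan_Suc)
  have "(\<integral>\<^sup>+w. indicator (grid_stays K z h N) w * f (z + X (real (Suc N) * h) w) \<partial>M) =
      (\<integral>\<^sup>+w. \<Phi> (\<lambda>i\<in>{..<N}. \<xi> i w, \<xi> N w) \<partial>M)"
    by (intro nn_integral_cong, subst \<Phi>) (auto simp: \<xi>_def)
  also have "\<dots> = (\<integral>\<^sup>+w. \<integral>\<^sup>+y. ennreal (gauss_density h y) * \<Phi> (\<lambda>i\<in>{..<N}. \<xi> i w, y) \<partial>lborel \<partial>M)"
    unfolding \<xi>_def by (rule grid_increment_independent[OF h]) measurable
  also have "\<dots> = (\<integral>\<^sup>+w. indicator (grid_stays K z h N) w *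
        (\<integral>\<^sup>+y. ennreal (gauss_density h (y - (z + X (real N * h) w))) * f y \<partial>lborel) \<partial>M)"
  proof (intro nn_integral_cong)
    fix w assume w: "w \<in> space M"
    \<comment> \<open>Translation invariance of Lebesgue measure changes the integral over the
      increment into one over the new position.\<close>
    let ?x = "z + X (real N * h) w"
    have "(\<integral>\<^sup>+y. ennreal (gauss_density h (y - ?x)) * f y \<partial>lborel) =
        (\<integral>\<^sup>+y. ennreal (gauss_density h (y - ?x)) * f y \<partial>distr lborel borel ((+) ?x))"
      by (subst lborel_distr_plus) simp
    also have "\<dots> = (\<integral>\<^sup>+y. ennreal (gauss_density h y) * f (?x + y) \<partial>lborel)"
      by (subst nn_integral_distr) auto
    finally show "(\<integral>\<^sup>+y. ennreal (gauss_density h y) * \<Phi> (\<lambda>i\<in>{..<N}. \<xi> i w, y) \<partial>lborel) =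
        indicator (grid_stays K z h N) w * (\<integral>\<^sup>+y. ennreal (gauss_density h (y - ?x)) * f y \<partial>lborel)"
      by (simp add: \<Phi>[OF w] nn_integral_cmult[symmetric] mult_ac)
  qed
  finally show ?thesis .
qed

text \<open>The bridge between paths and operators. The induction varies \<open>f\<close>: the last
  step is integrated out first and turns \<open>f\<close> into the terminal function
  \<open>step_kill K h f\<close> for the remaining steps.\<close>

lemma nn_integral_grid_stays:
  assumes h: "0 < h" and [measurable]: "K \<in> sets borel" "f \<in> borel_measurable borel"
  shows "(\<integral>\<^sup>+w. indicator (grid_stays K z h N) w * f (z + X (real N * h) w) \<partial>M) =
    (step_kill K h ^^ N) (\<lambda>x. indicator K x * f x) z"
  using assms(3)
proof (induction N arbitrary: f)
  case 0
  have "(\<integral>\<^sup>+w. indicator (grid_stays K z h 0) w * f (z + X (real 0 * h) w) \<partial>M) = (\<integral>\<^sup>+w. indicator K z * f z \<partial>M)"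
    by (intro nn_integral_cong) (simp add: grid_stays_def X_zero indicator_def)
  also have "\<dots> = indicator K z * f z"
    by (simp add: emeasure_space_1)
  finally show ?case by simp
next
  case (Suc N)
  note [measurable] = Suc.prems
  have "(\<integral>\<^sup>+w. indicator (grid_stays K z h (Suc N)) w * f (z + X (real (Suc N) * h) w) \<partial>M) =
     (\<integral>\<^sup>+w. indicator (grid_stays K z h N) w * (indicator K (z + X (real (Suc N) * h) w) * f (z + X (real (Suc N) * h) w)) \<partial>M)"
    by (intro nn_integral_cong) (auto simp: grid_stays_def indicator_def le_Suc_eq)
  also have "\<dots> = (\<integral>\<^sup>+w. indicator (grid_stays K z h N) w *
        (\<integral>\<^sup>+y. ennreal (gauss_density h (y - (z + X (real N * h) w))) * (indicator K y * f y) \<partial>lborel) \<partial>M)"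
    by (rule grid_markov_step[OF h]) measurable
  also have "\<dots> = (\<integral>\<^sup>+w. indicator (grid_stays K z h N) w * step_kill K h f (z + X (real N * h) w) \<partial>M)"
    by (intro nn_integral_cong) (auto simp: grid_stays_def indicator_def step_kill_def)
  also have "\<dots> = (step_kill K h ^^ N) (\<lambda>x. indicator K x * step_kill K h f x) z"
    by (rule Suc.IH) measurable
  also have "\<dots> = (step_kill K h ^^ Suc N) (\<lambda>x. indicator K x * f x) z"
    by (simp add: indicator_step_kill step_kill_indicator funpow_swap1)
  finally show ?case .
qed

section \<open>Continuous time as a limit of dyadic grids\<close>

definition stays :: "'a set \<Rightarrow> 'a \<Rightarrow> real \<Rightarrow> 'w set" where
  "stays D z t = {w. \<forall>r\<in>{0..t}. z + X r w \<in> D}"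

text \<open>The operator \<open>P_t\<close> of the overview. It is valued in \<open>ennreal\<close>,
  so monotone and Tonelli arguments need no integrability.\<close>

definition killed :: "'a set \<Rightarrow> real \<Rightarrow> ('a \<Rightarrow> ennreal) \<Rightarrow> 'a \<Rightarrow> ennreal" where
  "killed D t f z = (\<integral>\<^sup>+w. indicator (stays D z t) w * f (z + X t w) \<partial>M)"

text \<open>The pair \<open>(z, w)\<close> is treated as the sample point of the process
  \<open>z + X\<close>; joint measurability then survives integration over \<open>w\<close>.\<close>

lemma killed_borel:
  assumes [measurable]: "f \<in> borel_measurable borel" and D: "open D \<or> closed D"
  shows "killed D t f \<in> borel_measurable borel"
proof -
  have [measurable]: "Measurable.pred (borel \<Otimes>\<^sub>M M) (\<lambda>x. \<forall>r\<in>{0..t}. fst x + X r (snd x) \<in> D)"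
    using D by (intro pred_path_stays) (auto simp: space_pair_measure intro: shifted_X_continuous)
  have "(\<lambda>(z, w). (if \<forall>r\<in>{0..t}. z + X r w \<in> D then 1 else 0) * f (z + X t w)) \<in> borel_measurable (borel \<Otimes>\<^sub>M M)"
    unfolding split_beta' by measurable
  from borel_measurable_nn_integral[OF this] show ?thesis
    by (simp add: killed_def[abs_def] stays_def indicator_def of_bool_def)
qed

lemma killed_inner_part_borel [measurable]:
  "f \<in> borel_measurable borel \<Longrightarrow> killed (inner_part D m) t f \<in> borel_measurable borel"
  using closed_inner_part by (intro killed_borel) auto

lemma stays_borel:
  assumes D: "open D \<or> closed D"
  shows "stays D z t \<inter> space M \<in> sets M"
proof -
  have "Measurable.pred M (\<lambda>w. \<forall>r\<in>{0..t}. z + X r w \<in> D)"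
    using D by (intro pred_path_stays) (auto intro: shifted_X_continuous)
  then show ?thesis
    by (simp add: stays_def pred_def Int_def conj_commute)
qed

lemma indicator_stays_borel:
  assumes "open D \<or> closed D"
  shows "(\<lambda>w. indicator (stays D z t) w :: ennreal) \<in> borel_measurable M"
  using stays_borel[OF assms] by (simp add: borel_measurable_indicator_iff)

lemma indicator_stays_inner_part_borel [measurable]:
  "(\<lambda>w. indicator (stays (inner_part D m) z t) w :: ennreal) \<in> borel_measurable M"
  using closed_inner_part by (intro indicator_stays_borel) auto

lemma grid_stays_borel [measurable]:
  assumes [measurable]: "K \<in> sets borel"
  shows "(\<lambda>w. indicator (grid_stays K z h N) w :: ennreal) \<in> borel_measurable M"
proof -
  have "Measurable.pred M (\<lambda>w. \<forall>i\<le>N. z + X (real i * h) w \<in> K)" by measurable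
  then have "grid_stays K z h N \<inter> space M \<in> sets M"
    by (simp add: grid_stays_def pred_def Int_def conj_commute)
  then show ?thesis by (simp add: borel_measurable_indicator_iff)
qed

text \<open>There are \<open>q * 2 ^ n\<close> steps of length \<open>s / 2 ^ n\<close>, so the
  elapsed time is \<open>q * s\<close> for every \<open>n\<close>, and step counts add when
  \<open>q\<close> does.\<close>

abbreviation grid_killed :: "'a set \<Rightarrow> nat \<Rightarrow> nat \<Rightarrow> nat \<Rightarrow> real \<Rightarrow> ('a \<Rightarrow> ennreal) \<Rightarrow> 'a \<Rightarrow> ennreal" where
  "grid_killed D m n q s f \<equiv>
     (step_kill (inner_part D m) (s / 2 ^ n) ^^ (q * 2 ^ n)) (\<lambda>x. indicator (inner_part D m) x * f x)"

lemma grid_killed_eq: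
  assumes s: "0 < s" and f [measurable]: "f \<in> borel_measurable borel"
  shows "grid_killed D m n q s f z =
    (\<integral>\<^sup>+w. indicator (grid_stays (inner_part D m) z (s / 2 ^ n) (q * 2 ^ n)) w * f (z + X (real q * s) w) \<partial>M)"
  using s by (subst nn_integral_grid_stays[symmetric]) auto

lemma grid_stays_eventually_stays:
  assumes "w \<in> space M" "0 < s"
  shows "\<forall>\<^sub>F n in sequentially. w \<in> grid_stays (inner_part D m) z (s / 2 ^ n) (q * 2 ^ n) \<longleftrightarrow>
    w \<in> stays (inner_part D m) z (real q * s)"
  using grid_stays_eventually[OF shifted_X_continuous[OF assms(1), of z] closed_inner_part[of D m], of s q] assms(2)
  by (simp add: grid_stays_def stays_def)

lemma stays_inner_part_eventually_stays:
  assumes "w \<in> space M" "open D"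
  shows "\<forall>\<^sub>F m in sequentially. w \<in> stays (inner_part D m) z t \<longleftrightarrow> w \<in> stays D z t"
  using inner_part_stays_eventually[OF shifted_X_continuous[OF assms(1), of z] assms(2), of t]
  by (simp add: stays_def)

text \<open>The form of dominated convergence behind both limits. The integrand \<open>f n\<close>
  may vary with \<open>n\<close> because in the semigroup law the inner function is itself being
  approximated.\<close>

lemma nn_integral_indicator_tendsto:
  assumes [measurable]: "\<And>n. (\<lambda>w. indicator (S n) w :: ennreal) \<in> borel_measurable M"
      "(\<lambda>w. indicator S' w :: ennreal) \<in> borel_measurable M"
      "\<And>n. f n \<in> borel_measurable borel" "f' \<in> borel_measurable borel"
    and c: "\<And>n x. f n x \<le> c" "c < \<infinity>"
    and S: "\<And>w. w \<in> space M \<Longrightarrow> \<forall>\<^sub>F n in sequentially. w \<in> S n \<longleftrightarrow> w \<in> S'"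
    and f: "\<And>x. (\<lambda>n. f n x) \<longlonglongrightarrow> f' x"
  shows "(\<lambda>n. \<integral>\<^sup>+w. indicator (S n) w * f n (z + X t w) \<partial>M) \<longlonglongrightarrow>
    (\<integral>\<^sup>+w. indicator S' w * f' (z + X t w) \<partial>M)"
proof (rule nn_integral_dominated_convergence[where w="\<lambda>_. c"])
  show "AE w in M. (\<lambda>n. indicator (S n) w * f n (z + X t w)) \<longlonglongrightarrow> indicator S' w * f' (z + X t w)"
  proof (rule AE_I2)
    fix w assume "w \<in> space M"
    have "(\<lambda>n. indicator S' w * f n (z + X t w)) \<longlonglongrightarrow> indicator S' w * f' (z + X t w)"
      by (intro ennreal_tendsto_cmult f) (auto simp: indicator_def)
    moreover have "\<forall>\<^sub>F n in sequentially. indicator S' w * f n (z + X t w) = indicator (S n) w * f n (z + X t w)"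
      using S[OF \<open>w \<in> space M\<close>] by eventually_elim (simp add: indicator_def)
    ultimately show "(\<lambda>n. indicator (S n) w * f n (z + X t w)) \<longlonglongrightarrow> indicator S' w * f' (z + X t w)"
      by (rule Lim_transform_eventually)
  qed
qed (use c in \<open>auto intro!: indicator_mult_le simp: emeasure_space_1\<close>)

lemma grid_killed_tendsto:
  assumes s: "0 < s" and f [measurable]: "f \<in> borel_measurable borel" and c: "\<And>x. f x \<le> c" "c < \<infinity>"
  shows "(\<lambda>n. grid_killed D m n q s f z) \<longlonglongrightarrow> killed (inner_part D m) (real q * s) f z"
  unfolding grid_killed_eq[OF s f] killed_def
  by (rule nn_integral_indicator_tendsto[OF _ _ _ _ c])
    (auto intro: grid_stays_eventually_stays s)

lemma killed_inner_part_tendsto: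
  assumes D: "open D" and f [measurable]: "f \<in> borel_measurable borel" and c: "\<And>x. f x \<le> c" "c < \<infinity>"
  shows "(\<lambda>m. killed (inner_part D m) t f z) \<longlonglongrightarrow> killed D t f z"
  unfolding killed_def
  by (rule nn_integral_indicator_tendsto[OF _ _ _ _ c])
    (auto intro: stays_inner_part_eventually_stays indicator_stays_borel D)

lemma killed_le_bound:
  assumes "\<And>x. f x \<le> c" shows "killed D t f z \<le> c"
proof -
  have "killed D t f z \<le> (\<integral>\<^sup>+w. c \<partial>M)"
    unfolding killed_def by (intro nn_integral_mono indicator_mult_le assms)
  then show ?thesis by (simp add: emeasure_space_1)
qed

lemma grid_killed_le_bound:
  assumes "0 < s" "f \<in> borel_measurable borel" "\<And>x. f x \<le> c" shows "grid_killed D m n q s f z \<le> c"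
proof -
  have "grid_killed D m n q s f z \<le> (\<integral>\<^sup>+w. c \<partial>M)"
    unfolding grid_killed_eq[OF assms(1,2)] by (intro nn_integral_mono indicator_mult_le assms)
  then show ?thesis by (simp add: emeasure_space_1)
qed

text \<open>On the grid this is additivity of exponents of an iterate; refinement then moves the
  outer event and the inner function simultaneously.\<close>

lemma killed_inner_part_semigroup:
  assumes s: "0 < s" and f [measurable]: "f \<in> borel_measurable borel" and c: "\<And>x. f x \<le> c" "c < \<infinity>"
  shows "killed (inner_part D m) (real (q + r) * s) f z =
    killed (inner_part D m) (real q * s) (killed (inner_part D m) (real r * s) f) z"
proof (rule LIMSEQ_unique)
  let ?g = "\<lambda>n. grid_killed D m n r s f"
  show "(\<lambda>n. grid_killed D m n (q + r) s f z) \<longlonglongrightarrow> killed (inner_part D m) (real (q + r) * s) f z"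
    by (rule grid_killed_tendsto[OF s f c])
  have "grid_killed D m n (q + r) s f z = grid_killed D m n q s (?g n) z" for n
    by (simp only: indicator_funpow_step_kill add_mult_distrib funpow_add o_apply)
  then have eq: "grid_killed D m n (q + r) s f z =
     (\<integral>\<^sup>+w. indicator (grid_stays (inner_part D m) z (s / 2 ^ n) (q * 2 ^ n)) w * ?g n (z + X (real q * s) w) \<partial>M)" for n
    by (subst grid_killed_eq[OF s, symmetric]) auto
  show "(\<lambda>n. grid_killed D m n (q + r) s f z) \<longlonglongrightarrow>
     killed (inner_part D m) (real q * s) (killed (inner_part D m) (real r * s) f) z"
    unfolding eq unfolding killed_def[of _ "real q * s"]
    by (rule nn_integral_indicator_tendsto[OF _ _ _ _ grid_killed_le_bound[OF s f c(1)] c(2)])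
      (auto intro: grid_stays_eventually_stays s grid_killed_tendsto[OF s f c])
qed

lemma killed_semigroup:
  assumes D: "open D" and s: "0 < s"
    and f [measurable]: "f \<in> borel_measurable borel" and c: "\<And>x. f x \<le> c" "c < \<infinity>"
  shows "killed D (real (q + r) * s) f z = killed D (real q * s) (killed D (real r * s) f) z"
proof (rule LIMSEQ_unique)
  show "(\<lambda>m. killed (inner_part D m) (real (q + r) * s) f z) \<longlonglongrightarrow> killed D (real (q + r) * s) f z"
    by (rule killed_inner_part_tendsto[OF D f c])
  show "(\<lambda>m. killed (inner_part D m) (real (q + r) * s) f z) \<longlonglongrightarrow> killed D (real q * s) (killed D (real r * s) f) z"
    unfolding killed_inner_part_semigroup[OF s f c] killed_def[of _ "real q * s"]
    by (rule nn_integral_indicator_tendsto[OF _ _ _ _ killed_le_bound[OF c(1)] c(2)])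
      (auto intro: stays_inner_part_eventually_stays indicator_stays_borel killed_borel D
        killed_inner_part_tendsto[OF D f c])
qed

lemma stays_subset: "w \<in> space M \<Longrightarrow> 0 \<le> t \<Longrightarrow> w \<in> stays D z t \<Longrightarrow> z \<in> D \<and> z + X t w \<in> D"
proof -
  assume w: "w \<in> space M" and t: "0 \<le> t" and st: "w \<in> stays D z t"
  have "z + X 0 w \<in> D" "z + X t w \<in> D" using st t by (auto simp: stays_def)
  then show ?thesis using X_zero[OF w] by simp
qed

lemma killed_le_indicator:
  assumes "\<And>x. f x \<le> c" "0 \<le> t" "D \<subseteq> D'" shows "killed D t f z \<le> c * indicator D' z"
proof (cases "z \<in> D")
  case False
  have "killed D t f z = (\<integral>\<^sup>+w. 0 \<partial>M)"
    unfolding killed_def using stays_subset[of _ t D z] False assms(2)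
    by (intro nn_integral_cong) (auto simp: indicator_def)
  then show ?thesis by simp
next
  case True
  then show ?thesis using assms(3) killed_le_bound[OF assms(1), where D=D] by auto
qed

text \<open>Symmetry of the iterated kernel passes through both limits; \<open>c\<close>,
  \<open>d\<close> and the finite volume of \<open>D\<close> supply the domination.\<close>

lemma killed_symmetric:
  assumes D: "open D" "bounded D" and s: "0 < s"
    and f [measurable]: "f \<in> borel_measurable borel" and c: "\<And>x. f x \<le> c" "c < \<infinity>"
    and g [measurable]: "g \<in> borel_measurable borel" and d: "\<And>x. g x \<le> d" "d < \<infinity>"
  shows "(\<integral>\<^sup>+x. g x * killed D s f x \<partial>lborel) = (\<integral>\<^sup>+x. f x * killed D s g x \<partial>lborel)"
proof -
  have DM: "D \<in> sets borel" "emeasure lborel D < \<infinity>"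
    using D emeasure_bounded_finite by auto
  have grid_lim: "(\<lambda>n. \<integral>\<^sup>+x. g x * grid_killed D m n 1 s f x \<partial>lborel) \<longlonglongrightarrow>
      (\<integral>\<^sup>+x. g x * killed (inner_part D m) s f x \<partial>lborel)"
    if [measurable]: "f \<in> borel_measurable borel" "g \<in> borel_measurable borel"
      and c: "\<And>x. f x \<le> c" "c < \<infinity>" and d: "\<And>x. g x \<le> d" "d < \<infinity>" for f g c d m
  proof (rule nn_integral_mult_tendsto[OF DM d c(2)])
    show "grid_killed D m n 1 s f x \<le> c * indicator D x" for n x
    proof (cases "x \<in> D")
      case False
      then have "x \<notin> inner_part D m" using inner_part_subset[of D m] by auto
      have "grid_killed D m n 1 s f x = indicator (inner_part D m) x * grid_killed D m n 1 s f x"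
        by (rule indicator_funpow_step_kill[symmetric])
      also have "\<dots> = 0" using \<open>x \<notin> inner_part D m\<close> by simp
      finally show ?thesis by simp
    qed (simp add: grid_killed_le_bound[OF s that(1) c(1)] del: mult_1 One_nat_def)
    show "(\<lambda>n. grid_killed D m n 1 s f x) \<longlonglongrightarrow> killed (inner_part D m) s f x" for x
      using grid_killed_tendsto[OF s that(1) c, where q=1] by simp
  qed measurable
  have "(\<integral>\<^sup>+x. g x * grid_killed D m n 1 s f x \<partial>lborel) = (\<integral>\<^sup>+x. f x * grid_killed D m n 1 s g x \<partial>lborel)" for m n
  proof -
    let ?K = "inner_part D m"
    \<comment> \<open>The iterate vanishes outside \<open>?K\<close>, so the indicator may be moved
      onto \<open>g\<close>; both sides of the pairing then have the same cut-off form.\<close>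
    have "(\<integral>\<^sup>+x. g x * grid_killed D m n 1 s f x \<partial>lborel) =
        (\<integral>\<^sup>+x. (indicator ?K x * g x) * grid_killed D m n 1 s f x \<partial>lborel)"
      by (subst (1) indicator_funpow_step_kill[symmetric]) (simp only: mult_ac)
    also have "\<dots> = (\<integral>\<^sup>+x. grid_killed D m n 1 s g x * (indicator ?K x * f x) \<partial>lborel)"
      by (rule funpow_step_kill_symmetric) measurable
    also have "\<dots> = (\<integral>\<^sup>+x. f x * (indicator ?K x * grid_killed D m n 1 s g x) \<partial>lborel)"
      by (simp only: mult_ac)
    also have "\<dots> = (\<integral>\<^sup>+x. f x * grid_killed D m n 1 s g x \<partial>lborel)"
      by (simp only: indicator_funpow_step_kill)
    finally show ?thesis .
  qed
  then have inner: "(\<integral>\<^sup>+x. g x * killed (inner_part D m) s f x \<partial>lborel) =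
      (\<integral>\<^sup>+x. f x * killed (inner_part D m) s g x \<partial>lborel)" for m
    using LIMSEQ_unique[OF grid_lim[OF f g c d, of m]] grid_lim[OF g f d c, of m] by simp
  have inner_lim: "(\<lambda>m. \<integral>\<^sup>+x. g x * killed (inner_part D m) s f x \<partial>lborel) \<longlonglongrightarrow> (\<integral>\<^sup>+x. g x * killed D s f x \<partial>lborel)"
    if [measurable]: "f \<in> borel_measurable borel" "g \<in> borel_measurable borel"
      and c: "\<And>x. f x \<le> c" "c < \<infinity>" and d: "\<And>x. g x \<le> d" "d < \<infinity>" for f g c d
    by (rule nn_integral_mult_tendsto[OF DM d c(2)])
      (use s that D in \<open>auto intro: killed_le_indicator[OF c(1)] subsetD[OF inner_part_subset]
        killed_inner_part_tendsto[OF D(1) that(1) c] killed_borel\<close>)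
  show ?thesis
    using LIMSEQ_unique[OF inner_lim[OF f g c d]] inner_lim[OF g f d c] unfolding inner by simp
qed

text \<open>Forgetting the killing before time \<open>t\<close> leaves the free heat kernel, which
  is at most its value at the origin. This is the smoothing from \<open>L^1\<close> to bounded
  functions.\<close>

lemma killed_le_heat:
  assumes D: "open D" and t: "0 < t" and f [measurable]: "f \<in> borel_measurable borel"
  shows "killed D t f z \<le> ennreal ((2 * pi * t) powr (- real DIM('a) / 2)) * (\<integral>\<^sup>+y. indicator D y * f y \<partial>lborel)"
proof -
  have [measurable]: "D \<in> sets borel" using D by auto
  have "killed D t f z \<le> (\<integral>\<^sup>+w. indicator D (z + X t w) * f (z + X t w) \<partial>M)"
    unfolding killed_def using stays_subset[of _ t D z] t
    by (intro nn_integral_mono mult_right_mono) (auto simp: indicator_def)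
  also have "\<dots> = (\<integral>\<^sup>+w. indicator D (z + (X t w - X 0 w)) * f (z + (X t w - X 0 w)) \<partial>M)"
    by (intro nn_integral_cong) (simp add: X_zero)
  also have "\<dots> = (\<integral>\<^sup>+y. ennreal (gauss_density t y) * (indicator D (z + y) * f (z + y)) \<partial>lborel)"
    using nn_integral_increment[of 0 t "\<lambda>y. indicator D (z + y) * f (z + y)"] t by simp
  also have "\<dots> \<le> (\<integral>\<^sup>+y. ennreal ((2 * pi * t) powr (- real DIM('a) / 2)) * (indicator D (z + y) * f (z + y)) \<partial>lborel)"
    using t by (intro nn_integral_mono mult_right_mono ennreal_leI) (auto simp: gauss_density_def mult_left_le)
  also have "\<dots> = ennreal ((2 * pi * t) powr (- real DIM('a) / 2)) * (\<integral>\<^sup>+y. indicator D (z + y) * f (z + y) \<partial>lborel)"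
    by (rule nn_integral_cmult) measurable
  also have "(\<integral>\<^sup>+y. indicator D (z + y) * f (z + y) \<partial>lborel) = (\<integral>\<^sup>+y. indicator D y * f y \<partial>distr lborel borel ((+) z))"
    by (subst nn_integral_distr) auto
  also have "\<dots> = (\<integral>\<^sup>+y. indicator D y * f y \<partial>lborel)"
    by (subst lborel_distr_plus) simp
  finally show ?thesis .
qed

end

section \<open>Uniform decay of the survival probability\<close>

text \<open>For \<open>a k = p k / V\<close> the doubling inequality reads
  \<open>(a k)^2 <= a (Suc k)\<close>, hence
  \<open>(a 0) ^ (2 ^ k) <= a k <= (C / V) * y ^ (2 ^ k)\<close>. If \<open>a 0\<close> exceeded
  \<open>y\<close>, the powers of the quotient would outgrow the constant \<open>C / V\<close>:
  taking roots of order \<open>2 ^ k\<close> erases \<open>C\<close>.\<close>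

lemma le_of_doubling:
  fixes p :: "nat \<Rightarrow> real"
  assumes p: "\<And>k. 0 \<le> p k" "\<And>k. (p k)\<^sup>2 \<le> V * p (Suc k)" and V: "0 < V" and y: "0 < y"
    and C: "\<And>k. p k \<le> C * y ^ (2 ^ k)"
  shows "p 0 \<le> V * y"
proof (rule ccontr)
  assume "\<not> p 0 \<le> V * y"
  then have gt: "1 < p 0 / V / y"
    using V y by (simp add: field_simps)
  have "(p 0 / V) ^ (2 ^ k) \<le> p k / V" for k
  proof (induction k)
    case (Suc k)
    have "(p 0 / V) ^ (2 ^ Suc k) = ((p 0 / V) ^ (2 ^ k))\<^sup>2"
      by (simp add: power_mult[symmetric] mult.commute)
    also have "\<dots> \<le> (p k / V)\<^sup>2"
      using Suc p(1) V by (intro power_mono) auto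
    also have "\<dots> \<le> V * p (Suc k) / V\<^sup>2"
      using p(2)[of k] V by (simp add: power_divide divide_right_mono)
    also have "\<dots> = p (Suc k) / V" using V by (simp add: power2_eq_square)
    finally show ?case .
  qed simp
  then have "(p 0 / V) ^ (2 ^ k) \<le> C / V * y ^ (2 ^ k)" for k
    using order_trans[OF _ divide_right_mono[OF C[of k], of V]] V by auto
  then have "(p 0 / V / y) ^ (2 ^ k) \<le> C / V" for k
    using y by (subst power_divide) (simp add: pos_divide_le_eq)
  moreover obtain n where n: "C / V < (p 0 / V / y) ^ n"
    using real_arch_pow[OF gt] by blast
  moreover have "(p 0 / V / y) ^ n \<le> (p 0 / V / y) ^ (2 ^ n)"
    using gt by (intro power_increasing) (auto simp: less_imp_le)
  ultimately show False by (metis leD order_less_le_trans)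
qed

text \<open>The semigroup law is available along multiples of a common step. Its first step should
  be at least 1, to control the heat kernel, and at most 2, to control \<open>exp (lam * s)\<close>.
  The choice is \<open>s = t / floor t\<close>.\<close>

lemma split_time:
  fixes t :: real assumes "2 \<le> t"
  obtains s q where "1 \<le> s" "s \<le> 2" "1 \<le> q" "t = real (1 + q) * s" "t - s = real q * s"
proof -
  define q where "q = nat \<lfloor>t\<rfloor> - 1"
  have f: "2 \<le> \<lfloor>t\<rfloor>" using assms by linarith
  then have q: "real (1 + q) = of_int \<lfloor>t\<rfloor>" "1 \<le> q" unfolding q_def by (auto, linarith)
  define s where "s = t / real (1 + q)"
  have 1: "real (1 + q) * s = t" by (simp add: s_def)
  have "1 \<le> s" "s \<le> 2"
    unfolding s_def q(1) using f by (auto simp: divide_simps) linarith+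
  then show ?thesis using that[of s q] q(2) 1 by (simp add: algebra_simps)
qed

context brownian
begin

lemma killed_add:
  assumes D: "open D" and [measurable]: "f \<in> borel_measurable borel" "g \<in> borel_measurable borel"
  shows "killed D t (\<lambda>x. f x + g x) z = killed D t f z + killed D t g z"
proof -
  have [measurable]: "(\<lambda>w. indicator (stays D z t) w :: ennreal) \<in> borel_measurable M"
    using D by (intro indicator_stays_borel) auto
  show ?thesis
    unfolding killed_def distrib_left by (rule nn_integral_add) measurable
qed

lemma killed_mono: "(\<And>x. f x \<le> g x) \<Longrightarrow> killed D t f z \<le> killed D t g z"
  unfolding killed_def by (intro nn_integral_mono mult_left_mono) auto

lemma killed_cmult:
  assumes D: "open D" and [measurable]: "f \<in> borel_measurable borel"
  shows "killed D t (\<lambda>x. c * f x) z = c * killed D t f z"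
proof -
  have [measurable]: "(\<lambda>w. indicator (stays D z t) w :: ennreal) \<in> borel_measurable M"
    using D by (intro indicator_stays_borel) auto
  have "killed D t (\<lambda>x. c * f x) z = (\<integral>\<^sup>+w. c * (indicator (stays D z t) w * f (z + X t w)) \<partial>M)"
    by (simp add: killed_def mult_ac)
  also have "\<dots> = c * killed D t f z"
    unfolding killed_def by (rule nn_integral_cmult) measurable
  finally show ?thesis .
qed

lemma killed_indicator:
  assumes "0 \<le> t"
  shows "killed D t (\<lambda>x. indicator D x * f x) z = killed D t f z"
  unfolding killed_def using stays_subset[of _ t D z] assms
  by (intro nn_integral_cong) (auto simp: indicator_def)

definition survival :: "'a set \<Rightarrow> real \<Rightarrow> 'a \<Rightarrow> real" where
  "survival D t z = prob (stays D z t \<inter> space M)"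

lemma killed_one:
  assumes "open D"
  shows "killed D t (\<lambda>_. 1) z = ennreal (survival D t z)"
proof -
  have "killed D t (\<lambda>_. 1) z = (\<integral>\<^sup>+w. indicator (stays D z t \<inter> space M) w \<partial>M)"
    unfolding killed_def by (intro nn_integral_cong) (auto simp: indicator_def)
  also have "\<dots> = emeasure M (stays D z t \<inter> space M)"
    using assms stays_borel[of D z t] by simp
  finally show ?thesis by (simp add: survival_def emeasure_eq_measure)
qed

lemma survival_nonneg: "0 \<le> survival D t z"
  and survival_le_1: "survival D t z \<le> 1"
  by (simp_all add: survival_def)

lemma survival_borel:
  assumes "open D" shows "survival D t \<in> borel_measurable borel"
proof -
  have "survival D t = (\<lambda>z. enn2real (killed D t (\<lambda>_. 1) z))"
    using killed_one[OF assms] by (simp add: survival_nonneg)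
  moreover have "killed D t (\<lambda>_. 1) \<in> borel_measurable borel"
    using assms by (intro killed_borel) auto
  ultimately show ?thesis by simp
qed

lemma survival_outside: "0 \<le> t \<Longrightarrow> z \<notin> D \<Longrightarrow> survival D t z = 0"
  using stays_subset[of _ t D z] by (auto simp: survival_def intro!: arg_cong[where f=prob, of _ "{}", simplified])

lemma killed_one_eq: "open D \<Longrightarrow> killed D t (\<lambda>_. 1) = (\<lambda>z. ennreal (survival D t z))"
  by (simp add: killed_one fun_eq_iff)

lemma survival_step:
  assumes D: "open D" and s: "0 < s"
  shows "ennreal (survival D (real (1 + q) * s) z) = killed D s (\<lambda>x. ennreal (survival D (real q * s) x)) z"
  using killed_semigroup[OF D s, of "\<lambda>_. 1" 1 1 q z] by (simp add: killed_one_eq[OF D])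

text \<open>Cauchy-Schwarz bounds the square by \<open>|A|\<close> times the squared
  \<open>L^2\<close> norm of \<open>P_t 1_A\<close>; symmetry and the semigroup law identify that
  norm with the pairing at time \<open>2 * t\<close>.\<close>

lemma killed_doubling:
  assumes D: "open D" "bounded D" and t: "0 < t" and A [measurable]: "A \<in> sets borel" and AD: "A \<subseteq> D"
  shows "(\<integral>\<^sup>+x. indicator A x * killed D t (indicator A) x \<partial>lborel)\<^sup>2 \<le>
    emeasure lborel D * (\<integral>\<^sup>+x. indicator A x * killed D (2 * t) (indicator A) x \<partial>lborel)"
proof -
  have [measurable]: "D \<in> sets borel" using D by auto
  let ?g = "killed D t (indicator A)"
  have [measurable]: "?g \<in> borel_measurable borel"
    using D by (intro killed_borel) auto
  have g1: "?g x \<le> 1" for x by (rule killed_le_bound) (simp add: indicator_def)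
  have "(\<integral>\<^sup>+x. indicator A x * ?g x \<partial>lborel)\<^sup>2 \<le>
      (\<integral>\<^sup>+x. (indicator A x)\<^sup>2 \<partial>lborel) * (\<integral>\<^sup>+x. (?g x)\<^sup>2 \<partial>lborel)"
    by (rule Cauchy_Schwarz_nn_integral) measurable
  also have "(\<integral>\<^sup>+x. (indicator A x)\<^sup>2 \<partial>lborel) = (\<integral>\<^sup>+x. indicator A x \<partial>lborel)"
    by (intro nn_integral_cong) (simp add: indicator_def)
  also have "\<dots> \<le> emeasure lborel D"
    using AD by (simp add: emeasure_mono)
  also have "(\<integral>\<^sup>+x. (?g x)\<^sup>2 \<partial>lborel) = (\<integral>\<^sup>+x. indicator A x * killed D t ?g x \<partial>lborel)"
    unfolding power2_eq_square
    by (rule killed_symmetric[OF D t, symmetric]) (use g1 in \<open>auto simp: indicator_def\<close>)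
  also have "killed D t ?g = killed D (2 * t) (indicator A)"
    using killed_semigroup[OF D(1) t, of "indicator A" 1 1 1] by (simp add: fun_eq_iff indicator_def)
  finally show ?thesis by (simp add: mult_right_mono)
qed

text \<open>The killed semigroup is symmetric, so the doubling inequality forces an exponential bound with
  the sharp rate and without any constant on \<open>\<integral> 1\<^sub>A P\<^sub>s 1\<^sub>A\<close> as soon as the survival
  probability decays with that rate on \<open>A\<close>; such sets \<open>A\<close> exhaust the domain.\<close>

lemma nn_integral_survival_le:
  assumes D: "open D" "bounded D" and s: "0 < s"
    and lim: "\<And>z. z \<in> D \<Longrightarrow> ((\<lambda>t. exp (lam * t) * survival D t z) \<longlongrightarrow> L z) at_top"
  shows "(\<integral>\<^sup>+x. ennreal (survival D s x) \<partial>lborel) \<le> emeasure lborel D * ennreal (exp (- lam * s))"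
proof -
  have [measurable]: "D \<in> sets borel" "survival D t \<in> borel_measurable borel" for t
    using D survival_borel by auto
  have finD: "emeasure lborel D < \<infinity>" using D(2) by (rule emeasure_bounded_finite)
  define V where "V = measure lborel D"
  have V: "emeasure lborel D = ennreal V" unfolding V_def
    using finD by (simp add: emeasure_eq_ennreal_measure)
  have V0: "0 \<le> V" by (simp add: V_def)
  \<comment> \<open>Starting points at which the decay holds with constant \<open>N\<close> along
    the times \<open>2 ^ k * s\<close>, the only times that the doubling argument visits.\<close>
  define A where "A N = {z\<in>D. \<forall>k. exp (lam * (2 ^ k * s)) * survival D (2 ^ k * s) z \<le> real N}" for N :: nat
  have A [measurable]: "A N \<in> sets borel" for N
    unfolding A_def by measurable
  have AD: "A N \<subseteq> D" for N by (auto simp: A_def)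
  define \<phi> where "\<phi> N t = (\<integral>\<^sup>+x. indicator (A N) x * killed D t (indicator (A N)) x \<partial>lborel)" for N t
  have \<phi>_le: "\<phi> N t \<le> (\<integral>\<^sup>+x. indicator (A N) x * ennreal (survival D t x) \<partial>lborel)" for N t
    unfolding \<phi>_def killed_one[OF D(1), symmetric]
    by (intro nn_integral_mono mult_left_mono killed_mono) (auto simp: indicator_def)
  have \<phi>_V: "\<phi> N t \<le> V" for N t
  proof -
    have "\<phi> N t \<le> (\<integral>\<^sup>+x. indicator D x \<partial>lborel)"
      using AD[of N] survival_le_1 by (intro order_trans[OF \<phi>_le] nn_integral_mono) (auto simp: indicator_def)
    then show ?thesis by (simp add: V)
  qed
  have \<phi>_fin: "ennreal (enn2real (\<phi> N t)) = \<phi> N t" for N t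
    using \<phi>_V[of N t] by (metis ennreal_enn2real ennreal_less_top order_le_less_trans)
  have bound: "\<phi> N s \<le> ennreal (V * exp (- lam * s))" for N
  proof (cases "V = 0")
    case True
    then show ?thesis using \<phi>_V[of N s] by simp
  next
    case False
    \<comment> \<open>Incrementing \<open>k\<close> doubles the time. Membership in
      \<open>A N\<close> bounds \<open>p k\<close> by \<open>N * V\<close> times the expected
      exponential, a constant that \<open>le_of_doubling\<close> removes.\<close>
    define p where "p k = enn2real (\<phi> N (2 ^ k * s))" for k
    have "p 0 \<le> V * exp (- lam * s)"
    proof (rule le_of_doubling[where C="real N * V"])
      show "0 < V" using False V0 by simp
      show "(p k)\<^sup>2 \<le> V * p (Suc k)" for k
      proof -
        have "(\<phi> N (2 ^ k * s))\<^sup>2 \<le> ennreal V * \<phi> N (2 * (2 ^ k * s))"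
          unfolding \<phi>_def V[symmetric] using s by (intro killed_doubling D AD A) auto
        then have "ennreal ((p k)\<^sup>2) \<le> ennreal (V * p (Suc k))"
          using V0 by (simp add: p_def ennreal_power[symmetric] ennreal_mult \<phi>_fin mult.assoc)
        then show ?thesis using V0 by (subst (asm) ennreal_le_iff) (auto simp: p_def)
      qed
      show "p k \<le> real N * V * exp (- lam * s) ^ 2 ^ k" for k
      proof -
        let ?t = "2 ^ k * s"
        have "\<phi> N ?t \<le> (\<integral>\<^sup>+x. ennreal (real N * exp (- lam * ?t)) * indicator D x \<partial>lborel)"
        proof (intro order_trans[OF \<phi>_le] nn_integral_mono)
          fix x
          show "indicator (A N) x * ennreal (survival D ?t x) \<le> ennreal (real N * exp (- lam * ?t)) * indicator D x"
          proof (cases "x \<in> A N")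
            case True
            then have "exp (lam * ?t) * survival D ?t x \<le> real N" by (simp add: A_def)
            then have "survival D ?t x \<le> real N * exp (- lam * ?t)"
              by (simp add: exp_minus field_simps)
            with True AD[of N] show ?thesis by (auto intro!: ennreal_leI)
          qed simp
        qed
        also have "\<dots> = ennreal (real N * exp (- lam * ?t) * V)"
          by (simp add: nn_integral_cmult_indicator V ennreal_mult V0)
        finally have "p k \<le> real N * exp (- lam * ?t) * V"
          unfolding p_def using V0 by (intro enn2real_leI) auto
        also have "exp (- lam * ?t) = exp (- lam * s) ^ 2 ^ k"
          by (subst exp_of_nat_mult[symmetric]) (simp add: mult_ac)
        finally show ?thesis by (simp add: mult_ac)
      qed
    qed (auto simp: p_def)
    then have "ennreal (p 0) \<le> ennreal (V * exp (- lam * s))" by (rule ennreal_leI)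
    then show ?thesis by (simp add: p_def \<phi>_fin)
  qed
  \<comment> \<open>A point of \<open>D\<close> enters \<open>A N\<close> for large
    \<open>N\<close>, because a convergent sequence is bounded.\<close>
  have ev: "\<forall>\<^sub>F N in sequentially. indicator (A N) z = (indicator D z :: ennreal)" for z
  proof (cases "z \<in> D")
    case True
    have "filterlim (\<lambda>k::nat. 2 ^ k * s) at_top sequentially"
    proof (rule filterlim_at_top_mono)
      show "filterlim (\<lambda>k. s * real k) at_top sequentially"
        using s by (rule filterlim_tendsto_pos_mult_at_top[OF tendsto_const _ filterlim_real_sequentially])
      have "real k \<le> 2 ^ k" for k
        using of_nat_less_two_power[of k, where ?'a=real] by simp
      then show "\<forall>\<^sub>F k in sequentially. s * real k \<le> 2 ^ k * s"
        using s by (simp add: mult.commute)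
    qed
    with lim[OF True] have "(\<lambda>k. exp (lam * (2 ^ k * s)) * survival D (2 ^ k * s) z) \<longlonglongrightarrow> L z"
      by (rule filterlim_compose)
    then have "Bseq (\<lambda>k. exp (lam * (2 ^ k * s)) * survival D (2 ^ k * s) z)"
      by (rule convergent_imp_Bseq[OF convergentI])
    then obtain B where B: "\<And>k. norm (exp (lam * (2 ^ k * s)) * survival D (2 ^ k * s) z) \<le> B"
      by (auto simp: Bseq_def)
    have "z \<in> A N" if "nat \<lceil>B\<rceil> \<le> N" for N
    proof -
      have "B \<le> real N" using that by linarith
      then have "exp (lam * (2 ^ k * s)) * survival D (2 ^ k * s) z \<le> real N" for k
        using B[of k] unfolding real_norm_def by linarith
      then show ?thesis using True by (simp add: A_def)
    qed
    then have "\<forall>\<^sub>F N in sequentially. z \<in> A N" by (rule eventually_sequentiallyI)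
    then show ?thesis by (rule eventually_mono) (simp add: True)
  next
    case False
    then have "z \<notin> A N" for N using AD[of N] by blast
    then show ?thesis using False by (auto simp: indicator_def)
  qed
  have [measurable]: "killed D s (indicator (A N)) \<in> borel_measurable borel" "killed D s (indicator D) \<in> borel_measurable borel" for N
    using D by (auto intro!: killed_borel)
  have kil: "(\<lambda>N. killed D s (indicator (A N)) x) \<longlonglongrightarrow> killed D s (indicator D) x" for x
    unfolding killed_def
  proof (rule nn_integral_indicator_tendsto[where c=1])
    show "(\<lambda>N. indicator (A N) y) \<longlonglongrightarrow> (indicator D y :: ennreal)" for y
      using ev by (rule tendsto_eventually)
    show "(\<lambda>w. indicator (stays D x s) w :: ennreal) \<in> borel_measurable M"
      "(\<lambda>w. indicator (stays D x s) w :: ennreal) \<in> borel_measurable M"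
      using D by (auto intro: indicator_stays_borel)
  qed (auto simp: indicator_def)
  \<comment> \<open>With \<open>A N\<close> exhausting \<open>D\<close>, the pairing tends to the
    integral of the survival probability, which already vanishes outside \<open>D\<close>.\<close>
  have "(\<lambda>N. \<phi> N s) \<longlonglongrightarrow> (\<integral>\<^sup>+x. indicator D x * killed D s (indicator D) x \<partial>lborel)"
    unfolding \<phi>_def
  proof (rule nn_integral_dominated_convergence[where w="indicator D"])
    show "AE x in lborel. (\<lambda>N. indicator (A N) x * killed D s (indicator (A N)) x) \<longlonglongrightarrow>
        indicator D x * killed D s (indicator D) x"
    proof (rule AE_I2)
      fix x
      have "(\<lambda>N. indicator D x * killed D s (indicator (A N)) x) \<longlonglongrightarrow> indicator D x * killed D s (indicator D) x"
        by (intro ennreal_tendsto_cmult kil) (auto simp: indicator_def)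
      moreover have "\<forall>\<^sub>F N in sequentially. indicator D x * killed D s (indicator (A N)) x =
          indicator (A N) x * killed D s (indicator (A N)) x"
        using ev[of x] by eventually_elim simp
      ultimately show "(\<lambda>N. indicator (A N) x * killed D s (indicator (A N)) x) \<longlonglongrightarrow>
          indicator D x * killed D s (indicator D) x"
        by (rule Lim_transform_eventually)
    qed
    have "killed D s (indicator (A N)) x \<le> 1" for N x
      by (rule killed_le_bound) (simp add: indicator_def)
    then show "AE x in lborel. indicator (A N) x * killed D s (indicator (A N)) x \<le> indicator D x" for N
      using AD[of N] by (intro AE_I2) (auto simp: indicator_def)
  qed (use finD in auto)
  then have "(\<integral>\<^sup>+x. indicator D x * killed D s (indicator D) x \<partial>lborel) \<le> ennreal (V * exp (- lam * s))"
    by (rule LIMSEQ_le_const2) (use bound in auto)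
  moreover have "killed D s (indicator D) x = ennreal (survival D s x)" for x
    using killed_indicator[of s D "\<lambda>_. 1" x] s killed_one[OF D(1)] by simp
  moreover have "indicator D x * ennreal (survival D s x) = ennreal (survival D s x)" for x
    using survival_outside[of s x D] s by (auto simp: indicator_def)
  ultimately show ?thesis using V0 by (simp add: V ennreal_mult)
qed

text \<open>Both parts spend one step of length between 1 and 2 on smoothing. For the second, the
  limit is a fixed point of \<open>exp (lam * s) * P_s\<close>, so the error at time
  \<open>t\<close> is controlled by the image of the error at time \<open>t - s\<close>, whose
  \<open>L^1\<close> norm tends to zero.\<close>

lemma survival_bounded_and_uniform:
  assumes D: "open D" "bounded D" and lam: "0 \<le> lam"
    and lim: "\<And>z. z \<in> D \<Longrightarrow> ((\<lambda>t. exp (lam * t) * survival D t z) \<longlongrightarrow> L z) at_top"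
  shows "\<exists>B. \<forall>z t. 0 \<le> t \<longrightarrow> exp (lam * t) * survival D t z \<le> B"
    and "uniform_limit D (\<lambda>t z. exp (lam * t) * survival D t z) L at_top"
proof -
  define a where "a t z = exp (lam * t) * survival D t z" for t z
  have [measurable]: "D \<in> sets borel" "survival D t \<in> borel_measurable borel" for t
    using D survival_borel by auto
  have a_meas [measurable]: "a t \<in> borel_measurable borel" for t
    unfolding a_def by measurable
  have a_nonneg: "0 \<le> a t z" for t z by (simp add: a_def survival_nonneg)
  have finD: "emeasure lborel D < \<infinity>" using D(2) by (rule emeasure_bounded_finite)
  define V where "V = measure lborel D"
  have V: "emeasure lborel D = ennreal V" unfolding V_def
    using finD by (simp add: emeasure_eq_ennreal_measure)
  have V0: "0 \<le> V" by (simp add: V_def)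
  have heat_const: "(2 * pi * s) powr (- real DIM('a) / 2) \<le> 1" if "1 \<le> s" for s
  proof -
    have "1 \<le> 2 * pi * s" using that pi_ge_two mult_mono[of 1 "2 * pi" 1 s] by simp
    then show ?thesis using powr_mono[of "- real DIM('a) / 2" 0 "2 * pi * s"] that by simp
  qed
  have heat: "killed D s f z \<le> (\<integral>\<^sup>+y. indicator D y * f y \<partial>lborel)"
    if s: "1 \<le> s" and f: "f \<in> borel_measurable borel" for s f z
  proof -
    have "killed D s f z \<le> ennreal ((2 * pi * s) powr (- real DIM('a) / 2)) * (\<integral>\<^sup>+y. indicator D y * f y \<partial>lborel)"
      using s by (intro killed_le_heat D f) auto
    also have "\<dots> \<le> 1 * (\<integral>\<^sup>+y. indicator D y * f y \<partial>lborel)"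
      using heat_const[OF s] by (intro mult_right_mono) auto
    finally show ?thesis by simp
  qed
  have a_step: "ennreal (a (real (1 + q) * s) z) = ennreal (exp (lam * s)) * killed D s (\<lambda>x. ennreal (a (real q * s) x)) z"
    if s: "0 < s" for q s z
  proof -
    have "killed D s (\<lambda>x. ennreal (a (real q * s) x)) z =
        ennreal (exp (lam * (real q * s))) * killed D s (\<lambda>x. ennreal (survival D (real q * s) x)) z"
      unfolding a_def by (subst killed_cmult[OF D(1), symmetric]) (auto simp: ennreal_mult survival_nonneg)
    then have "ennreal (exp (lam * s)) * killed D s (\<lambda>x. ennreal (a (real q * s) x)) z =
       ennreal (exp (lam * s)) * (ennreal (exp (lam * (real q * s))) * ennreal (survival D (real (1 + q) * s) z))"
      by (simp only: survival_step[OF D(1) s])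
    also have "\<dots> = ennreal (exp (lam * s) * (exp (lam * (real q * s)) * survival D (real (1 + q) * s) z))"
      by (simp add: ennreal_mult survival_nonneg)
    also have "exp (lam * s) * (exp (lam * (real q * s)) * survival D (real (1 + q) * s) z) = a (real (1 + q) * s) z"
    proof -
      have "exp (lam * s) * exp (lam * (real q * s)) = exp (lam * (real (1 + q) * s))"
        by (simp add: exp_add[symmetric] algebra_simps)
      then show ?thesis by (simp only: a_def mult.assoc[symmetric])
    qed
    finally show ?thesis by simp
  qed
  \<comment> \<open>\<open>V * exp (lam * s)\<close> with \<open>s <= 2\<close> serves the times
    \<open>t >= 2\<close>, and \<open>exp (lam * t)\<close> the earlier ones; \<open>B\<close>
    dominates both.\<close>
  define B where "B = (V + 1) * exp (2 * lam)"
  have a_bound: "a t z \<le> B" if "0 \<le> t" for t z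
  proof (cases "2 \<le> t")
    case False
    have "a t z \<le> exp (lam * t) * 1"
      unfolding a_def by (intro mult_left_mono survival_le_1) auto
    also have "\<dots> \<le> 1 * exp (2 * lam)"
      using False lam that by (simp add: mult_left_mono mult.commute)
    also have "\<dots> \<le> B" unfolding B_def using V0 by (intro mult_right_mono) auto
    finally show ?thesis .
  next
    case True
    then obtain s q where sq: "1 \<le> s" "s \<le> 2" "1 \<le> q" "t = real (1 + q) * s" "t - s = real q * s"
      by (rule split_time)
    have "ennreal (survival D t z) = killed D s (\<lambda>x. ennreal (survival D (real q * s) x)) z"
      unfolding sq(4) using sq(1) by (intro survival_step D) auto
    also have "\<dots> \<le> (\<integral>\<^sup>+y. indicator D y * ennreal (survival D (real q * s) y) \<partial>lborel)"
      by (rule heat[OF sq(1)]) measurable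
    also have "\<dots> \<le> (\<integral>\<^sup>+y. ennreal (survival D (real q * s) y) \<partial>lborel)"
      by (intro nn_integral_mono) (auto simp: indicator_def)
    also have "\<dots> \<le> emeasure lborel D * ennreal (exp (- lam * (real q * s)))"
      using sq by (intro nn_integral_survival_le[OF D _ lim]) auto
    also have "\<dots> = ennreal (V * exp (- lam * (t - s)))"
      unfolding sq(5) using V0 by (simp add: V ennreal_mult)
    finally have "survival D t z \<le> V * exp (- lam * (t - s))"
      using V0 by (subst (asm) ennreal_le_iff) auto
    then have "a t z \<le> exp (lam * t) * (V * exp (- lam * (t - s)))"
      unfolding a_def by (intro mult_left_mono) auto
    also have "\<dots> = V * exp (lam * s)"
    proof -
      have "exp (lam * t) * exp (- lam * (t - s)) = exp (lam * s)"
        by (simp add: exp_add[symmetric] algebra_simps)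
      then show ?thesis by (simp only: mult.left_commute)
    qed
    also have "\<dots> \<le> B" unfolding B_def using V0 sq(2) lam
      by (intro mult_mono) (auto simp: mult.commute[of 2] mult_left_mono)
    finally show ?thesis .
  qed
  then show "\<exists>B. \<forall>z t. 0 \<le> t \<longrightarrow> exp (lam * t) * survival D t z \<le> B"
    unfolding a_def by blast

  \<comment> \<open>The limit is extended by zero, in agreement with survival from outside
    \<open>D\<close>, so convergence holds at every point of the space.\<close>
  define A where "A z = (if z \<in> D then L z else 0)" for z
  have a_lim: "((\<lambda>t. a t z) \<longlongrightarrow> A z) at_top" for z
  proof (cases "z \<in> D")
    case True
    then show ?thesis using lim by (simp add: a_def A_def)
  next
    case False
    have "\<forall>\<^sub>F t in at_top. 0 = a t z"
      using eventually_ge_at_top[of 0] by eventually_elim (simp add: a_def survival_outside False)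
    then show ?thesis using False by (intro Lim_transform_eventually[OF tendsto_const]) (simp_all add: A_def)
  qed
  have A_meas [measurable]: "A \<in> borel_measurable borel"
    by (rule borel_measurable_LIMSEQ_real[OF filterlim_compose[OF a_lim filterlim_real_sequentially]]) measurable
  have A_nonneg: "0 \<le> A z" for z
    by (rule tendsto_lowerbound[OF a_lim]) (auto simp: a_nonneg)
  have A_le: "A z \<le> B" for z
    by (rule tendsto_upperbound[OF a_lim]) (auto simp: a_bound intro: eventually_mono[OF eventually_ge_at_top[of 0]])
  define e where "e t = (\<integral>\<^sup>+x. indicator D x * ennreal \<bar>a t x - A x\<bar> \<partial>lborel)" for t
  have e_lim: "(e \<longlongrightarrow> 0) at_top"
  proof (rule tendsto_at_topI_sequentially)
    fix T :: "nat \<Rightarrow> real" assume T: "filterlim T at_top sequentially"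
    then obtain N where N: "\<And>n. N \<le> n \<Longrightarrow> 0 \<le> T n"
      using filterlim_at_top[of T sequentially] by (auto simp: eventually_sequentially)
    have "(\<lambda>n. e (T (n + N))) \<longlonglongrightarrow> (\<integral>\<^sup>+x. (0::ennreal) \<partial>(lborel :: 'a measure))"
      unfolding e_def
    proof (rule nn_integral_dominated_convergence[where w="\<lambda>x. ennreal B * indicator D x"])
      show "AE x in lborel. (\<lambda>n. indicator D x * ennreal \<bar>a (T (n + N)) x - A x\<bar>) \<longlonglongrightarrow> 0"
      proof (rule AE_I2)
        fix x
        have "(\<lambda>n. a (T (n + N)) x) \<longlonglongrightarrow> A x"
          by (rule LIMSEQ_ignore_initial_segment[OF filterlim_compose[OF a_lim T]])
        then have "(\<lambda>n. ennreal \<bar>a (T (n + N)) x - A x\<bar>) \<longlonglongrightarrow> ennreal \<bar>A x - A x\<bar>"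
          by (intro tendsto_ennrealI tendsto_intros)
        then have "(\<lambda>n. indicator D x * ennreal \<bar>a (T (n + N)) x - A x\<bar>) \<longlonglongrightarrow> indicator D x * ennreal \<bar>A x - A x\<bar>"
          by (intro ennreal_tendsto_cmult) (auto simp: indicator_def)
        then show "(\<lambda>n. indicator D x * ennreal \<bar>a (T (n + N)) x - A x\<bar>) \<longlonglongrightarrow> 0" by simp
      qed
      show "AE x in lborel. indicator D x * ennreal \<bar>a (T (n + N)) x - A x\<bar> \<le> ennreal B * indicator D x" for n
      proof (rule AE_I2)
        fix x
        have "\<bar>a (T (n + N)) x - A x\<bar> \<le> B"
          using a_nonneg[of "T (n + N)" x] a_bound[of "T (n + N)" x] A_nonneg[of x] A_le[of x] N[of "n + N"] by simp
        then show "indicator D x * ennreal \<bar>a (T (n + N)) x - A x\<bar> \<le> ennreal B * indicator D x"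
          by (auto simp: indicator_def ennreal_leI)
      qed
      show "(\<integral>\<^sup>+x. ennreal B * indicator D x \<partial>lborel) < \<infinity>"
        by (simp add: nn_integral_cmult_indicator V ennreal_mult_less_top)
    qed measurable
    then have "(\<lambda>n. e (T (n + N))) \<longlonglongrightarrow> 0" by simp
    then show "(\<lambda>n. e (T n)) \<longlonglongrightarrow> 0" by (rule LIMSEQ_offset)
  qed
  \<comment> \<open>Pass to the limit \<open>q -> \<infinity>\<close> in \<open>a_step\<close>, with
    domination by \<open>B\<close>.\<close>
  have A_inv: "ennreal (A z) = ennreal (exp (lam * s)) * killed D s (\<lambda>x. ennreal (A x)) z"
    if s: "0 < s" for s z
  proof (rule LIMSEQ_unique)
    have Ts: "filterlim (\<lambda>q. real q * s) at_top sequentially"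
      using filterlim_tendsto_pos_mult_at_top[OF tendsto_const s filterlim_real_sequentially] by (simp add: mult.commute)
    have "(\<lambda>q. a (real q * s) z) \<longlonglongrightarrow> A z"
      by (rule filterlim_compose[OF a_lim Ts])
    from LIMSEQ_ignore_initial_segment[OF this, of 1]
    show "(\<lambda>q. ennreal (a (real (1 + q) * s) z)) \<longlonglongrightarrow> ennreal (A z)"
      by (intro tendsto_ennrealI) (simp add: add.commute)
    have "(\<lambda>q. killed D s (\<lambda>x. ennreal (a (real q * s) x)) z) \<longlonglongrightarrow> killed D s (\<lambda>x. ennreal (A x)) z"
      unfolding killed_def
    proof (rule nn_integral_indicator_tendsto[where c="ennreal B"])
      show "(\<lambda>q. ennreal (a (real q * s) x)) \<longlonglongrightarrow> ennreal (A x)" for x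
        by (intro tendsto_ennrealI filterlim_compose[OF a_lim Ts])
      show "ennreal (a (real q * s) x) \<le> ennreal B" for q x
        using s by (intro ennreal_leI a_bound) simp
    qed (use D in \<open>auto intro: indicator_stays_borel\<close>)
    then show "(\<lambda>q. ennreal (a (real (1 + q) * s) z)) \<longlonglongrightarrow> ennreal (exp (lam * s)) * killed D s (\<lambda>x. ennreal (A x)) z"
      unfolding a_step[OF s] by (intro ennreal_tendsto_cmult) auto
  qed
  have diff_bound: "ennreal \<bar>a t z - A z\<bar> \<le> ennreal (exp (2 * lam)) * e (t - s)"
    if sq: "1 \<le> s" "s \<le> 2" "t = real (1 + q) * s" "t - s = real q * s" for t z s q
  proof -
    let ?k = "\<lambda>f. ennreal (exp (lam * s)) * killed D s (\<lambda>x. ennreal (f x)) z"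
    let ?d = "\<lambda>x. \<bar>a (real q * s) x - A x\<bar>"
    have s: "0 < s" using sq by simp
    \<comment> \<open>Differences are awkward in \<open>ennreal\<close>; the absolute difference is
      bounded through two one-sided estimates of this shape, with the roles of \<open>a\<close> and
      \<open>A\<close> exchanged.\<close>
    have add: "?k f \<le> ?k g + ?k ?d"
      if [measurable]: "f \<in> borel_measurable borel" "g \<in> borel_measurable borel"
        and "\<And>x. f x \<le> g x + ?d x" "\<And>x. 0 \<le> g x" for f g
    proof -
      have "killed D s (\<lambda>x. ennreal (f x)) z \<le> killed D s (\<lambda>x. ennreal (g x) + ennreal (?d x)) z"
        using that by (intro killed_mono) (auto simp: ennreal_plus[symmetric] intro!: ennreal_leI simp del: ennreal_plus)
      also have "\<dots> = killed D s (\<lambda>x. ennreal (g x)) z + killed D s (\<lambda>x. ennreal (?d x)) z"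
        by (intro killed_add D) measurable
      finally show ?thesis
        by (metis distrib_left mult_left_mono zero_le)
    qed
    have kd: "?k ?d \<le> ennreal (exp (2 * lam)) * e (t - s)"
    proof (rule mult_mono)
      show "ennreal (exp (lam * s)) \<le> ennreal (exp (2 * lam))"
        using sq lam by (intro ennreal_leI) (simp add: mult.commute[of 2] mult_left_mono)
      show "killed D s (\<lambda>x. ennreal (?d x)) z \<le> e (t - s)"
        unfolding e_def sq(4) by (rule heat[OF sq(1)]) measurable
    qed auto
    show ?thesis
    proof (cases "e (t - s) = \<infinity>")
      case True
      then show ?thesis by (simp add: ennreal_mult_top)
    next
      case False
      define \<epsilon> where "\<epsilon> = enn2real (ennreal (exp (2 * lam)) * e (t - s))"
      have \<epsilon>: "ennreal (exp (2 * lam)) * e (t - s) = ennreal \<epsilon>"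
        unfolding \<epsilon>_def using False
        by (subst ennreal_enn2real) (auto simp: ennreal_mult_less_top less_top)
      have at: "ennreal (a t z) = ?k (a (real q * s))"
        unfolding sq(3) by (rule a_step[OF s])
      have Az: "ennreal (A z) = ?k A" by (rule A_inv[OF s])
      have \<epsilon>0: "0 \<le> \<epsilon>" by (simp add: \<epsilon>_def)
      have "ennreal (a t z) \<le> ennreal (A z) + ennreal \<epsilon>"
        unfolding at Az \<epsilon>[symmetric]
        by (rule order_trans[OF add add_left_mono[OF kd]]) (auto simp: A_nonneg)
      then have 1: "a t z \<le> A z + \<epsilon>"
        using \<epsilon>0 A_nonneg[of z] by (simp add: ennreal_plus[symmetric] del: ennreal_plus)
      have "ennreal (A z) \<le> ennreal (a t z) + ennreal \<epsilon>"
        unfolding at Az \<epsilon>[symmetric]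
        by (rule order_trans[OF add add_left_mono[OF kd]]) (auto simp: a_nonneg)
      then have 2: "A z \<le> a t z + \<epsilon>"
        using \<epsilon>0 a_nonneg[of t z] by (simp add: ennreal_plus[symmetric] del: ennreal_plus)
      from 1 2 show ?thesis unfolding \<epsilon> by (intro ennreal_leI) simp
    qed
  qed
  show "uniform_limit D (\<lambda>t z. exp (lam * t) * survival D t z) L at_top"
    unfolding uniform_limit_iff
  proof (intro allI impI)
    fix \<epsilon> :: real assume \<epsilon>: "\<epsilon> > 0"
    have "\<forall>\<^sub>F t in at_top. e t < ennreal (\<epsilon> / exp (2 * lam))"
      by (rule order_tendstoD(2)[OF e_lim]) (use \<epsilon> in simp)
    then obtain T where T: "\<And>t. T \<le> t \<Longrightarrow> e t < ennreal (\<epsilon> / exp (2 * lam))"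
      by (auto simp: eventually_at_top_linorder)
    have "dist (a t z) (L z) < \<epsilon>" if t: "max 2 (T + 2) \<le> t" and z: "z \<in> D" for t z
    proof -
      have "2 \<le> t" using t by simp
      then obtain s q where sq: "1 \<le> s" "s \<le> 2" "1 \<le> q" "t = real (1 + q) * s" "t - s = real q * s"
        by (rule split_time)
      have "ennreal \<bar>a t z - A z\<bar> \<le> ennreal (exp (2 * lam)) * e (t - s)"
        by (rule diff_bound[OF sq(1,2,4,5)])
      also have "\<dots> < ennreal (exp (2 * lam)) * ennreal (\<epsilon> / exp (2 * lam))"
        using T[of "t - s"] t sq(2) by (intro ennreal_mult_strict_left_mono) auto
      also have "\<dots> = ennreal \<epsilon>"
        using \<epsilon> by (simp add: ennreal_mult[symmetric])
      finally show ?thesis using \<epsilon> z by (simp add: ennreal_less_iff A_def dist_real_def)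
    qed
    then show "\<forall>\<^sub>F t in at_top. \<forall>z\<in>D. dist (exp (lam * t) * survival D t z) (L z) < \<epsilon>"
      unfolding a_def eventually_at_top_linorder by blast
  qed
qed

end

section \<open>Exit of one-dimensional Brownian motion from an interval\<close>

text \<open>The real part of the complex arctangent series at \<open>z = r * cis \<theta>\<close>.
  Where \<open>cos \<theta> > 0\<close>, the right-hand side tends to \<open>pi / 4\<close> as
  \<open>r -> 1\<close>, which is the value of the square wave in this normalisation.\<close>

lemma abel_square_wave_sums:
  fixes r \<theta> :: real
  assumes r: "0 \<le> r" "r < 1"
  shows "(\<lambda>k. (-1) ^ k / real (2 * k + 1) * (r ^ (2 * k + 1) * cos (real (2 * k + 1) * \<theta>)))
    sums (arctan (2 * r * cos \<theta> / (1 - r\<^sup>2)) / 2)"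
proof -
  define z where "z = of_real r * cis \<theta>"
  have nz: "norm z < 1" using r by (simp add: z_def norm_mult)
  have pw: "z ^ n = of_real (r ^ n) * cis (real n * \<theta>)" for n
    by (simp only: z_def power_mult_distrib Complex.DeMoivre of_real_power)
  have "(\<lambda>k. (-1) ^ k / of_nat (2 * k + 1) * z ^ (2 * k + 1)) sums Arctan z"
    by (rule Arctan_series(2)[OF nz])
  then have "(\<lambda>k. Re ((-1) ^ k / of_nat (2 * k + 1) * z ^ (2 * k + 1))) sums Re (Arctan z)"
    by (rule sums_Re)
  moreover have "Re ((-1) ^ k / of_nat (2 * k + 1) * z ^ (2 * k + 1)) =
      (-1) ^ k / real (2 * k + 1) * (r ^ (2 * k + 1) * cos (real (2 * k + 1) * \<theta>))" for k
  proof -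
    have "(-1) ^ k / of_nat (2 * k + 1) * z ^ (2 * k + 1) =
        of_real ((-1) ^ k / real (2 * k + 1)) * (of_real (r ^ (2 * k + 1)) * cis (real (2 * k + 1) * \<theta>))"
      unfolding pw by simp
    then show ?thesis by (simp only: times_complex.sel Re_complex_of_real Im_complex_of_real cis.sel mult_zero_left diff_zero)
  qed
  moreover have "Re (Arctan z) = arctan (2 * r * cos \<theta> / (1 - r\<^sup>2)) / 2"
  proof -
    \<comment> \<open>\<open>Arctan z\<close> is \<open>\<i> / 2\<close> times the logarithm of
      \<open>w\<close>, so its real part is minus half the argument of \<open>w\<close>; since
      \<open>Re w > 0\<close>, that argument is the arctangent of
      \<open>Im w / Re w\<close>.\<close>
    define w where "w = (1 - \<i> * z) / (1 + \<i> * z)"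
    have den: "1 + \<i> * z \<noteq> 0"
    proof
      assume "1 + \<i> * z = 0"
      then have "\<i> * z = -1" by (simp add: eq_neg_iff_add_eq_0 add.commute)
      then have "norm (\<i> * z) = 1" by simp
      then show False using nz by (simp add: norm_mult)
    qed
    define d where "d = (cmod (1 + \<i> * z))\<^sup>2"
    have d: "d > 0" using den by (simp add: d_def)
    have "w = (1 - \<i> * z) * cnj (1 + \<i> * z) / of_real d"
      unfolding w_def d_def by (subst complex_div_cnj) simp
    also have "(1 - \<i> * z) * cnj (1 + \<i> * z) = Complex (1 - r\<^sup>2) (- 2 * r * cos \<theta>)"
    proof (rule complex_eqI)
      have "Re ((1 - \<i> * z) * cnj (1 + \<i> * z)) = 1 - ((r * cos \<theta>)\<^sup>2 + (r * sin \<theta>)\<^sup>2)"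
        by (simp add: z_def algebra_simps power2_eq_square)
      also have "(r * cos \<theta>)\<^sup>2 + (r * sin \<theta>)\<^sup>2 = r\<^sup>2"
        by (simp add: power_mult_distrib distrib_left[symmetric])
      finally show "Re ((1 - \<i> * z) * cnj (1 + \<i> * z)) = Re (Complex (1 - r\<^sup>2) (- 2 * r * cos \<theta>))"
        by simp
      show "Im ((1 - \<i> * z) * cnj (1 + \<i> * z)) = Im (Complex (1 - r\<^sup>2) (- 2 * r * cos \<theta>))"
        by (simp add: z_def algebra_simps)
    qed
    finally have w: "w = Complex (1 - r\<^sup>2) (- 2 * r * cos \<theta>) / of_real d" .
    have Rew: "Re w = (1 - r\<^sup>2) / d" and Imw: "Im w = - (2 * r * cos \<theta>) / d"
      by (simp_all add: w)
    have r2: "r\<^sup>2 < 1" using r by (simp add: abs_square_less_1)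
    have "0 < Re w" using d r2 by (simp add: Rew)
    moreover from this have "w \<noteq> 0" by auto
    ultimately have "Im (Ln w) = arctan (Im w / Re w)"
      using arg_conv_arctan[of w] by (simp add: Arg_def)
    also have "Im w / Re w = - (2 * r * cos \<theta> / (1 - r\<^sup>2))"
      using d by (simp add: Rew Imw)
    finally have "Im (Ln w) = - arctan (2 * r * cos \<theta> / (1 - r\<^sup>2))" by (simp add: arctan_minus)
    then show ?thesis by (simp add: Arctan_def w_def[symmetric])
  qed
  ultimately show ?thesis by simp
qed

lemma integral_std_normal_cos_sin:
  shows "(\<integral>x. cos (t * x) \<partial>std_normal_distribution) = exp (- t\<^sup>2 / 2)"
    and "(\<integral>x. sin (t * x) \<partial>std_normal_distribution) = 0"
proof -
  interpret real_distribution std_normal_distribution by (rule real_dist_normal_dist)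
  have int: "integrable std_normal_distribution (\<lambda>x. iexp (t * x))"
    by (rule integrable_iexp) (auto simp del: of_real_mult simp add: Im_complex_of_real)
  have ch: "(CLINT x|std_normal_distribution. iexp (t * x)) = of_real (exp (- t\<^sup>2 / 2))"
    using char_std_normal_distribution by (simp add: char_def fun_eq_iff)
  show "(\<integral>x. cos (t * x) \<partial>std_normal_distribution) = exp (- t\<^sup>2 / 2)"
    using integral_Re[OF int] ch by (simp add: Re_exp)
  show "(\<integral>x. sin (t * x) \<partial>std_normal_distribution) = 0"
    using integral_Im[OF int] ch by (simp add: Im_exp)
qed

lemma gauss_density_real: "0 < h \<Longrightarrow> gauss_density h (y - x) = normal_density x (sqrt h) y" for x y :: real
proof -
  assume h: "0 < h"
  have "(2 * pi * h) powr (- real DIM(real) / 2) = (2 * pi * h) powr - (1 / 2)" by simp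
  also have "\<dots> = 1 / sqrt (2 * pi * h)"
    unfolding powr_minus_divide using h by (subst powr_half_sqrt) auto
  finally show ?thesis
    using h unfolding gauss_density_def normal_density_def by simp
qed

text \<open>Cosines are eigenfunctions of the heat kernel, by the characteristic function of the
  normal law. Adding 1 makes the integrand nonnegative, as the Markov step for
  \<open>ennreal\<close> functions demands.\<close>

lemma nn_integral_gauss_one_plus_cos:
  fixes x c h :: real
  assumes h: "0 < h"
  shows "(\<integral>\<^sup>+y. ennreal (gauss_density h (y - x)) * ennreal (1 + cos (c * y)) \<partial>lborel) =
    ennreal (1 + exp (- (c\<^sup>2 * h) / 2) * cos (c * x))"
proof -
  let ?N = std_normal_distribution
  let ?c = "\<lambda>v. cos (c * (x + sqrt h * v))" and ?d = "\<lambda>v. ennreal (gauss_density h (x + sqrt h * v - x))"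
  interpret N: real_distribution ?N by (rule real_dist_normal_dist)
  have "(\<integral>\<^sup>+y. ennreal (gauss_density h (y - x)) * ennreal (1 + cos (c * y)) \<partial>lborel) =
      ennreal \<bar>sqrt h\<bar> * (\<integral>\<^sup>+v. ?d v * ennreal (1 + ?c v) \<partial>lborel)"
    using h by (intro nn_integral_real_affine) auto
  also have "\<dots> = (\<integral>\<^sup>+v. ennreal \<bar>sqrt h\<bar> * (?d v * ennreal (1 + ?c v)) \<partial>lborel)"
    by (rule nn_integral_cmult[symmetric]) measurable
  also have "\<dots> = (\<integral>\<^sup>+v. ennreal (std_normal_density v) * ennreal (1 + ?c v) \<partial>lborel)"
  proof (intro nn_integral_cong)
    fix v
    have "\<bar>sqrt h\<bar> * gauss_density h (x + sqrt h * v - x) = std_normal_density v"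
      using h unfolding gauss_density_real[OF h]
      by (simp add: normal_density_def real_sqrt_mult power_mult_distrib)
    then show "ennreal \<bar>sqrt h\<bar> * (?d v * ennreal (1 + ?c v)) =
        ennreal (std_normal_density v) * ennreal (1 + ?c v)"
      by (simp add: mult.assoc[symmetric] ennreal_mult''[symmetric] gauss_density_nonneg)
  qed
  also have "\<dots> = (\<integral>\<^sup>+v. ennreal (1 + ?c v) \<partial>?N)"
    by (subst nn_integral_density) auto
  also have "\<dots> = ennreal (\<integral>v. 1 + ?c v \<partial>?N)"
  proof (rule nn_integral_eq_integral)
    show "integrable ?N (\<lambda>v. 1 + ?c v)"
    proof (rule N.integrable_const_bound[of _ 2])
      show "AE v in ?N. norm (1 + ?c v) \<le> 2"
        by (intro AE_I2) (smt (verit) cos_ge_minus_one cos_le_one real_norm_def)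
    qed simp
    show "AE v in ?N. 0 \<le> 1 + ?c v"
      by (intro AE_I2) (smt (verit) cos_ge_minus_one)
  qed
  also have "(\<integral>v. 1 + ?c v \<partial>?N) =
      (\<integral>v. 1 + (cos (c * x) * cos (c * sqrt h * v) - sin (c * x) * sin (c * sqrt h * v)) \<partial>?N)"
    by (simp add: distrib_left cos_add mult.assoc)
  also have "\<dots> = 1 + (cos (c * x) * exp (- (c * sqrt h)\<^sup>2 / 2) - sin (c * x) * 0)"
  proof -
    have i: "integrable ?N (\<lambda>v. cos (a * v))" "integrable ?N (\<lambda>v. sin (a * v))" for a
      by (rule N.integrable_const_bound[of _ 1]; simp)+
    have "(\<integral>v. 1 + (cos (c * x) * cos (c * sqrt h * v) - sin (c * x) * sin (c * sqrt h * v)) \<partial>?N) =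
        (\<integral>v. 1 \<partial>?N) + (cos (c * x) * (\<integral>v. cos (c * sqrt h * v) \<partial>?N) -
          sin (c * x) * (\<integral>v. sin (c * sqrt h * v) \<partial>?N))"
      by (subst Bochner_Integration.integral_add; (intro Bochner_Integration.integrable_diff integrable_mult_right i)?;
          (subst Bochner_Integration.integral_diff)?; (intro integrable_mult_right i)?) simp_all
    then show ?thesis
      unfolding integral_std_normal_cos_sin using N.prob_space by simp
  qed
  finally show ?thesis
    using h by (simp add: power_mult_distrib mult.commute)
qed

text \<open>\<open>cos (c * x)\<close> is even in \<open>x\<close>, vanishes at \<open>u\<close> and
  has Lipschitz constant \<open>c\<close>. This measures the martingale at an exit that misses the
  boundary slightly.\<close>

lemma abs_cos_le:
  fixes u x c :: real
  assumes cu: "cos (c * u) = 0" and c: "0 \<le> c"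
  shows "\<bar>cos (c * x)\<bar> \<le> c * \<bar>\<bar>x\<bar> - u\<bar>"
proof -
  have lip: "\<bar>cos a - cos b\<bar> \<le> \<bar>a - b\<bar>" for a b :: real
  proof -
    have "\<bar>cos a - cos b\<bar> = 2 * \<bar>sin ((a + b) / 2)\<bar> * \<bar>sin ((b - a) / 2)\<bar>"
      by (simp add: cos_diff_cos abs_mult)
    also have "\<dots> \<le> 2 * 1 * \<bar>(b - a) / 2\<bar>"
      by (intro mult_mono abs_sin_x_le_abs_x) auto
    finally show ?thesis by simp
  qed
  have "cos (c * x) = cos (c * \<bar>x\<bar>)" by (simp add: abs_if)
  then have "\<bar>cos (c * x)\<bar> = \<bar>cos (c * \<bar>x\<bar>) - cos (c * u)\<bar>" by (simp add: cu)
  also have "\<dots> \<le> \<bar>c * \<bar>x\<bar> - c * u\<bar>" by (rule lip)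
  also have "\<dots> = c * \<bar>\<bar>x\<bar> - u\<bar>" using c by (simp add: right_diff_distrib[symmetric] abs_mult)
  finally show ?thesis .
qed

section \<open>Optional stopping for the cosine martingale\<close>

locale real_brownian = brownian M Y for M :: "'w measure" and Y :: "real \<Rightarrow> 'w \<Rightarrow> real"
begin

lemma grid_stays_sets [measurable]: "K \<in> sets borel \<Longrightarrow> grid_stays K z h N \<inter> space M \<in> sets M"
  using grid_stays_borel[of K z h N] by (simp add: borel_measurable_indicator_iff)

lemma grid_stays_real_borel [measurable]:
  "K \<in> sets borel \<Longrightarrow> (\<lambda>w. indicator (grid_stays K z h N) w :: real) \<in> borel_measurable M"
  using grid_stays_sets[of K z h N] by (simp add: borel_measurable_indicator_iff)

lemma integrable_indicator_mult:
  fixes f :: "'w \<Rightarrow> real"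
  assumes "(\<lambda>w. indicator A w :: real) \<in> borel_measurable M" "f \<in> borel_measurable M" "\<And>w. \<bar>f w\<bar> \<le> B"
  shows "integrable M (\<lambda>w. indicator A w * f w)"
proof (rule integrable_const_bound[of _ B])
  show "AE w in M. norm (indicator A w * f w) \<le> B"
  proof (rule AE_I2)
    fix w
    have "norm (indicator A w * f w) \<le> \<bar>f w\<bar>" by (simp add: indicator_def)
    also have "\<dots> \<le> B" by (rule assms(3))
    finally show "norm (indicator A w * f w) \<le> B" .
  qed
qed (use assms in measurable)

text \<open>The Markov step is applied to \<open>1 + cos\<close>; the constant 1 contributes the
  same survival probability to both sides and cancels.\<close>

lemma expectation_grid_cos_step:
  assumes h: "0 < h" and [measurable]: "K \<in> sets borel"
  shows "expectation (\<lambda>w. indicator (grid_stays K 0 h N) w * cos (c * Y (real (Suc N) * h) w)) =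
    exp (- (c\<^sup>2 * h) / 2) * expectation (\<lambda>w. indicator (grid_stays K 0 h N) w * cos (c * Y (real N * h) w))"
proof -
  let ?x = "\<lambda>w. cos (c * Y (real N * h) w)" and ?y = "\<lambda>w. cos (c * Y (real (Suc N) * h) w)"
  let ?R = "\<lambda>w. indicator (grid_stays K 0 h N) w :: real"
  let ?e = "exp (- (c\<^sup>2 * h) / 2)"
  have e: "0 \<le> ?e" "?e \<le> 1" using h by auto
  have e_cos: "0 \<le> 1 + ?e * cos x" "\<bar>1 + ?e * cos x\<bar> \<le> 2" for x
  proof -
    have "\<bar>?e * cos x\<bar> \<le> 1 * 1"
      unfolding abs_mult using e by (intro mult_mono) auto
    then show "0 \<le> 1 + ?e * cos x" "\<bar>1 + ?e * cos x\<bar> \<le> 2" by (auto simp: abs_le_iff)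
  qed
  have cos1: "0 \<le> 1 + cos x" "\<bar>1 + cos x\<bar> \<le> 2" for x :: real
    using cos_ge_minus_one[of x] cos_le_one[of x] by (auto simp: abs_le_iff simp del: cos_ge_minus_one cos_le_one)
  have "(\<integral>\<^sup>+w. indicator (grid_stays K 0 h N) w * ennreal (1 + cos (c * (0 + Y (real (Suc N) * h) w))) \<partial>M) =
    (\<integral>\<^sup>+w. indicator (grid_stays K 0 h N) w *
        (\<integral>\<^sup>+y. ennreal (gauss_density h (y - (0 + Y (real N * h) w))) * ennreal (1 + cos (c * y)) \<partial>lborel) \<partial>M)"
    by (rule grid_markov_step[OF h]) measurable
  also have "\<dots> = (\<integral>\<^sup>+w. indicator (grid_stays K 0 h N) w * ennreal (1 + ?e * ?x w) \<partial>M)"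
    by (simp only: nn_integral_gauss_one_plus_cos[OF h] add_0_left)
  finally have nn: "(\<integral>\<^sup>+w. ennreal (?R w * (1 + ?y w)) \<partial>M) =
      (\<integral>\<^sup>+w. ennreal (?R w * (1 + ?e * ?x w)) \<partial>M)"
    by (simp add: ennreal_mult' ennreal_indicator)
  have int: "integrable M (\<lambda>w. ?R w * cos (c * Y t w))" "integrable M ?R" for t
    using integrable_indicator_mult[of "grid_stays K 0 h N" "\<lambda>w. cos (c * Y t w)" 1]
      integrable_indicator_mult[of "grid_stays K 0 h N" "\<lambda>w. 1" 1] by auto
  have int': "integrable M (\<lambda>w. ?R w * (1 + ?y w))"
    "integrable M (\<lambda>w. ?R w * (1 + ?e * ?x w))"
    by (rule integrable_indicator_mult[where B=2]; use cos1 e_cos in simp)+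
  have "expectation (\<lambda>w. ?R w * (1 + ?y w)) =
      expectation (\<lambda>w. ?R w * (1 + ?e * ?x w))"
  proof -
    have nonneg: "0 \<le> ?R w * (1 + cos x)" "0 \<le> ?R w * (1 + ?e * cos x)" for w x
      using cos1(1) e_cos(1) by (intro mult_nonneg_nonneg; simp)+
    have "(\<integral>\<^sup>+w. ennreal (?R w * (1 + ?y w)) \<partial>M) =
        ennreal (expectation (\<lambda>w. ?R w * (1 + ?y w)))"
      by (rule nn_integral_eq_integral[OF int'(1)]) (intro AE_I2 nonneg)
    moreover have "(\<integral>\<^sup>+w. ennreal (?R w * (1 + ?e * ?x w)) \<partial>M) =
        ennreal (expectation (\<lambda>w. ?R w * (1 + ?e * ?x w)))"
      by (rule nn_integral_eq_integral[OF int'(2)]) (intro AE_I2 nonneg)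
    moreover have "0 \<le> expectation (\<lambda>w. ?R w * (1 + ?y w))"
      "0 \<le> expectation (\<lambda>w. ?R w * (1 + ?e * ?x w))"
      by (intro integral_nonneg_AE AE_I2 nonneg)+
    ultimately show ?thesis using nn by (simp only: ennreal_inj)
  qed
  moreover have "expectation (\<lambda>w. ?R w * (1 + ?y w)) =
      expectation ?R + expectation (\<lambda>w. ?R w * ?y w)"
    by (simp only: distrib_left mult_1_right) (rule Bochner_Integration.integral_add[OF int(2,1)])
  moreover have "expectation (\<lambda>w. ?R w * (1 + ?e * ?x w)) =
      expectation ?R + ?e * expectation (\<lambda>w. ?R w * ?x w)"
  proof -
    have "expectation (\<lambda>w. ?R w * (1 + ?e * ?x w)) =
        expectation (\<lambda>w. ?R w + ?e * (?R w * ?x w))"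
      by (simp only: distrib_left mult_1_right mult.left_commute)
    also have "\<dots> = expectation ?R + expectation (\<lambda>w. ?e * (?R w * ?x w))"
      by (intro Bochner_Integration.integral_add int integrable_mult_right)
    finally show ?thesis by simp
  qed
  ultimately show ?thesis by simp
qed

lemma grid_stays_Suc_subset: "w \<in> grid_stays K z h (Suc i) \<Longrightarrow> w \<in> grid_stays K z h i"
  by (simp add: grid_stays_def)

text \<open>Discrete optional stopping for the martingale \<open>exp (c\<^sup>2 t / 2) cos (c Y\<^sub>t)\<close>:
  the defect is the value of the martingale at the exit time.\<close>

lemma optional_stopping_defect:
  assumes h: "0 < h" and [measurable]: "K \<in> sets borel" and K0: "0 \<in> K"
  defines "R \<equiv> \<lambda>i w. indicator (grid_stays K 0 h i) w :: real"
  shows "\<bar>1 - exp (c\<^sup>2 * (real N * h) / 2) * expectation (\<lambda>w. R N w * cos (c * Y (real N * h) w))\<bar> \<le>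
    exp (c\<^sup>2 * (real N * h) / 2) *
      expectation (\<lambda>w. \<Sum>i<N. (R i w - R (Suc i) w) * \<bar>cos (c * Y (real (Suc i) * h) w)\<bar>)"
proof -
  let ?e = "\<lambda>i. exp (c\<^sup>2 * (real i * h) / 2)"
  let ?S = "\<lambda>i w. (R i w - R (Suc i) w) * cos (c * Y (real (Suc i) * h) w)"
  let ?T = "\<lambda>i w. (R i w - R (Suc i) w) * \<bar>cos (c * Y (real (Suc i) * h) w)\<bar>"
  have [measurable]: "R i \<in> borel_measurable M" for i unfolding R_def by measurable
  \<comment> \<open>The expected martingale on the event of survival through step \<open>i\<close>.
    Consecutive values differ by the contribution of the paths that leave at step
    \<open>Suc i\<close>.\<close>
  define d where "d i = ?e i * expectation (\<lambda>w. R i w * cos (c * Y (real i * h) w))" for i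
  have int: "integrable M (\<lambda>w. R i w * cos (c * Y t w))" "integrable M (\<lambda>w. R i w * \<bar>cos (c * Y t w)\<bar>)" for i t
    unfolding R_def by (rule integrable_indicator_mult[where B=1]; simp)+
  have int2: "integrable M (\<lambda>w. (R i w - R j w) * cos (c * Y t w))"
    "integrable M (\<lambda>w. (R i w - R j w) * \<bar>cos (c * Y t w)\<bar>)" for i j t
    unfolding left_diff_distrib by (intro Bochner_Integration.integrable_diff int)+
  have R_le: "R (Suc i) w \<le> R i w" for i w
    unfolding R_def using grid_stays_Suc_subset[of w K 0 h i] by (auto simp: indicator_def)
  have step: "d i - d (Suc i) = ?e (Suc i) *
      expectation (?S i)" for i
  proof -
    have ex: "?e i = ?e (Suc i) * exp (- (c\<^sup>2 * h) / 2)"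
      by (simp add: exp_add[symmetric] field_simps)
    have "d i = ?e (Suc i) * expectation (\<lambda>w. R i w * cos (c * Y (real (Suc i) * h) w))"
      unfolding d_def ex R_def by (subst expectation_grid_cos_step[OF h]) (auto simp: mult.assoc)
    then have "d i - d (Suc i) = ?e (Suc i) *
       (expectation (\<lambda>w. R i w * cos (c * Y (real (Suc i) * h) w)) - expectation (\<lambda>w. R (Suc i) w * cos (c * Y (real (Suc i) * h) w)))"
      by (simp only: d_def right_diff_distrib)
    then show ?thesis
      unfolding left_diff_distrib by (simp only: Bochner_Integration.integral_diff[OF int(1) int(1)])
  qed
  have "expectation (\<lambda>w. R 0 w * cos (c * Y (real 0 * h) w)) = expectation (\<lambda>w. 1)"
    using K0 by (intro Bochner_Integration.integral_cong) (auto simp: R_def grid_stays_def X_zero)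
  then have d0: "d 0 = 1" by (simp add: d_def prob_space)
  have "1 - d N = (\<Sum>i<N. d i - d (Suc i))"
    using sum_lessThan_telescope'[of d N] d0 by simp
  also have "\<bar>\<dots>\<bar> \<le> (\<Sum>i<N. \<bar>d i - d (Suc i)\<bar>)" by (rule sum_abs)
  also have "\<dots> \<le> (\<Sum>i<N. ?e N *
      expectation (?T i))"
  proof (rule sum_mono)
    fix i assume "i \<in> {..<N}"
    then have i: "real (Suc i) \<le> real N" by simp
    have "\<bar>d i - d (Suc i)\<bar> = ?e (Suc i) *
       \<bar>expectation (?S i)\<bar>"
      unfolding step abs_mult by simp
    also have "\<dots> \<le> ?e N *
       expectation (?T i)"
    proof (rule mult_mono)
      \<comment> \<open>The weights grow with time, so the final one dominates all of them.\<close>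
      show "?e (Suc i) \<le> ?e N"
        using i h by (simp only: exp_le_cancel_iff) (intro divide_right_mono mult_left_mono mult_right_mono, auto)
      have "\<bar>expectation (?S i)\<bar> \<le>
          expectation (\<lambda>w. \<bar>(R i w - R (Suc i) w) * cos (c * Y (real (Suc i) * h) w)\<bar>)"
        by (rule integral_abs_bound)
      also have "\<dots> = expectation (?T i)"
        using R_le by (simp add: abs_mult)
      finally show "\<bar>expectation (?S i)\<bar> \<le>
          expectation (?T i)" .
    qed auto
    finally show "\<bar>d i - d (Suc i)\<bar> \<le> ?e N *
       expectation (?T i)" .
  qed
  also have "\<dots> = ?e N *
      expectation (\<lambda>w. \<Sum>i<N. (R i w - R (Suc i) w) * \<bar>cos (c * Y (real (Suc i) * h) w)\<bar>)"
    by (subst Bochner_Integration.integral_sum) (auto simp: sum_distrib_left intro: int2)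
  finally show ?thesis by (simp only: d_def)
qed

text \<open>The difference of indicators singles out the first exit step, so at most one summand
  survives. At that step the path is at most \<open>1 / (m + 1)\<close> short of the level
  \<open>u\<close>, having left the inner part, and at most \<open>b\<close> beyond it, having been
  inside one step earlier.\<close>

lemma exit_sum_le:
  fixes b :: real and m :: nat
  assumes cu: "cos (c * u) = 0" and c: "0 \<le> c" and b: "0 \<le> b"
    and steps: "\<And>i. i < N \<Longrightarrow> \<bar>Y (real (Suc i) * h) w - Y (real i * h) w\<bar> \<le> b"
  defines "R \<equiv> \<lambda>i w. indicator (grid_stays (inner_part {-u<..<u} m) 0 h i) w :: real"
  shows "(\<Sum>i<N. (R i w - R (Suc i) w) * \<bar>cos (c * Y (real (Suc i) * h) w)\<bar>) \<le> c * (1 / (real m + 1) + b)"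
proof -
  have "(\<Sum>i<N. (R i w - R (Suc i) w) * \<bar>cos (c * Y (real (Suc i) * h) w)\<bar>) \<le>
      (\<Sum>i<N. (R i w - R (Suc i) w) * (c * (1 / (real m + 1) + b)))"
  proof (rule sum_mono)
    fix i assume i: "i \<in> {..<N}"
    let ?x = "Y (real i * h) w" and ?y = "Y (real (Suc i) * h) w"
    show "(R i w - R (Suc i) w) * \<bar>cos (c * ?y)\<bar> \<le> (R i w - R (Suc i) w) * (c * (1 / (real m + 1) + b))"
    proof (cases "w \<in> grid_stays (inner_part {-u<..<u} m) 0 h i \<and> w \<notin> grid_stays (inner_part {-u<..<u} m) 0 h (Suc i)")
      case True
      then have x: "?x \<in> inner_part {-u<..<u} m" and y: "?y \<notin> inner_part {-u<..<u} m"
        by (auto simp: grid_stays_def le_Suc_eq)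
      from x inner_part_subset have "?x \<in> {-u<..<u}" by blast
      then have xu: "\<bar>?x\<bar> < u" by auto
      from y obtain v where v: "v \<notin> {-u<..<u}" "dist ?y v < 1 / (real m + 1)"
        by (auto simp: inner_part_def not_le)
      have "u \<le> \<bar>v\<bar>" using v(1) by (auto simp: abs_if)
      then have 1: "u - \<bar>?y\<bar> \<le> 1 / (real m + 1)" using v(2) by (auto simp: dist_real_def)
      have 2: "\<bar>?y\<bar> - u \<le> b" using steps[of i] i xu by auto
      have "\<bar>\<bar>?y\<bar> - u\<bar> \<le> 1 / (real m + 1) + b"
        using 1 2 b by (auto simp: abs_le_iff intro: order_trans add_increasing add_increasing2)
      then have "\<bar>cos (c * ?y)\<bar> \<le> c * (1 / (real m + 1) + b)"
        using abs_cos_le[OF cu c, of ?y] mult_left_mono[OF _ c] by (meson order_trans)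
      then show ?thesis using True by (auto simp: R_def indicator_def)
    next
      case False
      then have "R i w - R (Suc i) w = 0"
        using grid_stays_Suc_subset[of w _ 0 h i] by (auto simp: R_def indicator_def)
      then show ?thesis by simp
    qed
  qed
  also have "\<dots> = (R 0 w - R N w) * (c * (1 / (real m + 1) + b))"
    using sum_lessThan_telescope'[of "\<lambda>i. R i w" N] by (simp only: sum_distrib_right[symmetric])
  also have "\<dots> \<le> 1 * (c * (1 / (real m + 1) + b))"
    using b c by (intro mult_right_mono) (auto simp: R_def indicator_def)
  finally show ?thesis by simp
qed

lemma stays_real_borel [measurable]:
  "open D \<or> closed D \<Longrightarrow> (\<lambda>w. indicator (stays D z t) w :: real) \<in> borel_measurable M"
  using stays_borel[of D z t] by (simp add: borel_measurable_indicator_iff)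

text \<open>Telescoping gives bounds that do not depend on the grid, as dominated convergence
  needs.\<close>

lemma exit_sum_bounds:
  "0 \<le> (\<Sum>i<N. (indicator (grid_stays K 0 h i) w - indicator (grid_stays K 0 h (Suc i)) w) * \<bar>cos (c * Y (real (Suc i) * h) w)\<bar> :: real)"
  "(\<Sum>i<N. (indicator (grid_stays K 0 h i) w - indicator (grid_stays K 0 h (Suc i)) w) * \<bar>cos (c * Y (real (Suc i) * h) w)\<bar>) \<le> (1 :: real)"
proof -
  let ?R = "\<lambda>i. indicator (grid_stays K 0 h i) w :: real"
  have R: "?R (Suc i) \<le> ?R i" for i
    using grid_stays_Suc_subset[of w K 0 h i] by (auto simp: indicator_def)
  show "0 \<le> (\<Sum>i<N. (?R i - ?R (Suc i)) * \<bar>cos (c * Y (real (Suc i) * h) w)\<bar>)"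
    using R by (intro sum_nonneg mult_nonneg_nonneg) auto
  have "(\<Sum>i<N. (?R i - ?R (Suc i)) * \<bar>cos (c * Y (real (Suc i) * h) w)\<bar>) \<le> (\<Sum>i<N. (?R i - ?R (Suc i)) * 1)"
    using R by (intro sum_mono mult_left_mono) auto
  also have "\<dots> = ?R 0 - ?R N" using sum_lessThan_telescope'[of ?R N] by (simp only: mult_1_right)
  also have "\<dots> \<le> 1" by (simp add: indicator_def)
  finally show "(\<Sum>i<N. (?R i - ?R (Suc i)) * \<bar>cos (c * Y (real (Suc i) * h) w)\<bar>) \<le> 1" .
qed

text \<open>Refining the grid removes the overshoot, by uniform continuity of each path on
  \<open>{0..t}\<close>; what remains is the gap between the inner part and the interval.\<close>

lemma expectation_cos_stays_inner_part:
  fixes c u t :: real and m :: nat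
  assumes c: "0 \<le> c" and t: "0 < t" and cu: "cos (c * u) = 0" and K0: "0 \<in> inner_part {-u<..<u} m"
  shows "\<bar>1 - exp (c\<^sup>2 * t / 2) * expectation (\<lambda>w. indicator (stays (inner_part {-u<..<u} m) 0 t) w * cos (c * Y t w))\<bar>
    \<le> exp (c\<^sup>2 * t / 2) * (c / (real m + 1))"
proof -
  let ?K = "inner_part {-u<..<u} m"
  define h where "h n = t / 2 ^ n" for n :: nat
  have h: "0 < h n" for n using t by (simp add: h_def)
  have Nh: "real (2 ^ n) * h n = t" for n by (simp add: h_def)
  define R where "R n i w = (indicator (grid_stays ?K 0 (h n) i) w :: real)" for n i w
  define T where "T n w = (\<Sum>i<2 ^ n. (R n i w - R n (Suc i) w) * \<bar>cos (c * Y (real (Suc i) * h n) w)\<bar>)" for n w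
  \<comment> \<open>The excess of the exit sum over the part of its bound that does not vanish as
    the grid is refined.\<close>
  define S where "S n w = max 0 (T n w - c / (real m + 1))" for n w
  let ?e = "exp (c\<^sup>2 * t / 2)" and ?E = "expectation (\<lambda>w. indicator (stays ?K 0 t) w * cos (c * Y t w))"
  let ?a = "\<lambda>n. expectation (\<lambda>w. R n (2 ^ n) w * cos (c * Y t w))"
  have [measurable]: "R n i \<in> borel_measurable M" for n i unfolding R_def by measurable
  have [measurable]: "T n \<in> borel_measurable M" "S n \<in> borel_measurable M" for n
    unfolding S_def T_def by measurable
  have [measurable]: "(\<lambda>w. indicator (stays ?K 0 t) w :: real) \<in> borel_measurable M"
    using closed_inner_part by (intro stays_real_borel) auto
  have T_bounds: "0 \<le> T n w" "T n w \<le> 1" for n w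
    unfolding T_def R_def by (rule exit_sum_bounds)+
  have intT: "integrable M (T n)" and intS: "integrable M (S n)" for n
  proof -
    show "integrable M (T n)"
      by (rule integrable_const_bound[of _ 1]) (use T_bounds in auto)
    show "integrable M (S n)"
    proof (rule integrable_const_bound[of _ 1])
      have "T n w - c / (real m + 1) \<le> 1" for w
        using T_bounds(2)[of n w] c by (smt (verit) divide_nonneg_nonneg of_nat_0_le_iff)
      then show "AE w in M. norm (S n w) \<le> 1" by (auto simp: S_def)
    qed measurable
  qed
  have S_lim: "(\<lambda>n. expectation (S n)) \<longlonglongrightarrow> expectation (\<lambda>_. 0)"
  proof (rule integral_dominated_convergence[where w="\<lambda>_. 1"])
    show "AE w in M. norm (S n w) \<le> 1" for n
    proof (rule AE_I2)
      fix w
      have "0 \<le> c / (real m + 1)" using c by simp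
      then show "norm (S n w) \<le> 1" using T_bounds[of n w] by (auto simp: S_def)
    qed
    show "AE w in M. (\<lambda>n. S n w) \<longlonglongrightarrow> 0"
    proof (rule AE_I2)
      fix w assume w: "w \<in> space M"
      have uc: "uniformly_continuous_on {0..t} (\<lambda>r. Y r w)"
        by (intro compact_uniformly_continuous continuous_on_subset[OF X_continuous[OF w]]) auto
      show "(\<lambda>n. S n w) \<longlonglongrightarrow> 0"
      proof (rule LIMSEQ_I)
        fix e :: real assume e: "0 < e"
        define b where "b = e / (2 * (c + 1))"
        have b: "0 < b" "c * b < e"
        proof -
          show "0 < b" using e c by (simp add: b_def)
          have "c * b = e * (c / (2 * (c + 1)))" by (simp add: b_def)
          also have "\<dots> < e * 1" using e c by (intro mult_strict_left_mono) (auto simp: field_simps)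
          finally show "c * b < e" by simp
        qed
        obtain d where d: "d > 0" "\<And>x x'. x \<in> {0..t} \<Longrightarrow> x' \<in> {0..t} \<Longrightarrow> dist x' x < d \<Longrightarrow> dist (Y x' w) (Y x w) < b"
          using uc b(1) unfolding uniformly_continuous_on_def by metis
        obtain n0 where n0: "t / d < 2 ^ n0" using real_arch_pow[of 2 "t / d"] by auto
        have "norm (S n w - 0) < e" if n: "n0 \<le> n" for n
        proof -
          have "(2::real) ^ n0 \<le> 2 ^ n" using n by (intro power_increasing) auto
          then have "t / d < 2 ^ n" using n0 by (rule order_less_le_trans[rotated])
          then have hd: "h n < d" using d(1) by (simp add: h_def field_simps)
          have "T n w \<le> c * (1 / (real m + 1) + b)"
            unfolding T_def R_def
          proof (rule exit_sum_le[OF cu c])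
            fix i :: nat assume i: "i < 2 ^ n"
            have in_t: "real j * h n \<in> {0..t}" if "j \<le> 2 ^ n" for j
            proof -
              have "real j \<le> real (2 ^ n)" using that by (rule of_nat_mono)
              then have "real j * h n \<le> real (2 ^ n) * h n" using h[of n] by (intro mult_right_mono) auto
              then show ?thesis unfolding Nh using h[of n] by simp
            qed
            have "dist (Y (real (Suc i) * h n) w) (Y (real i * h n) w) < b"
              using i hd h[of n] by (intro d(2) in_t) (auto simp: dist_real_def algebra_simps)
            then show "\<bar>Y (real (Suc i) * h n) w - Y (real i * h n) w\<bar> \<le> b" by (simp add: dist_real_def)
          qed (use b in simp)
          also have "\<dots> = c / (real m + 1) + c * b" by (simp add: distrib_left)
          finally have "S n w \<le> c * b" using b(1) c by (simp add: S_def)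
          moreover have "0 \<le> S n w" by (simp add: S_def)
          ultimately show ?thesis using b(2) by simp
        qed
        then show "\<exists>no. \<forall>n\<ge>no. norm (S n w - 0) < e" by blast
      qed
    qed
  qed auto
  have R_lim: "(\<lambda>n. ?a n) \<longlonglongrightarrow>
      ?E"
  proof (rule integral_dominated_convergence[where w="\<lambda>_. 1"])
    show "AE w in M. (\<lambda>n. R n (2 ^ n) w * cos (c * Y t w)) \<longlonglongrightarrow> indicator (stays ?K 0 t) w * cos (c * Y t w)"
    proof (rule AE_I2)
      fix w assume w: "w \<in> space M"
      have "\<forall>\<^sub>F n in sequentially. R n (2 ^ n) w = indicator (stays ?K 0 t) w"
        using grid_stays_eventually[OF shifted_X_continuous[OF w, of 0] closed_inner_part[of "{-u<..<u}" m], of t 1] t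
        by (auto simp: R_def h_def grid_stays_def stays_def indicator_def elim!: eventually_mono)
      then have "(\<lambda>n. R n (2 ^ n) w) \<longlonglongrightarrow> indicator (stays ?K 0 t) w" by (rule tendsto_eventually)
      then show "(\<lambda>n. R n (2 ^ n) w * cos (c * Y t w)) \<longlonglongrightarrow> indicator (stays ?K 0 t) w * cos (c * Y t w)"
        by (intro tendsto_intros)
    qed
    show "AE w in M. norm (R n (2 ^ n) w * cos (c * Y t w)) \<le> 1" for n
      by (intro AE_I2) (auto simp: R_def indicator_def)
  qed auto
  have ineq: "\<bar>1 - ?e * ?a n\<bar> \<le>
      ?e * (c / (real m + 1) + expectation (S n))" for n
  proof -
    have "\<bar>1 - ?e * ?a n\<bar> \<le>
        ?e * expectation (T n)"
      using optional_stopping_defect[OF h[of n] _ K0, where N="2 ^ n" and c=c] unfolding R_def T_def Nh by simp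
    also have "expectation (T n) \<le> expectation (\<lambda>w. c / (real m + 1) + S n w)"
      by (intro integral_mono intT Bochner_Integration.integrable_add intS) (auto simp: S_def)
    also have "\<dots> = c / (real m + 1) + expectation (S n)"
      by (subst Bochner_Integration.integral_add) (auto intro: intS simp: prob_space)
    finally show ?thesis by simp
  qed
  have "(\<lambda>n. \<bar>1 - ?e * ?a n\<bar>) \<longlonglongrightarrow>
      \<bar>1 - ?e * ?E\<bar>"
    by (intro tendsto_intros R_lim)
  moreover have "(\<lambda>n. ?e * (c / (real m + 1) + expectation (S n))) \<longlonglongrightarrow>
      ?e * (c / (real m + 1) + expectation (\<lambda>_. 0))"
    by (intro tendsto_intros S_lim)
  ultimately have "\<bar>1 - ?e * ?E\<bar> \<le>
      ?e * (c / (real m + 1) + expectation (\<lambda>_. 0))"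
    by (rule LIMSEQ_le) (use ineq in blast)
  then show ?thesis by simp
qed

text \<open>Since \<open>cos (c * x)\<close> vanishes at both endpoints, paths that have left
  contribute nothing in the limit and the identity is exact.\<close>

lemma expectation_cos_stays:
  fixes c u t :: real
  assumes c: "0 \<le> c" and t: "0 < t" and u: "0 < u" and cu: "cos (c * u) = 0"
  shows "expectation (\<lambda>w. indicator (stays {-u<..<u} 0 t) w * cos (c * Y t w)) = exp (- (c\<^sup>2 * t) / 2)"
proof -
  let ?D = "{-u<..<u}"
  let ?E = "\<lambda>m. expectation (\<lambda>w. indicator (stays (inner_part ?D m) 0 t) w * cos (c * Y t w))"
  let ?e = "expectation (\<lambda>w. indicator (stays ?D 0 t) w * cos (c * Y t w))"
  have [measurable]: "(\<lambda>w. indicator (stays (inner_part ?D m) 0 t) w :: real) \<in> borel_measurable M" for m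
    using closed_inner_part by (intro stays_real_borel) auto
  have [measurable]: "(\<lambda>w. indicator (stays ?D 0 t) w :: real) \<in> borel_measurable M"
    by (intro stays_real_borel) auto
  have "?E \<longlonglongrightarrow> ?e"
  proof (rule integral_dominated_convergence[where w="\<lambda>_. 1"])
    show "AE w in M. (\<lambda>m. indicator (stays (inner_part ?D m) 0 t) w * cos (c * Y t w)) \<longlonglongrightarrow>
        indicator (stays ?D 0 t) w * cos (c * Y t w)"
    proof (rule AE_I2)
      fix w assume w: "w \<in> space M"
      have "\<forall>\<^sub>F m in sequentially. indicator (stays (inner_part ?D m) 0 t) w = (indicator (stays ?D 0 t) w :: real)"
        using inner_part_stays_eventually[OF shifted_X_continuous[OF w, of 0], of ?D t]
        by (auto simp: stays_def indicator_def elim!: eventually_mono)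
      then have "(\<lambda>m. indicator (stays (inner_part ?D m) 0 t) w) \<longlonglongrightarrow> (indicator (stays ?D 0 t) w :: real)"
        by (rule tendsto_eventually)
      then show "(\<lambda>m. indicator (stays (inner_part ?D m) 0 t) w * cos (c * Y t w)) \<longlonglongrightarrow>
          indicator (stays ?D 0 t) w * cos (c * Y t w)"
        by (intro tendsto_intros)
    qed
    show "AE w in M. norm (indicator (stays (inner_part ?D m) 0 t) w * cos (c * Y t w)) \<le> 1" for m
      by (intro AE_I2) (auto simp: indicator_def)
  qed auto
  then have "(\<lambda>m. \<bar>1 - exp (c\<^sup>2 * t / 2) * ?E m\<bar>) \<longlonglongrightarrow> \<bar>1 - exp (c\<^sup>2 * t / 2) * ?e\<bar>"
    by (intro tendsto_intros)
  moreover have "(\<lambda>m. exp (c\<^sup>2 * t / 2) * (c * (1 / (real m + 1)))) \<longlonglongrightarrow> exp (c\<^sup>2 * t / 2) * (c * 0)"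
    using LIMSEQ_inverse_real_of_nat by (intro tendsto_intros) (simp add: inverse_eq_divide add.commute)
  moreover have "\<exists>N. \<forall>m\<ge>N. \<bar>1 - exp (c\<^sup>2 * t / 2) * ?E m\<bar> \<le> exp (c\<^sup>2 * t / 2) * (c * (1 / (real m + 1)))"
  proof -
    \<comment> \<open>The starting point 0 belongs to the inner part only once \<open>m\<close> is
      large.\<close>
    obtain m0 where m0: "{0} \<subseteq> inner_part ?D m0"
      using compact_subset_inner_part[of "{0}" ?D] u by auto
    have "\<bar>1 - exp (c\<^sup>2 * t / 2) * ?E m\<bar> \<le> exp (c\<^sup>2 * t / 2) * (c * (1 / (real m + 1)))" if "m0 \<le> m" for m
      using expectation_cos_stays_inner_part[OF c t cu, of m] inner_part_mono[OF that, of ?D] m0 by auto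
    then show ?thesis by blast
  qed
  ultimately have "\<bar>1 - exp (c\<^sup>2 * t / 2) * ?e\<bar> \<le> exp (c\<^sup>2 * t / 2) * (c * 0)"
    by (rule LIMSEQ_le)
  then have "exp (c\<^sup>2 * t / 2) * ?e = 1" by simp
  then show ?thesis by (simp add: exp_minus field_simps)
qed

end

lemma cos_odd_half_pi: "cos (real (2 * k + 1) * (pi / 2)) = 0"
  by (subst cos_zero_iff) (rule disjI1, rule exI[of _ "2 * k + 1"], simp)

lemma tendsto_abel_arctan:
  assumes "0 < x"
  defines "r \<equiv> \<lambda>n. 1 - inverse (real (Suc n))"
  shows "(\<lambda>n. arctan (2 * r n * x / (1 - (r n)\<^sup>2))) \<longlonglongrightarrow> pi / 2"
proof -
  have r: "r \<longlonglongrightarrow> 1"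
    unfolding r_def using tendsto_diff[OF tendsto_const LIMSEQ_inverse_real_of_nat, of 1] by simp
  have "filterlim (\<lambda>n. 2 * r n * x / (1 - (r n)\<^sup>2)) at_top sequentially"
  proof (rule LIM_at_top_divide)
    show "(\<lambda>n. 2 * r n * x) \<longlonglongrightarrow> 2 * 1 * x" by (intro tendsto_intros r)
    have "(\<lambda>n. 1 - (r n)\<^sup>2) \<longlonglongrightarrow> 1 - 1\<^sup>2" by (intro tendsto_intros r)
    then show "(\<lambda>n. 1 - (r n)\<^sup>2) \<longlonglongrightarrow> 0" by simp
    have "(r n)\<^sup>2 < 1" for n
      unfolding abs_square_less_1 by (auto simp: r_def field_simps abs_if)
    then show "\<forall>\<^sub>F n in sequentially. 0 < 1 - (r n)\<^sup>2" by simp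
  qed (use assms in simp)
  then show ?thesis by (rule filterlim_compose[OF tendsto_arctan_at_top])
qed

section \<open>Exit probability of the interval by Abel summation\<close>

context real_brownian
begin

text \<open>Integrate the cosine series term by term; \<open>r < 1\<close> gives the absolute
  summability for this. The frequencies are those whose cosines vanish at \<open>u\<close>, so the
  term of index \<open>k\<close> contributes \<open>q ^ ((2 * k + 1)^2)\<close>: exponent 1 is the
  main term and 9 comes next. The error bound is independent of \<open>r\<close>.\<close>

lemma abel_mean_stays_approx:
  fixes u t r :: real
  assumes t: "0 < t" and u: "0 < u" and r: "0 \<le> r" "r < 1"
  defines "q \<equiv> exp (- (pi\<^sup>2 * t / (8 * u\<^sup>2)))"
  shows "\<bar>expectation (\<lambda>w. indicator (stays {-u<..<u} 0 t) w *
      (2 / pi * arctan (2 * r * cos (pi / (2 * u) * Y t w) / (1 - r\<^sup>2)))) - 4 / pi * r * q\<bar> \<le> 4 / pi * (q ^ 9 / (1 - q ^ 8))"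
proof -
  let ?A = "\<lambda>w. 2 / pi * arctan (2 * r * cos (pi / (2 * u) * Y t w) / (1 - r\<^sup>2))"
  let ?I = "\<lambda>w. indicator (stays {-u<..<u} 0 t) w :: real"
  have [measurable]: "?I \<in> borel_measurable M" by (intro stays_real_borel) auto
  define c where "c k = real (2 * k + 1) * (pi / (2 * u))" for k
  \<comment> \<open>The factor \<open>4 / pi\<close> normalises the square wave to the value 1 on
    the interval; it matches \<open>2 / pi * arctan\<close> because the series sums to half an
    arctangent.\<close>
  define a where "a k = 4 / pi * ((-1) ^ k / real (2 * k + 1) * r ^ (2 * k + 1))" for k
  define f where "f k w = ?I w * (a k * cos (c k * Y t w))" for k w
  have q: "0 < q" "q < 1" using t u by (auto simp: q_def)
  have a_le: "\<bar>a k\<bar> \<le> 4 / pi * r ^ k" for k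
  proof -
    have "\<bar>a k\<bar> = 4 / pi * (r ^ (2 * k + 1) / real (2 * k + 1))"
      using r by (simp add: a_def abs_mult power_abs)
    also have "r ^ (2 * k + 1) / real (2 * k + 1) \<le> r ^ (2 * k + 1) / 1"
      using r by (intro divide_left_mono) auto
    also have "r ^ (2 * k + 1) \<le> r ^ k" using r by (intro power_decreasing) auto
    finally show ?thesis by (simp add: mult_left_mono divide_right_mono)
  qed
  have a_le1: "\<bar>a k\<bar> \<le> 4 / pi" for k
    using a_le[of k] mult_left_mono[OF power_le_one[OF r(1), of k], of "4 / pi"] r by simp
  have summ: "summable (\<lambda>k. 4 / pi * r ^ k)"
    using r by (intro summable_mult summable_geometric) auto
  have f_le: "norm (f k w) \<le> 4 / pi * r ^ k" for k w
  proof -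
    have "norm (f k w) \<le> \<bar>a k\<bar> * \<bar>cos (c k * Y t w)\<bar>"
      by (auto simp: f_def indicator_def abs_mult)
    also have "\<dots> \<le> \<bar>a k\<bar> * 1" by (intro mult_left_mono) auto
    finally show ?thesis using a_le[of k] by simp
  qed
  have f_int: "integrable M (f k)" for k
  proof (rule integrable_const_bound[of _ "4 / pi * r ^ k"])
    show "f k \<in> borel_measurable M" unfolding f_def by measurable
  qed (use f_le in auto)
  have Ef: "expectation (f k) = a k * q ^ ((2 * k + 1)\<^sup>2)" for k
  proof -
    have "c k * u = real (2 * k + 1) * (pi / 2)" using u by (simp add: c_def)
    then have cu: "cos (c k * u) = 0" by (simp only: cos_odd_half_pi)
    have c0: "0 \<le> c k" using u by (simp add: c_def)
    have "expectation (f k) = a k * expectation (\<lambda>w. ?I w * cos (c k * Y t w))"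
      unfolding f_def mult.left_commute[of "?I _" "a k"] by simp
    also have "\<dots> = a k * exp (- ((c k)\<^sup>2 * t) / 2)"
      by (simp only: expectation_cos_stays[OF c0 t u cu])
    also have "- ((c k)\<^sup>2 * t) / 2 = real ((2 * k + 1)\<^sup>2) * (- (pi\<^sup>2 * t / (8 * u\<^sup>2)))"
    proof -
      have "- ((b * (pi / (2 * u)))\<^sup>2 * t) / 2 = b\<^sup>2 * (- (pi\<^sup>2 * t / (8 * u\<^sup>2)))" for b :: real
        using u by (simp add: power_mult_distrib power_divide field_simps)
      then show ?thesis by (simp only: c_def of_nat_power)
    qed
    also have "exp \<dots> = q ^ ((2 * k + 1)\<^sup>2)" unfolding q_def by (rule exp_of_nat_mult)
    finally show ?thesis .
  qed
  have pointwise: "(\<lambda>k. f k w) sums (?I w * (?A w))" for w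
  proof -
    define \<theta> where "\<theta> = pi / (2 * u) * Y t w"
    have "(\<lambda>k. ?I w * (4 / pi * ((-1) ^ k / real (2 * k + 1) * (r ^ (2 * k + 1) * cos (real (2 * k + 1) * \<theta>)))))
        sums (?I w * (4 / pi * (arctan (2 * r * cos \<theta> / (1 - r\<^sup>2)) / 2)))"
      by (intro sums_mult abel_square_wave_sums r)
    moreover have "?I w * (4 / pi * ((-1) ^ k / real (2 * k + 1) * (r ^ (2 * k + 1) * cos (real (2 * k + 1) * \<theta>)))) = f k w" for k
      by (simp add: f_def a_def c_def \<theta>_def mult.assoc)
    ultimately show ?thesis by (simp add: \<theta>_def)
  qed
  have "(\<lambda>k. expectation (f k)) sums expectation (\<lambda>w. \<Sum>k. f k w)"
  proof (rule sums_integral[OF f_int])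
    show "AE w in M. summable (\<lambda>k. norm (f k w))"
      by (intro AE_I2 summable_comparison_test'[OF summ]) (use f_le in simp)
    show "summable (\<lambda>k. expectation (\<lambda>w. norm (f k w)))"
    proof (rule summable_comparison_test'[OF summ])
      fix k
      have "expectation (\<lambda>w. norm (f k w)) \<le> expectation (\<lambda>w. 4 / pi * r ^ k)"
        by (intro integral_mono integrable_norm f_int f_le) auto
      then show "norm (expectation (\<lambda>w. norm (f k w))) \<le> 4 / pi * r ^ k"
        by (simp add: prob_space)
    qed
  qed
  moreover have "(\<Sum>k. f k w) = ?I w * (?A w)" for w
    using pointwise by (rule sums_unique[symmetric])
  ultimately have sums: "(\<lambda>k. a k * q ^ ((2 * k + 1)\<^sup>2)) sums
      expectation (\<lambda>w. ?I w * (?A w))" (is "_ sums ?E")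
    by (simp only: Ef)
  define g where "g k = a (Suc k) * q ^ ((2 * Suc k + 1)\<^sup>2)" for k
  have "g sums (?E - 4 / pi * r * q)"
  proof -
    have "a 0 * q ^ ((2 * 0 + 1)\<^sup>2) = 4 / pi * r * q" by (simp add: a_def)
    then have "(\<lambda>k. a k * q ^ ((2 * k + 1)\<^sup>2)) sums (?E - 4 / pi * r * q + a 0 * q ^ ((2 * 0 + 1)\<^sup>2))"
      using sums by (simp only: diff_add_cancel)
    then show ?thesis unfolding g_def by (rule iffD2[OF sums_Suc_iff])
  qed
  then have g_sum: "suminf g = ?E - 4 / pi * r * q" by (rule sums_unique[symmetric])
  have g_le: "norm (g k) \<le> 4 / pi * q ^ 9 * (q ^ 8) ^ k" for k
  proof -
    \<comment> \<open>The quadratic exponent \<open>(2 * k + 3)^2\<close> is bounded below by a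
      linear one, which leaves a geometric series of ratio \<open>q ^ 8\<close>.\<close>
    have "9 + 8 * k \<le> (2 * Suc k + 1)\<^sup>2" by (simp add: power2_eq_square)
    then have "q ^ ((2 * Suc k + 1)\<^sup>2) \<le> q ^ (9 + 8 * k)" using q by (intro power_decreasing) auto
    then have "norm (g k) \<le> 4 / pi * q ^ (9 + 8 * k)"
      unfolding g_def norm_mult using a_le1[of "Suc k"] q by (intro mult_mono) auto
    then show ?thesis by (simp add: power_add power_mult mult.assoc)
  qed
  have q8: "q ^ 8 < 1" using q by (simp add: power_less_one_iff)
  have geo: "(\<lambda>k. 4 / pi * q ^ 9 * (q ^ 8) ^ k) sums (4 / pi * q ^ 9 * (1 / (1 - q ^ 8)))"
    using q q8 by (intro sums_mult geometric_sums) auto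
  have "norm (suminf g) \<le> (\<Sum>k. 4 / pi * q ^ 9 * (q ^ 8) ^ k)"
    by (rule norm_suminf_le[OF g_le sums_summable[OF geo]])
  also have "\<dots> = 4 / pi * q ^ 9 * (1 / (1 - q ^ 8))" by (rule sums_unique[OF geo, symmetric])
  finally show ?thesis unfolding g_sum by simp
qed

text \<open>Let \<open>r -> 1\<close>. On the survival event \<open>\<bar>Y t w\<bar> < u\<close>,
  so the cosine is positive and the Abel means tend boundedly to 1.\<close>

lemma survival_interval_approx:
  fixes u t :: real
  assumes t: "0 < t" and u: "0 < u"
  defines "q \<equiv> exp (- (pi\<^sup>2 * t / (8 * u\<^sup>2)))"
  shows "\<bar>survival {-u<..<u} t 0 - 4 / pi * q\<bar> \<le> 4 / pi * (q ^ 9 / (1 - q ^ 8))"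
proof -
  let ?I = "\<lambda>w. indicator (stays {-u<..<u} 0 t) w :: real"
  have [measurable]: "?I \<in> borel_measurable M" by (intro stays_real_borel) auto
  define r where "r n = 1 - inverse (real (Suc n))" for n
  have r: "0 \<le> r n" "r n < 1" for n by (auto simp: r_def field_simps)
  have r_lim: "r \<longlonglongrightarrow> 1"
    unfolding r_def using tendsto_diff[OF tendsto_const LIMSEQ_inverse_real_of_nat, of 1] by simp
  define A where "A n w = 2 / pi * arctan (2 * r n * cos (pi / (2 * u) * Y t w) / (1 - (r n)\<^sup>2))" for n w
  have [measurable]: "A n \<in> borel_measurable M" for n unfolding A_def by measurable
  have A_le: "\<bar>A n w\<bar> \<le> 1" for n w
  proof -
    have "\<bar>2 / pi * arctan x\<bar> \<le> 1" for x
      using arctan_bounded[of x] by (auto simp: abs_le_iff field_simps)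
    then show ?thesis unfolding A_def .
  qed
  have "(\<lambda>n. expectation (\<lambda>w. ?I w * A n w)) \<longlonglongrightarrow> expectation ?I"
  proof (rule integral_dominated_convergence[where w="\<lambda>_. 1"])
    show "AE w in M. (\<lambda>n. ?I w * A n w) \<longlonglongrightarrow> ?I w"
    proof (rule AE_I2)
      fix w assume w: "w \<in> space M"
      show "(\<lambda>n. ?I w * A n w) \<longlonglongrightarrow> ?I w"
      proof (cases "w \<in> stays {-u<..<u} 0 t")
        case True
        then have "0 + Y t w \<in> {-u<..<u}" using t unfolding stays_def by auto
        then have "\<bar>Y t w\<bar> < u" by auto
        then have "\<bar>pi / (2 * u) * Y t w\<bar> < pi / 2"
          using u by (simp add: abs_mult field_simps)
        then have "- (pi / 2) < pi / (2 * u) * Y t w" "pi / (2 * u) * Y t w < pi / 2" by linarith+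
        then have "0 < cos (pi / (2 * u) * Y t w)" by (rule cos_gt_zero_pi)
        from tendsto_abel_arctan[OF this] have "(\<lambda>n. A n w) \<longlonglongrightarrow> 2 / pi * (pi / 2)"
          unfolding A_def r_def by (intro tendsto_intros)
        then show ?thesis using True by simp
      qed simp
    qed
    show "AE w in M. norm (?I w * A n w) \<le> 1" for n
      using A_le[of n] by (intro AE_I2) (auto simp: indicator_def)
  qed auto
  moreover have "expectation ?I = survival {-u<..<u} t 0"
  proof -
    have "expectation ?I = expectation (\<lambda>w. indicator (stays {-u<..<u} 0 t \<inter> space M) w)"
      by (intro Bochner_Integration.integral_cong) (auto simp: indicator_def)
    then show ?thesis using stays_borel[of "{-u<..<u}" 0 t] by (simp add: survival_def)
  qed
  ultimately have "(\<lambda>n. \<bar>expectation (\<lambda>w. ?I w * A n w) - 4 / pi * r n * q\<bar>) \<longlonglongrightarrow> \<bar>survival {-u<..<u} t 0 - 4 / pi * 1 * q\<bar>"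
    by (intro tendsto_intros r_lim) simp
  then have "\<bar>survival {-u<..<u} t 0 - 4 / pi * 1 * q\<bar> \<le> 4 / pi * (q ^ 9 / (1 - q ^ 8))"
    using abel_mean_stays_approx[OF t u r] unfolding A_def q_def by (intro LIMSEQ_le_const2) auto
  then show ?thesis by simp
qed

text \<open>A bound for all \<open>t\<close> and \<open>u\<close>, including the range where
  \<open>q\<close> is near 1 and the error term above blows up. For \<open>q <= 1/2\<close> main
  term and error are together at most \<open>6 / pi * q\<close>; for larger \<open>q\<close> the
  claim exceeds 1.\<close>

lemma survival_interval_le:
  fixes u t :: real
  assumes t: "0 < t" and u: "0 < u"
  shows "survival {-u<..<u} t 0 \<le> 3 * exp (- (pi\<^sup>2 * t / (8 * u\<^sup>2)))"
proof -
  define q where "q = exp (- (pi\<^sup>2 * t / (8 * u\<^sup>2)))"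
  have q: "0 < q" by (simp add: q_def)
  show ?thesis
  proof (cases "q \<le> 1 / 2")
    case True
    have "q ^ 8 \<le> (1 / 2) ^ 8" using q True by (intro power_mono) auto
    then have q8: "q ^ 8 \<le> 1 / 256" by (simp add: power_divide)
    have "q ^ 9 / (1 - q ^ 8) = q * (q ^ 8 / (1 - q ^ 8))" by (simp add: power_Suc[symmetric] numeral_eq_Suc)
    also have "\<dots> \<le> q * (1 / 2)"
      using q q8 by (intro mult_left_mono) (auto simp: field_simps)
    finally have "4 / pi * (q ^ 9 / (1 - q ^ 8)) \<le> 4 / pi * (q * (1 / 2))"
      by (intro mult_left_mono) auto
    then have "survival {-u<..<u} t 0 \<le> 4 / pi * q + 4 / pi * (q * (1 / 2))"
      using survival_interval_approx[OF t u] unfolding q_def[symmetric] by linarith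
    also have "\<dots> = 6 / pi * q" by (simp add: field_simps)
    also have "\<dots> \<le> 3 * q" using q pi_ge_two by (intro mult_right_mono) (auto simp: field_simps)
    finally show ?thesis by (simp add: q_def)
  next
    case False
    then show ?thesis using survival_le_1[of "{-u<..<u}" t 0] by (simp add: q_def)
  qed
qed

end

section \<open>Laplace's method\<close>

lemma nn_integral_gaussian:
  fixes a :: real
  assumes a: "0 < a"
  shows "(\<integral>\<^sup>+x. ennreal (exp (- a * x\<^sup>2)) \<partial>lborel) = ennreal (sqrt (pi / a))"
proof -
  define \<sigma> where "\<sigma> = sqrt (1 / (2 * a))"
  have \<sigma>: "0 < \<sigma>" "\<sigma>\<^sup>2 = 1 / (2 * a)" using a by (auto simp: \<sigma>_def)
  have eq: "exp (- a * x\<^sup>2) = sqrt (pi / a) * normal_density 0 \<sigma> x" for x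
    using a unfolding normal_density_def \<sigma>(2) by (simp add: real_sqrt_divide)
  have 1: "(\<integral>\<^sup>+x. ennreal (normal_density 0 \<sigma> x) \<partial>lborel) = 1"
    using prob_space.emeasure_space_1[OF prob_space_normal_density[OF \<sigma>(1), of 0]]
    by (simp add: emeasure_density)
  have "(\<integral>\<^sup>+x. ennreal (exp (- a * x\<^sup>2)) \<partial>lborel) = (\<integral>\<^sup>+x. ennreal (sqrt (pi / a)) * ennreal (normal_density 0 \<sigma> x) \<partial>lborel)"
    unfolding eq using a by (simp add: ennreal_mult)
  also have "\<dots> = ennreal (sqrt (pi / a)) * (\<integral>\<^sup>+x. ennreal (normal_density 0 \<sigma> x) \<partial>lborel)"
    by (rule nn_integral_cmult) simp
  finally show ?thesis by (simp add: 1)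
qed

lemma nn_integral_exp_tail:
  fixes lam m :: real
  assumes lam: "0 < lam"
  shows "(\<integral>\<^sup>+u. ennreal (lam * exp (- lam * u)) * indicator {m..} u \<partial>lborel) = ennreal (exp (- lam * m))"
proof -
  have "((\<lambda>x. exp (- lam * x)) \<longlongrightarrow> 0) at_top"
    using lam by real_asymp
  then have "((\<lambda>x. - exp (- lam * x)) \<longlongrightarrow> 0) at_top"
    using tendsto_minus by fastforce
  then have "(\<integral>\<^sup>+u. ennreal (lam * exp (- lam * u)) * indicator {m..} u \<partial>lborel) = ennreal (0 - (- exp (- lam * m)))"
    using lam by (intro nn_integral_FTC_atLeast) (auto intro!: derivative_eq_intros)
  then show ?thesis by simp
qed

lemma nn_integral_exp_abs_finite:
  fixes lam :: real
  assumes lam: "0 < lam"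
  shows "(\<integral>\<^sup>+x. ennreal (exp (- lam * \<bar>x\<bar>)) \<partial>lborel) < \<infinity>"
proof -
  let ?f = "\<lambda>x. ennreal (lam * exp (- lam * x)) * indicator {0..} x"
  have 1: "(\<integral>\<^sup>+x. ?f x \<partial>lborel) = 1"
    using nn_integral_exp_tail[OF lam, of 0] by simp
  have "(\<integral>\<^sup>+x. ?f x \<partial>lborel) = ennreal \<bar>- 1\<bar> * (\<integral>\<^sup>+x. ?f (0 + - 1 * x) \<partial>lborel)"
    by (rule nn_integral_real_affine) auto
  then have 2: "(\<integral>\<^sup>+x. ?f (- x) \<partial>lborel) = 1" using 1 by simp
  have "(\<integral>\<^sup>+x. ennreal lam * ennreal (exp (- lam * \<bar>x\<bar>)) \<partial>lborel) \<le> (\<integral>\<^sup>+x. ?f x + ?f (- x) \<partial>lborel)"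
    using lam by (intro nn_integral_mono) (auto simp: ennreal_mult indicator_def abs_if)
  also have "\<dots> = (\<integral>\<^sup>+x. ?f x \<partial>lborel) + (\<integral>\<^sup>+x. ?f (- x) \<partial>lborel)"
    by (rule nn_integral_add) auto
  finally have "ennreal lam * (\<integral>\<^sup>+x. ennreal (exp (- lam * \<bar>x\<bar>)) \<partial>lborel) \<le> 2"
    unfolding 1 2 by (subst (asm) nn_integral_cmult) auto
  then show ?thesis
    using lam by (metis ennreal_mult_top infinity_ennreal_def less_top ennreal_eq_0_iff leD top.not_eq_extremum ennreal_numeral ennreal_less_top not_le)
qed

text \<open>The left side is a function of \<open>v > 0\<close> minus its minimum, attained at
  \<open>v0\<close>. The exact factorisation takes the place of a Taylor expansion and serves both
  the pointwise limit and the global majorant.\<close>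

lemma exponent_identity:
  fixes lam v0 v :: real
  assumes v: "v \<noteq> 0"
  shows "lam * v + (lam * v0 ^ 3 / 2) / v\<^sup>2 - 3 / 2 * lam * v0 = lam * (v - v0)\<^sup>2 * (2 * v + v0) / (2 * v\<^sup>2)"
  using v by (simp add: field_simps power2_eq_square power3_eq_cube)

text \<open>The condition relating \<open>v0\<close> and \<open>lam\<close> says that
  \<open>v0\<close> is the critical point. With \<open>b = t powr (1/6)\<close> and
  \<open>u = b\<twosuperior> * v0 + b * x\<close>, the Jacobian \<open>b\<close> cancels
  \<open>t powr (-1/6)\<close> and dominated convergence applies to the rescaled integrand.\<close>

lemma laplace_method_limit:
  fixes S :: "real \<Rightarrow> real \<Rightarrow> real" and lam v0 :: real
  assumes lam: "0 < lam" and v0: "0 < v0" "pi\<^sup>2 / 8 = lam * v0 ^ 3 / 2"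
    and S [measurable]: "\<And>t. (\<lambda>u. S u t) \<in> borel_measurable borel"
    and S0: "\<And>u t. 0 \<le> S u t"
    and S_le: "\<And>u t. 0 < u \<Longrightarrow> 0 < t \<Longrightarrow> S u t \<le> 3 * exp (- (pi\<^sup>2 * t / (8 * u\<^sup>2)))"
    and S_approx: "\<And>u t q. 0 < u \<Longrightarrow> 0 < t \<Longrightarrow> q = exp (- (pi\<^sup>2 * t / (8 * u\<^sup>2))) \<Longrightarrow>
      \<bar>S u t - 4 / pi * q\<bar> \<le> 4 / pi * (q ^ 9 / (1 - q ^ 8))"
    and I: "\<And>t. 0 \<le> I t"
      "\<And>t. 0 < t \<Longrightarrow> ennreal (I t) = (\<integral>\<^sup>+u. ennreal (indicator {0<..} u * (lam * exp (- lam * u) * S u t)) \<partial>lborel)"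
  shows "((\<lambda>t. t powr (-1/6) * exp (3 / 2 * lam * v0 * t powr (1/3)) * I t) \<longlongrightarrow>
     lam * (4 / pi) * sqrt (2 * pi * v0 / (3 * lam))) at_top"
proof -
  let ?G = "\<integral>\<^sup>+x. ennreal (lam * (4 / pi) * exp (- (3 * lam / (2 * v0)) * x\<^sup>2)) \<partial>lborel"
  let ?C = "lam * (4 / pi) * sqrt (2 * pi * v0 / (3 * lam))"
  let ?W = "\<lambda>x v. lam * x\<^sup>2 * (2 * v + v0) / (2 * v\<^sup>2)"
  let ?F = "\<lambda>t. t powr (-1/6) * exp (3 / 2 * lam * v0 * t powr (1/3)) * I t"
  \<comment> \<open>The rescaled integrand, divided by its peak value on the exponential scale;
    \<open>b ^ 6\<close> plays the role of \<open>t\<close>.\<close>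
  define J where "J b x = indicator {0<..} (b\<^sup>2 * v0 + b * x) *
     (lam * exp (- lam * (b\<^sup>2 * v0 + b * x)) * S (b\<^sup>2 * v0 + b * x) (b ^ 6)) * exp (3 / 2 * lam * v0 * b\<^sup>2)" for b x
  have [measurable]: "J b \<in> borel_measurable borel" for b
    unfolding J_def by measurable
  have J0: "0 \<le> J b x" for b x
    using lam S0 by (simp add: J_def)
  have scaled: "ennreal (?F t) = (\<integral>\<^sup>+x. ennreal (J (t powr (1/6)) x) \<partial>lborel)"
    if t: "0 < t" for t
  proof -
    define b where "b = t powr (1/6)"
    have b: "0 < b" using t by (simp add: b_def)
    have b6: "b ^ 6 = t" and b2: "b\<^sup>2 = t powr (1/3)" and bi: "t powr (-1/6) = 1 / b"
      using t by (simp_all add: b_def powr_power powr_minus_divide)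
    define E where "E = exp (3 / 2 * lam * v0 * b\<^sup>2)"
    let ?f = "\<lambda>u. ennreal (indicator {0<..} u * (lam * exp (- lam * u) * S u t))"
    have "ennreal (I t) = (\<integral>\<^sup>+u. ?f u \<partial>lborel)" by (rule I(2)[OF t])
    also have "\<dots> = ennreal \<bar>b\<bar> * (\<integral>\<^sup>+x. ?f (b\<^sup>2 * v0 + b * x) \<partial>lborel)"
      using b by (intro nn_integral_real_affine) auto
    finally have I_eq: "ennreal (I t) = ennreal b * (\<integral>\<^sup>+x. ?f (b\<^sup>2 * v0 + b * x) \<partial>lborel)" using b by simp
    have "(\<integral>\<^sup>+x. ennreal (J b x) \<partial>lborel) = (\<integral>\<^sup>+x. ?f (b\<^sup>2 * v0 + b * x) * ennreal E \<partial>lborel)"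
      using lam S0 by (simp add: J_def E_def b6 ennreal_mult''[symmetric])
    also have "\<dots> = (\<integral>\<^sup>+x. ?f (b\<^sup>2 * v0 + b * x) \<partial>lborel) * ennreal E"
      by (rule nn_integral_multc) measurable
    also have "(\<integral>\<^sup>+x. ?f (b\<^sup>2 * v0 + b * x) \<partial>lborel) = ennreal (1 / b) * (ennreal b * (\<integral>\<^sup>+x. ?f (b\<^sup>2 * v0 + b * x) \<partial>lborel))"
      using b by (simp add: mult.assoc[symmetric] ennreal_mult[symmetric])
    also have "\<dots> * ennreal E = ennreal (1 / b) * ennreal (I t) * ennreal E"
      by (simp only: I_eq)
    also have "\<dots> = ennreal (1 / b * E * I t)"
      using b I(1)[of t] by (simp add: ennreal_mult[symmetric] E_def mult_ac)
    finally show ?thesis by (simp only: b2[symmetric] bi E_def b_def[symmetric])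
  qed
  \<comment> \<open>Dividing \<open>S\<close> by its leading exponential \<open>q\<close> isolates a
    ratio that is bounded by 3 and tends to \<open>4 / pi\<close>; all remaining exponentials
    combine into \<open>?W\<close>.\<close>
  have J_form: "J b x = lam * (S u (b ^ 6) / q) * exp (- (?W x v))"
    if b: "0 < b" and v: "v = v0 + x / b" "0 < v" and u: "u = b\<^sup>2 * v"
      and q: "q = exp (- (pi\<^sup>2 * b ^ 6 / (8 * u\<^sup>2)))" for b x v u q
  proof -
    have u': "b\<^sup>2 * v0 + b * x = u" using b by (simp add: u v field_simps power2_eq_square)
    have u0: "0 < u" using b v by (simp add: u)
    have x: "x = b * (v - v0)" using b by (simp add: v)
    have qe: "pi\<^sup>2 * b ^ 6 / (8 * u\<^sup>2) = b\<^sup>2 * ((lam * v0 ^ 3 / 2) / v\<^sup>2)"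
    proof -
      have "pi\<^sup>2 * b ^ 6 / (8 * u\<^sup>2) = (pi\<^sup>2 / 8) * (b ^ 6 / (b\<^sup>2 * v)\<^sup>2)" by (simp add: u)
      also have "b ^ 6 / (b\<^sup>2 * v)\<^sup>2 = b\<^sup>2 / v\<^sup>2"
        using b v(2) by (simp add: power_mult_distrib field_simps flip: power_add power_mult)
      finally show ?thesis unfolding v0(2) by simp
    qed
    have ex: "- lam * u + 3 / 2 * lam * v0 * b\<^sup>2 = pi\<^sup>2 * b ^ 6 / (8 * u\<^sup>2) - ?W x v"
    proof -
      have "- lam * u + 3 / 2 * lam * v0 * b\<^sup>2 - pi\<^sup>2 * b ^ 6 / (8 * u\<^sup>2) =
          - (b\<^sup>2 * (lam * v + (lam * v0 ^ 3 / 2) / v\<^sup>2 - 3 / 2 * lam * v0))"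
        unfolding qe unfolding u by (simp add: algebra_simps)
      also have "\<dots> = - (b\<^sup>2 * (lam * (v - v0)\<^sup>2 * (2 * v + v0) / (2 * v\<^sup>2)))"
        using v(2) by (subst exponent_identity) auto
      also have "\<dots> = - (?W x v)"
        unfolding x by (simp add: power_mult_distrib mult_ac)
      finally show ?thesis by simp
    qed
    have "exp (- lam * u) * exp (3 / 2 * lam * v0 * b\<^sup>2) = exp (- (?W x v)) / q"
    proof -
      have rule: "exp a * exp e = exp (- W) / exp (- Q)" if "a + e = Q - W" for a e W Q :: real
        using that by (metis exp_add exp_diff diff_minus_eq_add add.commute uminus_add_conv_diff)
      show ?thesis unfolding q by (rule rule[OF ex])
    qed
    moreover have "J b x = lam * S u (b ^ 6) * (exp (- lam * u) * exp (3 / 2 * lam * v0 * b\<^sup>2))"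
      unfolding J_def u' using u0 by simp
    ultimately show ?thesis by simp
  qed
  have v_pos: "0 < v0 + x / b" if "0 < b" "0 < b\<^sup>2 * v0 + b * x" for b x
  proof -
    have "b\<^sup>2 * v0 + b * x = b\<^sup>2 * (v0 + x / b)" using that(1) by (simp add: field_simps power2_eq_square)
    with that show ?thesis by (simp add: zero_less_mult_iff)
  qed
  \<comment> \<open>For \<open>b >= 1\<close> one has \<open>v <= v0 + \<bar>x\<bar>\<close>, and
    \<open>?W\<close> is at least \<open>lam * x^2 / v\<close>, hence at least
    \<open>lam * (\<bar>x\<bar> - v0)\<close>. The majorant is therefore exponential and covers all
    \<open>x\<close>, not just a neighbourhood of the peak.\<close>
  have J_le: "J b x \<le> 3 * lam * exp (lam * v0) * exp (- lam * \<bar>x\<bar>)" if b: "1 \<le> b" for b x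
  proof (cases "0 < b\<^sup>2 * v0 + b * x")
    case False
    then show ?thesis using lam by (simp add: J_def)
  next
    case True
    define v where "v = v0 + x / b"
    define u where "u = b\<^sup>2 * v"
    define q where "q = exp (- (pi\<^sup>2 * b ^ 6 / (8 * u\<^sup>2)))"
    have b0: "0 < b" using b by simp
    have v: "0 < v" using v_pos[OF b0 True] by (simp add: v_def)
    have u: "0 < u" using b0 v by (simp add: u_def)
    have "S u (b ^ 6) / q \<le> 3"
      using S_le[OF u, of "b ^ 6"] b0 by (simp add: q_def field_simps)
    moreover have "exp (- (?W x v)) \<le> exp (lam * v0 + - lam * \<bar>x\<bar>)"
    proof -
      have "v \<le> v0 + \<bar>x\<bar>"
      proof -
        have "\<bar>x\<bar> / b \<le> \<bar>x\<bar> / 1" using b by (intro divide_left_mono) auto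
        moreover have "x / b \<le> \<bar>x\<bar> / b" using b0 by (intro divide_right_mono) auto
        ultimately show ?thesis by (simp add: v_def)
      qed
      have "(\<bar>x\<bar> - v0) * (\<bar>x\<bar> + v0) \<le> x\<^sup>2"
        by (simp add: algebra_simps power2_eq_square)
      then have "\<bar>x\<bar> - v0 \<le> x\<^sup>2 / (\<bar>x\<bar> + v0)"
        using v0 by (simp add: pos_le_divide_eq add_nonneg_pos)
      also have "\<dots> \<le> x\<^sup>2 / v" using \<open>v \<le> v0 + \<bar>x\<bar>\<close> v by (intro divide_left_mono) auto
      also have "\<dots> \<le> x\<^sup>2 * ((2 * v + v0) / (2 * v\<^sup>2))"
      proof -
        have "1 / v \<le> (2 * v + v0) / (2 * v\<^sup>2)" using v v0 by (simp add: field_simps power2_eq_square)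
        from mult_left_mono[OF this, of "x\<^sup>2"] show ?thesis by simp
      qed
      finally have "lam * (\<bar>x\<bar> - v0) \<le> lam * (x\<^sup>2 * ((2 * v + v0) / (2 * v\<^sup>2)))"
        using lam by (intro mult_left_mono) auto
      then show ?thesis by (simp add: algebra_simps)
    qed
    ultimately have "lam * (S u (b ^ 6) / q) * exp (- (?W x v)) \<le> lam * 3 * exp (lam * v0 + - lam * \<bar>x\<bar>)"
      using lam S0 by (intro mult_mono) (auto simp: q_def)
    then show ?thesis
      unfolding J_form[OF b0 v_def v u_def q_def] exp_add by (simp add: mult_ac)
  qed
  have J_lim: "((\<lambda>b. J b x) \<longlongrightarrow> lam * (4 / pi) * exp (- (3 * lam / (2 * v0)) * x\<^sup>2)) at_top" for x
  proof -
    define v where "v b = v0 + x / b" for b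
    define u where "u b = b\<^sup>2 * v b" for b
    define q where "q b = exp (- (pi\<^sup>2 * b ^ 6 / (8 * (u b)\<^sup>2)))" for b
    have v_lim: "(v \<longlongrightarrow> v0) at_top"
      unfolding v_def by real_asymp
    have v_ev: "\<forall>\<^sub>F b in at_top. 0 < v b"
      using order_tendstoD(1)[OF v_lim v0(1)] .
    have q_lim: "(q \<longlongrightarrow> 0) at_top"
    proof -
      have lim1: "((\<lambda>b. pi\<^sup>2 / (8 * (v b)\<^sup>2)) \<longlongrightarrow> pi\<^sup>2 / (8 * v0\<^sup>2)) at_top"
        using v0(1) by (intro tendsto_intros v_lim) auto
      have lim2: "filterlim (\<lambda>b::real. b\<^sup>2) at_top at_top" by real_asymp
      have "filterlim (\<lambda>b. pi\<^sup>2 / (8 * (v b)\<^sup>2) * b\<^sup>2) at_top at_top"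
        using v0(1) by (intro filterlim_tendsto_pos_mult_at_top[OF lim1 _ lim2]) simp
      then have "((\<lambda>b. exp (- (pi\<^sup>2 / (8 * (v b)\<^sup>2) * b\<^sup>2))) \<longlongrightarrow> 0) at_top"
        by (intro filterlim_compose[OF exp_at_bot] filterlim_compose[OF filterlim_uminus_at_bot_at_top])
      moreover have "\<forall>\<^sub>F b in at_top. exp (- (pi\<^sup>2 / (8 * (v b)\<^sup>2) * b\<^sup>2)) = q b"
        using eventually_gt_at_top[of 0]
      proof eventually_elim
        case (elim b)
        have "pi\<^sup>2 * b ^ 6 / (8 * (u b)\<^sup>2) = pi\<^sup>2 / 8 * (b ^ 6 / (b ^ 4 * (v b)\<^sup>2))"
          by (simp add: u_def power_mult_distrib)
        also have "\<dots> = pi\<^sup>2 / 8 * (b ^ 4 * b\<^sup>2 / (b ^ 4 * (v b)\<^sup>2))" by (simp flip: power_add)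
        also have "\<dots> = pi\<^sup>2 / (8 * (v b)\<^sup>2) * b\<^sup>2"
          using elim by (subst mult_divide_mult_cancel_left) auto
        finally show ?case by (simp only: q_def)
      qed
      ultimately show ?thesis by (rule Lim_transform_eventually)
    qed
    \<comment> \<open>The relative error is of order \<open>q ^ 8\<close>, and \<open>q\<close>
      tends to 0 because \<open>u\<close> is of order \<open>b^2\<close> while the time is
      \<open>b ^ 6\<close>.\<close>
    have ratio: "((\<lambda>b. S (u b) (b ^ 6) / q b) \<longlongrightarrow> 4 / pi) at_top"
    proof (rule LIM_zero_cancel, rule Lim_null_comparison)
      show "\<forall>\<^sub>F b in at_top. norm (S (u b) (b ^ 6) / q b - 4 / pi) \<le> 4 / pi * (q b ^ 8 / (1 - q b ^ 8))"
        using v_ev eventually_gt_at_top[of 0]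
      proof eventually_elim
        case (elim b)
        have ub: "0 < u b" using elim by (simp add: u_def)
        have qb: "0 < q b" by (simp add: q_def)
        have "\<bar>S (u b) (b ^ 6) - 4 / pi * q b\<bar> / q b \<le> 4 / pi * (q b ^ 9 / (1 - q b ^ 8)) / q b"
          using S_approx[OF ub _ q_def] elim qb by (intro divide_right_mono) auto
        also have "4 / pi * (q b ^ 9 / (1 - q b ^ 8)) / q b = 4 / pi * (q b ^ 8 / (1 - q b ^ 8))"
          using qb by (simp add: numeral_eq_Suc)
        also have "\<bar>S (u b) (b ^ 6) - 4 / pi * q b\<bar> / q b = \<bar>S (u b) (b ^ 6) / q b - 4 / pi\<bar>"
        proof -
          have "(S (u b) (b ^ 6) - 4 / pi * q b) / q b = S (u b) (b ^ 6) / q b - 4 / pi"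
            using qb by (simp add: diff_divide_distrib)
          then show ?thesis using qb by (metis abs_divide abs_of_pos)
        qed
        finally show ?case by simp
      qed
      have "((\<lambda>b. 4 / pi * (q b ^ 8 / (1 - q b ^ 8))) \<longlongrightarrow> 4 / pi * (0 ^ 8 / (1 - 0 ^ 8))) at_top"
        by (intro tendsto_intros q_lim) auto
      then show "((\<lambda>b. 4 / pi * (q b ^ 8 / (1 - q b ^ 8))) \<longlongrightarrow> 0) at_top" by simp
    qed
    have "((\<lambda>b. lam * (S (u b) (b ^ 6) / q b) * exp (- (lam * x\<^sup>2 * (2 * v b + v0) / (2 * (v b)\<^sup>2)))) \<longlongrightarrow>
        lam * (4 / pi) * exp (- (lam * x\<^sup>2 * (2 * v0 + v0) / (2 * v0\<^sup>2)))) at_top"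
      using v0 by (intro tendsto_intros ratio v_lim) auto
    moreover have "lam * x\<^sup>2 * (2 * v0 + v0) / (2 * v0\<^sup>2) = 3 * lam / (2 * v0) * x\<^sup>2"
      using v0 by (simp add: field_simps power2_eq_square)
    moreover have "\<forall>\<^sub>F b in at_top. lam * (S (u b) (b ^ 6) / q b) * exp (- (lam * x\<^sup>2 * (2 * v b + v0) / (2 * (v b)\<^sup>2))) = J b x"
      using v_ev eventually_gt_at_top[of 0]
      by eventually_elim (rule J_form[symmetric], auto simp: v_def u_def q_def)
    ultimately show ?thesis by (simp add: Lim_transform_eventually)
  qed
  have lim_b: "((\<lambda>b. \<integral>\<^sup>+x. ennreal (J b x) \<partial>lborel) \<longlongrightarrow>
      ?G) at_top"
  proof (rule tendsto_at_topI_sequentially)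
    fix T :: "nat \<Rightarrow> real" assume T: "filterlim T at_top sequentially"
    then obtain N where N: "\<And>n. N \<le> n \<Longrightarrow> 1 \<le> T n"
      using filterlim_at_top[of T sequentially] by (auto simp: eventually_sequentially)
    have "(\<lambda>n. \<integral>\<^sup>+x. ennreal (J (T (n + N)) x) \<partial>lborel) \<longlonglongrightarrow>
        ?G"
    proof (rule nn_integral_dominated_convergence[where w="\<lambda>x. ennreal (3 * lam * exp (lam * v0)) * ennreal (exp (- lam * \<bar>x\<bar>))"])
      show "AE x in lborel. (\<lambda>n. ennreal (J (T (n + N)) x)) \<longlonglongrightarrow> ennreal (lam * (4 / pi) * exp (- (3 * lam / (2 * v0)) * x\<^sup>2))"
        by (intro AE_I2 tendsto_ennrealI LIMSEQ_ignore_initial_segment[OF filterlim_compose[OF J_lim T]])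
      show "AE x in lborel. ennreal (J (T (n + N)) x) \<le> ennreal (3 * lam * exp (lam * v0)) * ennreal (exp (- lam * \<bar>x\<bar>))" for n
        using J_le[of "T (n + N)"] N[of "n + N"] lam by (intro AE_I2) (simp add: ennreal_mult[symmetric] ennreal_leI)
      show "(\<integral>\<^sup>+x. ennreal (3 * lam * exp (lam * v0)) * ennreal (exp (- lam * \<bar>x\<bar>)) \<partial>lborel) < \<infinity>"
        using nn_integral_exp_abs_finite[OF lam] by (subst nn_integral_cmult) (auto simp: ennreal_mult_less_top)
    qed measurable
    then show "(\<lambda>n. \<integral>\<^sup>+x. ennreal (J (T n) x) \<partial>lborel) \<longlonglongrightarrow>
        ?G"
      by (rule LIMSEQ_offset)
  qed
  have "?G =
      ennreal (lam * (4 / pi)) * (\<integral>\<^sup>+x. ennreal (exp (- (3 * lam / (2 * v0)) * x\<^sup>2)) \<partial>lborel)"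
    using lam by (subst nn_integral_cmult[symmetric]) (auto simp: ennreal_mult[symmetric])
  also have "\<dots> = ennreal (lam * (4 / pi)) * ennreal (sqrt (pi / (3 * lam / (2 * v0))))"
    using lam v0(1) by (subst nn_integral_gaussian) auto
  also have "\<dots> = ennreal (?C)"
    using lam v0(1) by (simp add: ennreal_mult[symmetric] mult_ac)
  finally have val: "?G =
      ennreal (?C)" .
  have "filterlim (\<lambda>t::real. t powr (1/6)) at_top at_top" by real_asymp
  from filterlim_compose[OF lim_b this]
  have "((\<lambda>t. \<integral>\<^sup>+x. ennreal (J (t powr (1/6)) x) \<partial>lborel) \<longlongrightarrow> ennreal (?C)) at_top"
    unfolding val .
  moreover have "\<forall>\<^sub>F t in at_top. (\<integral>\<^sup>+x. ennreal (J (t powr (1/6)) x) \<partial>lborel) =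
      ennreal (?F t)"
    using eventually_gt_at_top[of 0] by eventually_elim (rule scaled[symmetric])
  ultimately have "((\<lambda>t. ennreal (?F t)) \<longlongrightarrow>
      ennreal (?C)) at_top"
    by (rule Lim_transform_eventually)
  then show ?thesis
    using lam v0(1) I(1) by (subst (asm) tendsto_ennreal_iff) auto
qed

section \<open>The running maximum and the time change\<close>

definition running_max :: "(real \<Rightarrow> real) \<Rightarrow> real \<Rightarrow> real" where
  "running_max p t = (SUP s\<in>{0..t}. \<bar>p s\<bar>)"

text \<open>Intermediate values: the continuous image of an interval is connected and contains both
  0 and the attained maximum.\<close>

lemma abs_image_eq_running_max:
  assumes p: "continuous_on {0..} p" and p0: "p 0 = 0" and t: "0 \<le> t"
  shows "(\<lambda>s. \<bar>p s\<bar>) ` {0..t} = {0..running_max p t}"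
proof -
  have cont: "continuous_on {0..t} (\<lambda>s. \<bar>p s\<bar>)"
    by (intro continuous_intros continuous_on_subset[OF p]) auto
  obtain s where s: "s \<in> {0..t}" "\<And>r. r \<in> {0..t} \<Longrightarrow> \<bar>p r\<bar> \<le> \<bar>p s\<bar>"
    using continuous_attains_sup[OF _ _ cont] t by auto
  have max: "running_max p t = \<bar>p s\<bar>"
    unfolding running_max_def by (rule cSup_eq_maximum) (use s in auto)
  have "{\<bar>p 0\<bar>..\<bar>p s\<bar>} \<subseteq> (\<lambda>s. \<bar>p s\<bar>) ` {0..t}"
    using s(1) t connected_continuous_image[OF cont connected_Icc]
    by (intro connected_contains_Icc) auto
  then show ?thesis unfolding max using p0 s(2) by auto
qed

lemma running_max_nonneg:
  assumes "continuous_on {0..} p" "p 0 = 0" "0 \<le> t"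
  shows "0 \<le> running_max p t"
proof -
  have "\<bar>p 0\<bar> \<in> (\<lambda>s. \<bar>p s\<bar>) ` {0..t}" using assms(3) by simp
  then show ?thesis unfolding abs_image_eq_running_max[OF assms] by simp
qed

lemma running_max_less_iff:
  assumes "continuous_on {0..} p" "p 0 = 0" "0 \<le> t"
  shows "running_max p t < u \<longleftrightarrow> (\<forall>s\<in>{0..t}. p s \<in> {-u<..<u})"
proof -
  have "running_max p t < u \<longleftrightarrow> (\<forall>x\<in>{0..running_max p t}. x < u)"
    using running_max_nonneg[OF assms] by auto
  also have "\<dots> \<longleftrightarrow> (\<forall>s\<in>{0..t}. \<bar>p s\<bar> < u)"
    unfolding abs_image_eq_running_max[OF assms, symmetric] by simp
  also have "\<dots> \<longleftrightarrow> (\<forall>s\<in>{0..t}. p s \<in> {-u<..<u})"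
    by (intro ball_cong) (auto simp: abs_less_iff)
  finally show ?thesis .
qed

lemma exit_time_time_changed_greater_iff:
  fixes p :: "real \<Rightarrow> 'a::topological_space"
  assumes p: "continuous_on {0..} p" and y: "continuous_on {0..} y" "y 0 = 0" and D: "open D" and t: "0 \<le> t"
  shows "ereal t < exit_time (\<lambda>s. p \<bar>y s\<bar>) D \<longleftrightarrow> ereal (running_max y t) < exit_time p D"
proof -
  have "continuous_on {0..} (\<lambda>s. p \<bar>y s\<bar>)"
    by (rule continuous_on_compose2[OF p]) (auto intro!: continuous_intros y)
  then have "ereal t < exit_time (\<lambda>s. p \<bar>y s\<bar>) D \<longleftrightarrow> (\<forall>s\<in>{0..t}. p \<bar>y s\<bar> \<in> D)"
    by (rule exit_time_greater_iff[OF _ D t])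
  also have "\<dots> \<longleftrightarrow> (\<forall>r\<in>(\<lambda>s. \<bar>y s\<bar>) ` {0..t}. p r \<in> D)" by blast
  also have "\<dots> \<longleftrightarrow> ereal (running_max y t) < exit_time p D"
    unfolding abs_image_eq_running_max[OF y t]
    by (rule exit_time_greater_iff[OF p D running_max_nonneg[OF y t], symmetric])
  finally show ?thesis .
qed

lemma exit_time_nonneg: "0 \<le> exit_time p D"
  unfolding exit_time_def by (intro Inf_greatest) auto

text \<open>The measurable space \<open>N\<close> is arbitrary so that it can be the one generated
  by \<open>X\<close> alone; measurability there is what transfers independence.\<close>

lemma exit_time_borel_measurable:
  fixes V :: "real \<Rightarrow> 'w \<Rightarrow> 'a::euclidean_space"
  assumes V: "\<And>r. V r \<in> borel_measurable N"
    and cont: "\<And>w. w \<in> space N \<Longrightarrow> continuous_on {0..} (\<lambda>r. V r w)"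
    and D: "open D"
  shows "(\<lambda>w. exit_time (\<lambda>r. V r w) D) \<in> borel_measurable N"
  unfolding borel_measurable_ereal_iff_Ioi
proof
  fix a :: ereal
  let ?E = "\<lambda>w. exit_time (\<lambda>r. V r w) D"
  show "?E -` {a<..} \<inter> space N \<in> sets N"
  proof (cases "0 \<le> a \<and> a \<noteq> \<infinity>")
    case True
    then obtain t where t: "a = ereal t" "0 \<le> t" by (cases a) auto
    have "?E -` {a<..} \<inter> space N = {w\<in>space N. \<forall>r\<in>{0..t}. V r w \<in> D}"
      using exit_time_greater_iff[OF cont D t(2)] by (auto simp: t(1))
    then show ?thesis
      using pred_path_stays_open[OF V cont D, of t] by (simp add: pred_def)
  next
    case False
    then have "?E -` {a<..} \<inter> space N = {} \<or> ?E -` {a<..} \<inter> space N = space N"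
      using order_less_le_trans[OF _ exit_time_nonneg, of a] by (auto simp: not_le)
    then show ?thesis by auto
  qed
qed

lemma running_max_borel_measurable:
  fixes V :: "real \<Rightarrow> 'w \<Rightarrow> real"
  assumes V: "\<And>r. V r \<in> borel_measurable N"
    and cont: "\<And>w. w \<in> space N \<Longrightarrow> continuous_on {0..} (\<lambda>r. V r w)"
    and V0: "\<And>w. w \<in> space N \<Longrightarrow> V 0 w = 0" and t: "0 \<le> t"
  shows "(\<lambda>w. running_max (\<lambda>r. V r w) t) \<in> borel_measurable N"
proof (rule borel_measurable_iff_less[THEN iffD2], rule)
  fix u
  have "{w\<in>space N. running_max (\<lambda>r. V r w) t < u} = {w\<in>space N. \<forall>r\<in>{0..t}. V r w \<in> {-u<..<u}}"
    using running_max_less_iff[OF cont V0 t] by auto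
  then show "{w\<in>space N. running_max (\<lambda>r. V r w) t < u} \<in> sets N"
    using pred_path_stays_open[OF V cont open_greaterThanLessThan, of t] by (simp add: pred_def)
qed

lemma (in prob_space) indep_var_of_indep_set:
  assumes ind: "indep_set (sets N1) (sets N2)" and sp: "space N1 = space M" "space N2 = space M"
    and f: "f \<in> measurable N1 S" and g: "g \<in> measurable N2 T"
  shows "indep_var S f T g"
proof -
  have sub: "sets N1 \<subseteq> events" "sets N2 \<subseteq> events"
    using ind unfolding indep_set_def indep_sets_def by (auto dest: bspec[of UNIV _ True] bspec[of UNIV _ False] split: bool.splits)
  have rv: "random_variable S f" "random_variable T g"
    using f g sub sp by (auto simp: measurable_def)
  have "sigma_sets (space M) {f -` A \<inter> space M |A. A \<in> sets S} \<subseteq> sets N1"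
    using measurable_sets[OF f] unfolding sp(1)[symmetric] by (intro sets.sigma_sets_subset) auto
  moreover have "sigma_sets (space M) {g -` A \<inter> space M |A. A \<in> sets T} \<subseteq> sets N2"
    using measurable_sets[OF g] unfolding sp(2)[symmetric] by (intro sets.sigma_sets_subset) auto
  ultimately show ?thesis
    using ind rv unfolding indep_var_eq indep_set_def
    by (auto intro!: indep_sets_mono_sets[OF ind[unfolded indep_set_def]] split: bool.splits)
qed

text \<open>Fubini on the product law, with the value of \<open>W\<close> frozen. Extended reals are
  used because an exit time may be infinite.\<close>

lemma (in prob_space) emeasure_less_indep_ereal:
  fixes U :: "'a \<Rightarrow> ereal" and W :: "'a \<Rightarrow> ereal"
  assumes ind: "indep_var borel U borel W"
  shows "emeasure M {w\<in>space M. W w < U w} = (\<integral>\<^sup>+w. emeasure M {w'\<in>space M. W w < U w'} \<partial>M)"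
proof -
  let ?U = "distr M borel U" and ?W = "distr M borel W"
  have [measurable]: "U \<in> borel_measurable M" "W \<in> borel_measurable M"
    using ind by (auto dest: indep_var_rv1 indep_var_rv2)
  have joint: "?U \<Otimes>\<^sub>M ?W = distr M (borel \<Otimes>\<^sub>M borel) (\<lambda>w. (U w, W w))"
    using ind indep_var_distribution_eq by blast
  interpret P: pair_prob_space "?U" "?W"
    by (intro pair_prob_space.intro pair_sigma_finite.intro prob_space_imp_sigma_finite prob_space_distr) auto
  let ?A = "{p :: ereal \<times> ereal. snd p < fst p}"
  have [measurable]: "?A \<in> sets (borel \<Otimes>\<^sub>M borel)"
  proof -
    have "{p \<in> space (borel \<Otimes>\<^sub>M borel). snd p < (fst p :: ereal)} \<in> sets (borel \<Otimes>\<^sub>M borel)"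
      by measurable
    then show ?thesis by (simp add: space_pair_measure)
  qed
  have "emeasure M {w\<in>space M. W w < U w} = emeasure (distr M (borel \<Otimes>\<^sub>M borel) (\<lambda>w. (U w, W w))) ?A"
    by (subst emeasure_distr) (auto intro!: arg_cong[where f="emeasure M"])
  also have "\<dots> = (\<integral>\<^sup>+y. emeasure (?U) ((\<lambda>x. (x, y)) -` ?A) \<partial>?W)"
    unfolding joint[symmetric] by (rule P.emeasure_pair_measure_alt2) (simp cong: sets_pair_measure_cong)
  also have "\<dots> = (\<integral>\<^sup>+w. emeasure (?U) ((\<lambda>x. (x, W w)) -` ?A) \<partial>M)"
  proof (rule nn_integral_distr)
    show "(\<lambda>y. emeasure (?U) ((\<lambda>x. (x, y)) -` ?A)) \<in> borel_measurable (?W)"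
      using P.measurable_emeasure_Pair2[of ?A] by (simp cong: sets_pair_measure_cong)
  qed simp
  also have "\<dots> = (\<integral>\<^sup>+w. emeasure M {w'\<in>space M. W w < U w'} \<partial>M)"
  proof (intro nn_integral_cong)
    fix w
    have "(\<lambda>x. (x, W w)) -` ?A = {W w<..}" by auto
    then show "emeasure (?U) ((\<lambda>x. (x, W w)) -` ?A) = emeasure M {w'\<in>space M. W w < U w'}"
      by (subst emeasure_distr) (auto intro!: arg_cong[where f="emeasure M"])
  qed
  finally show ?thesis .
qed

section \<open>Exponential moments of the running maximum\<close>

context real_brownian
begin

definition Y_max :: "real \<Rightarrow> 'w \<Rightarrow> real" where
  "Y_max t w = running_max (\<lambda>s. Y s w) t"

lemma Y_max_borel: "0 \<le> t \<Longrightarrow> Y_max t \<in> borel_measurable M"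
  unfolding Y_max_def[abs_def] by (intro running_max_borel_measurable X_continuous X_zero) auto

lemma Y_max_nonneg: "0 \<le> t \<Longrightarrow> w \<in> space M \<Longrightarrow> 0 \<le> Y_max t w"
  unfolding Y_max_def by (intro running_max_nonneg X_continuous X_zero)

lemma Y_max_less_iff: "0 \<le> t \<Longrightarrow> w \<in> space M \<Longrightarrow> Y_max t w < u \<longleftrightarrow> w \<in> stays {-u<..<u} 0 t"
  unfolding Y_max_def stays_def using running_max_less_iff[OF X_continuous X_zero] by simp

lemma prob_Y_max_less: "0 \<le> t \<Longrightarrow> prob {w\<in>space M. Y_max t w < u} = survival {-u<..<u} t 0"
  unfolding survival_def by (intro arg_cong[where f=prob]) (auto simp: Y_max_less_iff)

lemma survival_interval_borel: "(\<lambda>u. survival {-u<..<u} t 0) \<in> borel_measurable borel"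
proof (rule borel_measurable_mono, rule monoI)
  fix u v :: real assume "u \<le> v"
  then show "survival {-u<..<u} t 0 \<le> survival {-v<..<v} t 0"
    unfolding survival_def by (intro finite_measure_mono stays_borel) (fastforce simp: stays_def)+
qed

text \<open>\<open>exp (- lam * y)\<close> is the mass that the exponential law puts beyond
  \<open>y\<close>; Tonelli then exchanges this integral with the expectation.\<close>

lemma nn_integral_exp_Y_max:
  assumes lam: "0 < lam" and t: "0 < t"
  shows "(\<integral>\<^sup>+w. ennreal (exp (- lam * Y_max t w)) \<partial>M) =
    (\<integral>\<^sup>+u. ennreal (indicator {0<..} u * (lam * exp (- lam * u) * survival {-u<..<u} t 0)) \<partial>lborel)"
proof -
  let ?S = "\<lambda>u. ennreal (indicator {0<..} u * (lam * exp (- lam * u) * survival {-u<..<u} t 0))"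
  let ?k = "\<lambda>u w. ennreal (lam * exp (- lam * u)) * (if Y_max t w < u then 1 else 0)"
  have [measurable]: "Y_max t \<in> borel_measurable M" using t by (intro Y_max_borel) simp
  interpret L: pair_sigma_finite M lborel ..
  have "(\<integral>\<^sup>+w. ennreal (exp (- lam * Y_max t w)) \<partial>M) =
      (\<integral>\<^sup>+w. \<integral>\<^sup>+u. ?k u w \<partial>lborel \<partial>M)"
  proof (intro nn_integral_cong)
    fix w
    have "ennreal (exp (- lam * Y_max t w)) = (\<integral>\<^sup>+u. ennreal (lam * exp (- lam * u)) * indicator {Y_max t w..} u \<partial>lborel)"
      by (rule nn_integral_exp_tail[OF lam, symmetric])
    also have "\<dots> = (\<integral>\<^sup>+u. ?k u w \<partial>lborel)"
    \<comment> \<open>The half-line \<open>u >= Y_max\<close> and the strict event differ at a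
      single \<open>u\<close>, a null set.\<close>
    proof (rule nn_integral_cong_AE)
      show "AE u in lborel. ennreal (lam * exp (- lam * u)) * indicator {Y_max t w..} u =
          ?k u w"
        using AE_lborel_singleton[of "Y_max t w"] by eventually_elim (simp add: indicator_def less_le)
    qed
    finally show "ennreal (exp (- lam * Y_max t w)) =
        (\<integral>\<^sup>+u. ?k u w \<partial>lborel)" .
  qed
  also have "\<dots> = (\<integral>\<^sup>+u. \<integral>\<^sup>+w. ?k u w \<partial>M \<partial>lborel)"
    by (rule L.Fubini'[symmetric]) measurable
  also have "\<dots> = (\<integral>\<^sup>+u. ?S u \<partial>lborel)"
  proof (intro nn_integral_cong)
    fix u :: real
    have "(\<integral>\<^sup>+w. ?k u w \<partial>M) =
        ennreal (lam * exp (- lam * u)) * (\<integral>\<^sup>+w. (if Y_max t w < u then 1 else 0) \<partial>M)"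
      by (rule nn_integral_cmult) measurable
    also have "(\<integral>\<^sup>+w. (if Y_max t w < u then 1 else 0) \<partial>M) = (\<integral>\<^sup>+w. indicator {w\<in>space M. Y_max t w < u} w \<partial>M)"
      by (intro nn_integral_cong) (simp add: indicator_def)
    also have "\<dots> = ennreal (survival {-u<..<u} t 0)"
      using t by (subst nn_integral_indicator) (auto simp: emeasure_eq_measure prob_Y_max_less)
    also have "ennreal (lam * exp (- lam * u)) * ennreal (survival {-u<..<u} t 0) =
        ?S u"
    proof (cases "0 < u")
      case True
      then show ?thesis using lam by (simp add: ennreal_mult survival_nonneg)
    next
      case False
      then have "survival {-u<..<u} t 0 = 0" using t by (intro survival_outside) auto
      then show ?thesis by simp
    qed
    finally show "(\<integral>\<^sup>+w. ?k u w \<partial>M) =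
        ?S u" .
  qed
  finally show ?thesis .
qed

lemma expectation_exp_Y_max_limit:
  assumes lam: "0 < lam" and v0: "0 < v0" "pi\<^sup>2 / 8 = lam * v0 ^ 3 / 2"
  shows "((\<lambda>t. t powr (-1/6) * exp (3 / 2 * lam * v0 * t powr (1/3)) * expectation (\<lambda>w. exp (- lam * Y_max t w))) \<longlongrightarrow>
     lam * (4 / pi) * sqrt (2 * pi * v0 / (3 * lam))) at_top"
proof (rule laplace_method_limit[where S="\<lambda>u t. survival {-u<..<u} t 0"])
  show "0 \<le> expectation (\<lambda>w. exp (- lam * Y_max t w))" for t by (rule integral_nonneg_AE) simp
  show "ennreal (expectation (\<lambda>w. exp (- lam * Y_max t w))) =
      (\<integral>\<^sup>+u. ennreal (indicator {0<..} u * (lam * exp (- lam * u) * survival {-u<..<u} t 0)) \<partial>lborel)" if t: "0 < t" for t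
  proof -
    have [measurable]: "Y_max t \<in> borel_measurable M" using t by (intro Y_max_borel) simp
    have "integrable M (\<lambda>w. exp (- lam * Y_max t w))"
      by (rule integrable_const_bound[of _ 1]) (use lam t Y_max_nonneg[of t] in auto)
    then show ?thesis
      unfolding nn_integral_exp_Y_max[OF lam t, symmetric] by (subst nn_integral_eq_integral) auto
  qed
  show "\<bar>survival {-u<..<u} t 0 - 4 / pi * q\<bar> \<le> 4 / pi * (q ^ 9 / (1 - q ^ 8))"
    if "0 < u" "0 < t" "q = exp (- (pi\<^sup>2 * t / (8 * u\<^sup>2)))" for u t q
    unfolding that(3) by (rule survival_interval_approx[OF that(2,1)])
qed (fact lam v0 survival_interval_borel survival_nonneg survival_interval_le | rule survival_interval_le; assumption)+

end

text \<open>Beyond a threshold \<open>m\<close>, \<open>u\<close> may be replaced by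
  \<open>L z * exp (- lam * m')\<close> at maximum \<open>m'\<close> with small relative error,
  uniformly in \<open>z\<close>. Maxima below the threshold are so unlikely that even the factor
  \<open>g t\<close> leaves them negligible.\<close>

lemma uniform_limit_of_max:
  fixes u :: "real \<Rightarrow> 'a \<Rightarrow> real" and Mx :: "real \<Rightarrow> 'w \<Rightarrow> real" and g :: "real \<Rightarrow> real"
  assumes "prob_space M"
    and meas: "\<And>t. 0 \<le> t \<Longrightarrow> Mx t \<in> borel_measurable M" and nonneg: "\<And>t w. 0 \<le> t \<Longrightarrow> w \<in> space M \<Longrightarrow> 0 \<le> Mx t w"
    and u_meas: "\<And>z. z \<in> D \<Longrightarrow> (\<lambda>m. u m z) \<in> borel_measurable borel"
    and u0: "\<And>m z. 0 \<le> u m z" and lam: "0 < lam"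
    and uB: "\<And>m z. z \<in> D \<Longrightarrow> 0 \<le> m \<Longrightarrow> exp (lam * m) * u m z \<le> B"
    and unif: "uniform_limit D (\<lambda>m z. exp (lam * m) * u m z) L at_top"
    and g0: "\<And>t. 0 \<le> g t"
    and lim: "((\<lambda>t. g t * (\<integral>w. exp (- lam * Mx t w) \<partial>M)) \<longlongrightarrow> C) at_top"
    and small: "\<And>m. 0 < m \<Longrightarrow> ((\<lambda>t. g t * measure M {w\<in>space M. Mx t w < m}) \<longlongrightarrow> 0) at_top"
  shows "uniform_limit D (\<lambda>t z. g t * (\<integral>w. u (Mx t w) z \<partial>M)) (\<lambda>z. C * L z) at_top"
  unfolding uniform_limit_iff
proof (intro allI impI)
  interpret prob_space M by fact
  fix e :: real assume e: "0 < e"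
  define E where "E t = g t * expectation (\<lambda>w. exp (- lam * Mx t w))" for t
  have L: "0 \<le> L z" "L z \<le> B" if "z \<in> D" for z
  proof -
    have lim_z: "((\<lambda>m. exp (lam * m) * u m z) \<longlongrightarrow> L z) at_top"
      by (rule tendsto_uniform_limitI[OF unif that])
    show "0 \<le> L z"
      by (rule tendsto_lowerbound[OF lim_z]) (simp_all add: u0)
    have "\<forall>\<^sub>F m in at_top. exp (lam * m) * u m z \<le> B"
      using eventually_ge_at_top[of 0] by eventually_elim (rule uB[OF that])
    then show "L z \<le> B"
      by (rule tendsto_upperbound[OF lim_z]) simp
  qed
  \<comment> \<open>Chosen so that \<open>\<delta> * C\<close> is at most \<open>e / 3\<close>; the
    added 2 keeps the denominator positive.\<close>
  define \<delta> where "\<delta> = e / 3 / (\<bar>C\<bar> + 2)"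
  have \<delta>: "0 < \<delta>" unfolding \<delta>_def using e by (intro divide_pos_pos) auto
  obtain m where m: "0 < m" "\<And>m' z. m \<le> m' \<Longrightarrow> z \<in> D \<Longrightarrow> \<bar>exp (lam * m') * u m' z - L z\<bar> < \<delta>"
  proof -
    have "\<forall>\<^sub>F m in at_top. \<forall>z\<in>D. dist (exp (lam * m) * u m z) (L z) < \<delta>"
      using unif \<delta> unfolding uniform_limit_iff by blast
    then obtain m0 where "\<And>m. m0 \<le> m \<Longrightarrow> \<forall>z\<in>D. dist (exp (lam * m) * u m z) (L z) < \<delta>"
      unfolding eventually_at_top_linorder by blast
    then show ?thesis by (intro that[of "max m0 1"]) (auto simp: dist_real_def)
  qed
  define B' where "B' = max B 1"
  have B': "B \<le> B'" "0 < B'" by (auto simp: B'_def)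
  \<comment> \<open>The three errors: replacing \<open>u\<close> by its asymptotics above the
    threshold, maxima below the threshold, and the distance of the normalised exponential moment
    from \<open>C\<close>.\<close>
  have key: "\<bar>g t * expectation (\<lambda>w. u (Mx t w) z) - C * L z\<bar> \<le>
      \<delta> * E t + B' * (g t * prob {w\<in>space M. Mx t w < m}) + B' * \<bar>E t - C\<bar>" if z: "z \<in> D" and t: "0 \<le> t" for z t
  proof -
    have [measurable]: "Mx t \<in> borel_measurable M" "(\<lambda>m. u m z) \<in> borel_measurable borel"
      using meas t u_meas z by auto
    let ?e = "\<lambda>w. exp (- lam * Mx t w)"
    have e1: "?e w \<le> 1" if "w \<in> space M" for w using nonneg[OF t that] lam by simp
    have ue: "u (Mx t w) z = ?e w * (exp (lam * Mx t w) * u (Mx t w) z)" for w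
      by (simp add: exp_minus field_simps)
    have u_le: "u (Mx t w) z \<le> B'" if w: "w \<in> space M" for w
    proof -
      have "?e w * (exp (lam * Mx t w) * u (Mx t w) z) \<le> 1 * B"
        using uB[OF z nonneg[OF t w]] e1[OF w] u0 by (intro mult_mono) auto
      then have "u (Mx t w) z \<le> B" by (simp only: ue[symmetric] mult_1)
      then show ?thesis using B' by simp
    qed
    have int: "integrable M ?e" "integrable M (\<lambda>w. u (Mx t w) z)"
      by (rule integrable_const_bound[of _ 1]; use e1 in auto)
         (rule integrable_const_bound[of _ B']; use u_le u0 in auto)
    have intd: "integrable M (\<lambda>w. u (Mx t w) z - L z * ?e w)"
      by (intro Bochner_Integration.integrable_diff integrable_mult_right int)
    have intI: "integrable M (\<lambda>w. B' * indicator {w\<in>space M. Mx t w < m} w)"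
      by (intro integrable_mult_right) (simp add: emeasure_eq_measure)
    have "\<bar>expectation (\<lambda>w. u (Mx t w) z) - L z * expectation ?e\<bar> = \<bar>expectation (\<lambda>w. u (Mx t w) z - L z * ?e w)\<bar>"
      by (subst Bochner_Integration.integral_diff[OF int(2) integrable_mult_right[OF int(1)]]) simp
    also have "\<dots> \<le> expectation (\<lambda>w. \<bar>u (Mx t w) z - L z * ?e w\<bar>)" by (rule integral_abs_bound)
    also have "\<dots> \<le> expectation (\<lambda>w. \<delta> * ?e w + B' * indicator {w\<in>space M. Mx t w < m} w)"
    proof (rule integral_mono)
      show "integrable M (\<lambda>w. \<bar>u (Mx t w) z - L z * ?e w\<bar>)" using intd by (rule integrable_abs)
      show "integrable M (\<lambda>w. \<delta> * ?e w + B' * indicator {w\<in>space M. Mx t w < m} w)"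
        by (intro Bochner_Integration.integrable_add integrable_mult_right int intI)
      fix w assume w: "w \<in> space M"
      show "\<bar>u (Mx t w) z - L z * ?e w\<bar> \<le> \<delta> * ?e w + B' * indicator {w\<in>space M. Mx t w < m} w"
      proof (cases "Mx t w < m")
        case True
        have "L z * ?e w \<le> B * 1" using L[OF z] e1[OF w] by (intro mult_mono) auto
        moreover have "0 \<le> L z * ?e w" using L[OF z] by simp
        ultimately have "\<bar>u (Mx t w) z - L z * ?e w\<bar> \<le> B'" using u_le[OF w] u0[of "Mx t w" z] B' by (simp add: abs_le_iff)
        then show ?thesis using True w \<delta> by (simp add: add_increasing)
      next
        case False
        have "\<bar>u (Mx t w) z - L z * ?e w\<bar> = ?e w * \<bar>exp (lam * Mx t w) * u (Mx t w) z - L z\<bar>"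
        proof -
          have "u (Mx t w) z - L z * ?e w = ?e w * (exp (lam * Mx t w) * u (Mx t w) z - L z)"
            unfolding right_diff_distrib ue[of w, symmetric] by simp
          then show ?thesis by (simp only: abs_mult abs_exp_cancel)
        qed
        also have "\<dots> \<le> ?e w * \<delta>" using m(2)[of "Mx t w", OF _ z] False by (intro mult_left_mono) auto
        finally show ?thesis using False by (simp add: mult.commute)
      qed
    qed
    also have "\<dots> = \<delta> * expectation ?e + B' * prob {w\<in>space M. Mx t w < m}"
      by (subst Bochner_Integration.integral_add[OF integrable_mult_right[OF int(1)] intI]) simp
    finally have "g t * \<bar>expectation (\<lambda>w. u (Mx t w) z) - L z * expectation ?e\<bar> \<le>
        g t * (\<delta> * expectation ?e + B' * prob {w\<in>space M. Mx t w < m})"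
      using g0 by (intro mult_left_mono)
    then have "\<bar>g t * expectation (\<lambda>w. u (Mx t w) z) - L z * E t\<bar> \<le> \<delta> * E t + B' * (g t * prob {w\<in>space M. Mx t w < m})"
    proof -
      have "g t * \<bar>a\<bar> = \<bar>g t * a\<bar>" for a using g0[of t] by (simp add: abs_mult)
      with \<open>g t * \<bar>expectation (\<lambda>w. u (Mx t w) z) - L z * expectation ?e\<bar> \<le> _\<close> show ?thesis
        by (simp add: E_def algebra_simps)
    qed
    moreover have "\<bar>L z * E t - C * L z\<bar> \<le> B' * \<bar>E t - C\<bar>"
    proof -
      have "\<bar>L z * E t - C * L z\<bar> = L z * \<bar>E t - C\<bar>"
        using L[OF z] by (simp add: abs_mult right_diff_distrib[symmetric] mult.commute[of C])
      also have "\<dots> \<le> B' * \<bar>E t - C\<bar>" using L[OF z] B' by (intro mult_right_mono) auto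
      finally show ?thesis .
    qed
    ultimately show ?thesis by linarith
  qed
  have E_lim: "(E \<longlongrightarrow> C) at_top" using lim by (simp add: E_def[abs_def])
  have "((\<lambda>t. \<delta> * E t + B' * (g t * prob {w\<in>space M. Mx t w < m}) + B' * \<bar>E t - C\<bar>) \<longlongrightarrow>
      \<delta> * C + B' * 0 + B' * \<bar>C - C\<bar>) at_top"
    by (intro tendsto_intros E_lim small m)
  moreover have "\<delta> * C + B' * 0 + B' * \<bar>C - C\<bar> < e"
  proof -
    have "\<delta> * C \<le> \<delta> * (\<bar>C\<bar> + 2)" using \<delta> by (intro mult_left_mono) auto
    also have "\<dots> = e / 3"
    proof -
      have "\<bar>C\<bar> + 2 \<noteq> 0" by linarith
      then show ?thesis unfolding \<delta>_def by (rule nonzero_eq_divide_eq[THEN iffD1, OF _ refl])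
    qed
    finally show ?thesis using e by simp
  qed
  ultimately have "\<forall>\<^sub>F t in at_top. \<delta> * E t + B' * (g t * prob {w\<in>space M. Mx t w < m}) + B' * \<bar>E t - C\<bar> < e"
    by (rule order_tendstoD)
  then show "\<forall>\<^sub>F t in at_top. \<forall>z\<in>D. dist (g t * expectation (\<lambda>w. u (Mx t w) z)) (C * L z) < e"
    using eventually_ge_at_top[of 0]
  proof eventually_elim
    case (elim t)
    then show ?case using key[of _ t] by (fastforce simp: dist_real_def)
  qed
qed

lemma X_measurable_vimage_algebra:
  "X s \<in> borel_measurable (vimage_algebra S (\<lambda>\<omega> t. X t \<omega>) (PiM UNIV (\<lambda>_. borel)))"
proof -
  have "(\<lambda>\<omega> t. X t \<omega>) \<in> measurable (vimage_algebra S (\<lambda>\<omega> t. X t \<omega>) (PiM UNIV (\<lambda>_. borel))) (PiM UNIV (\<lambda>_. borel))"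
    by (rule measurable_vimage_algebra1) (auto simp: space_PiM)
  from measurable_compose[OF this measurable_component_singleton[of s]] show ?thesis by simp
qed

lemma (in brownian) survival_time_borel:
  assumes "open D"
  shows "(\<lambda>t. survival D t z) \<in> borel_measurable borel"
proof -
  have "mono (\<lambda>t. - survival D t z)"
  proof (rule monoI)
    fix s t :: real assume "s \<le> t"
    then show "- survival D s z \<le> - survival D t z"
      unfolding survival_def neg_le_iff_le using assms
      by (intro finite_measure_mono stays_borel) (auto simp: stays_def)
  qed
  from borel_measurable_uminus[OF borel_measurable_mono[OF this]] show ?thesis by simp
qed

text \<open>The exit time of \<open>z + X\<close> depends on \<open>X\<close> only and the running
  maximum on \<open>Y\<close> only. Freezing the maximum turns the comparison of the two into
  survival up to a deterministic time.\<close>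

lemma time_changed_survival:
  fixes X :: "real \<Rightarrow> 'w \<Rightarrow> 'a::euclidean_space" and Y :: "real \<Rightarrow> 'w \<Rightarrow> real"
  assumes X_bm: "brownian_motion M X" and Y_bm: "brownian_motion M Y" and ind: "indep_processes M X Y"
    and D: "open D" and t: "0 \<le> t"
  shows "measure M {\<omega>\<in>space M. exit_time (\<lambda>s. z + X \<bar>Y s \<omega>\<bar> \<omega>) D > ereal t} =
    (\<integral>\<omega>. brownian.survival M X D (real_brownian.Y_max Y t \<omega>) z \<partial>M)"
proof -
  interpret X: brownian M X by unfold_locales (rule X_bm)
  interpret Y: real_brownian M Y by unfold_locales (rule Y_bm)
  let ?N = "\<lambda>V. vimage_algebra (space M) (\<lambda>\<omega> t. V t \<omega>) (PiM UNIV (\<lambda>_. borel))"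
  define U where "U \<omega> = exit_time (\<lambda>s. z + X s \<omega>) D" for \<omega>
  define W where "W \<omega> = ereal (Y.Y_max t \<omega>)" for \<omega>
  have Ym: "Y.Y_max t \<in> borel_measurable M" using t by (rule Y.Y_max_borel)
  have "X.indep_var borel U borel W"
  proof (rule X.indep_var_of_indep_set)
    show "X.indep_set (sets (?N X)) (sets (?N Y))"
      using ind by (simp add: indep_processes_def)
    show "U \<in> borel_measurable (?N X)"
      unfolding U_def using X.shifted_X_continuous[of _ z]
      by (intro exit_time_borel_measurable D borel_measurable_add borel_measurable_const X_measurable_vimage_algebra) auto
    show "W \<in> borel_measurable (?N Y)"
      unfolding W_def Y.Y_max_def using Y.X_continuous Y.X_zero t
      by (intro borel_measurable_ereal running_max_borel_measurable X_measurable_vimage_algebra) auto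
  qed auto
  then have "emeasure M {\<omega>\<in>space M. W \<omega> < U \<omega>} = (\<integral>\<^sup>+\<omega>. emeasure M {\<omega>'\<in>space M. W \<omega> < U \<omega>'} \<partial>M)"
    by (rule X.emeasure_less_indep_ereal)
  also have "\<dots> = (\<integral>\<^sup>+\<omega>. ennreal (X.survival D (Y.Y_max t \<omega>) z) \<partial>M)"
  proof (intro nn_integral_cong)
    fix \<omega> assume w: "\<omega> \<in> space M"
    have "{\<omega>'\<in>space M. W \<omega> < U \<omega>'} = X.stays D z (Y.Y_max t \<omega>) \<inter> space M"
      unfolding W_def U_def X.stays_def
      using exit_time_greater_iff[OF X.shifted_X_continuous D Y.Y_max_nonneg[OF t w]] by auto
    then show "emeasure M {\<omega>'\<in>space M. W \<omega> < U \<omega>'} = ennreal (X.survival D (Y.Y_max t \<omega>) z)"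
      by (simp add: X.survival_def X.emeasure_eq_measure)
  qed
  finally have eq: "emeasure M {\<omega>\<in>space M. W \<omega> < U \<omega>} = (\<integral>\<^sup>+\<omega>. ennreal (X.survival D (Y.Y_max t \<omega>) z) \<partial>M)" .
  have "{\<omega>\<in>space M. exit_time (\<lambda>s. z + X \<bar>Y s \<omega>\<bar> \<omega>) D > ereal t} = {\<omega>\<in>space M. W \<omega> < U \<omega>}"
    unfolding W_def U_def Y.Y_max_def
    using exit_time_time_changed_greater_iff[OF X.shifted_X_continuous Y.X_continuous Y.X_zero D t] by auto
  then have "measure M {\<omega>\<in>space M. exit_time (\<lambda>s. z + X \<bar>Y s \<omega>\<bar> \<omega>) D > ereal t} =
      enn2real (\<integral>\<^sup>+\<omega>. ennreal (X.survival D (Y.Y_max t \<omega>) z) \<partial>M)"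
    by (simp add: measure_def eq)
  also have "\<dots> = (\<integral>\<omega>. X.survival D (Y.Y_max t \<omega>) z \<partial>M)"
  proof (rule integral_eq_nn_integral[symmetric])
    show "(\<lambda>\<omega>. X.survival D (Y.Y_max t \<omega>) z) \<in> borel_measurable M"
      using measurable_compose[OF Ym X.survival_time_borel[OF D, of z]] by simp
  qed (simp add: X.survival_nonneg)
  finally show ?thesis .
qed

text \<open>\<open>v0\<close> is the cube root of \<open>pi^2 / (4 * lam)\<close>. The
  critical-point equation and the value of \<open>C\<close> are checked on logarithms, where they
  become linear in \<open>ln pi\<close>, \<open>ln 2\<close>, \<open>ln 3\<close> and
  \<open>ln lam\<close>.\<close>

lemma btbm_constants:
  fixes lam :: real
  assumes lam: "0 < lam"
  defines "v0 \<equiv> pi powr (2/3) * 2 powr (-2/3) * lam powr (-1/3)"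
  shows "0 < v0" "pi\<^sup>2 / 8 = lam * v0 ^ 3 / 2"
    "3 / 2 * lam * v0 = 3/2 * 2 powr (-2/3) * pi powr (2/3) * lam powr (2/3)"
    "lam * (4 / pi) * sqrt (2 * pi * v0 / (3 * lam)) =
       pi powr (-1/6) * 2 powr (13/6) * 3 powr (-1/2) * lam powr (1/3)"
proof -
  show v0: "0 < v0" using lam by (simp add: v0_def)
  have lnv: "ln v0 = 2/3 * ln pi - 2/3 * ln 2 - 1/3 * ln lam"
    using lam by (simp add: v0_def ln_mult ln_powr)
  have ln8: "ln (8::real) = 3 * ln 2" "ln (4::real) = 2 * ln 2"
    using ln_realpow[of 2 3] ln_realpow[of 2 2] by simp_all
  have "ln (pi\<^sup>2 / 8) = ln (lam * v0 ^ 3 / 2)"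
    using lam v0 by (simp add: ln_div ln_mult ln_realpow lnv ln8)
  then show "pi\<^sup>2 / 8 = lam * v0 ^ 3 / 2"
    using lam v0 by (subst (asm) ln_inj_iff) auto
  have "lam * lam powr (-1/3) = lam powr (2/3)"
    using lam powr_add[of lam 1 "-1/3"] by simp
  then show "3 / 2 * lam * v0 = 3/2 * 2 powr (-2/3) * pi powr (2/3) * lam powr (2/3)"
    by (simp add: v0_def mult_ac)
  have "ln (lam * (4 / pi) * sqrt (2 * pi * v0 / (3 * lam))) =
      ln (pi powr (-1/6) * 2 powr (13/6) * 3 powr (-1/2) * lam powr (1/3))"
    using lam v0 by (simp add: ln_mult ln_div ln_sqrt ln_powr lnv ln8 field_simps)
  then show "lam * (4 / pi) * sqrt (2 * pi * v0 / (3 * lam)) =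
       pi powr (-1/6) * 2 powr (13/6) * 3 powr (-1/2) * lam powr (1/3)"
    using lam v0 by (subst (asm) ln_inj_iff) auto
qed

text \<open>The Bochner integral of a non-integrable function is 0 by default, so positivity of
  \<open>psi\<close> alone does not suffice. Integrability comes from
  \<open>psi <= 1 + psi^2\<close> on a set of finite volume, and the \<open>L^2\<close>
  normalisation excludes the value 0.\<close>

lemma set_integral_eigenfunction_pos:
  fixes D :: "'a::euclidean_space set"
  assumes D: "open D" "bounded D" and eigen: "first_dirichlet_eigen D lam psi"
  shows "0 < (LINT y:D|lborel. psi y)"
proof -
  have [measurable]: "D \<in> sets borel" using D by auto
  have pos: "\<And>x. x \<in> D \<Longrightarrow> 0 < psi x" and norm: "(\<integral>\<^sup>+ x. indicator D x * ennreal ((psi x)\<^sup>2) \<partial>lborel) = 1"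
    and diff: "\<And>x. x \<in> D \<Longrightarrow> psi differentiable (at x)"
    using eigen by (auto simp: first_dirichlet_eigen_def dirichlet_eigenpair_def C2_on_def)
  define f where "f x = indicator D x * psi x" for x
  have "continuous_on D psi"
    by (intro continuous_at_imp_continuous_on ballI differentiable_imp_continuous_within diff)
  then have [measurable]: "f \<in> borel_measurable borel"
    using borel_measurable_continuous_on_indicator[of D psi] by (simp add: f_def[abs_def])
  have f0: "0 \<le> f x" for x using pos[of x] by (auto simp: f_def indicator_def)
  have f2: "indicator D x * ennreal ((psi x)\<^sup>2) = ennreal ((f x)\<^sup>2)" for x
    by (simp add: f_def indicator_def)
  have "(\<integral>\<^sup>+x. ennreal (norm (f x)) \<partial>lborel) \<le> (\<integral>\<^sup>+x. indicator D x + ennreal ((f x)\<^sup>2) \<partial>lborel)"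
  proof (rule nn_integral_mono)
    fix x
    have "a \<le> 1 + a\<^sup>2" for a :: real
      using zero_le_power2[of "a - 1/2"] by (simp add: power2_eq_square algebra_simps)
    then have "norm (f x) \<le> indicator D x + (f x)\<^sup>2"
      using f0[of x] by (cases "x \<in> D") (auto simp: f_def)
    then have "ennreal (norm (f x)) \<le> ennreal (indicator D x + (f x)\<^sup>2)" by (rule ennreal_leI)
    then show "ennreal (norm (f x)) \<le> indicator D x + ennreal ((f x)\<^sup>2)"
      by (simp add: ennreal_plus ennreal_indicator)
  qed
  also have "\<dots> = emeasure lborel D + 1"
    using norm unfolding f2 by (subst nn_integral_add) auto
  also have "\<dots> < \<infinity>" using emeasure_bounded_finite[OF D(2)] by simp
  finally have int: "integrable lborel f" by (intro integrableI_bounded) auto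
  have "(\<integral>x. f x \<partial>lborel) \<noteq> 0"
  proof
    assume "(\<integral>x. f x \<partial>lborel) = 0"
    then have "AE x in lborel. f x = 0"
      using integral_nonneg_eq_0_iff_AE[OF int] f0 by simp
    then have "AE x in lborel. ennreal ((f x)\<^sup>2) = 0" by eventually_elim simp
    then have "(\<integral>\<^sup>+x. ennreal ((f x)\<^sup>2) \<partial>lborel) = (\<integral>\<^sup>+x. 0 \<partial>(lborel :: 'a measure))"
      by (rule nn_integral_cong_AE)
    with norm f2 show False by simp
  qed
  moreover have "0 \<le> (\<integral>x. f x \<partial>lborel)" using f0 by simp
  ultimately show ?thesis by (simp add: set_lebesgue_integral_def f_def[abs_def])
qed

lemma (in brownian) survival_tendsto_0:
  assumes D: "open D" "bounded D"
  shows "((\<lambda>t. survival D t z) \<longlongrightarrow> 0) at_top"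
proof (rule tendsto_sandwich[where f="\<lambda>_. 0"])
  let ?b = "\<lambda>t. (2 * pi * t) powr (- real DIM('a) / 2) * measure lborel D"
  have fin: "emeasure lborel D = ennreal (measure lborel D)"
    using emeasure_bounded_finite[OF D(2)] by (simp add: emeasure_eq_ennreal_measure)
  have [measurable]: "D \<in> sets borel" using D by auto
  show "\<forall>\<^sub>F t in at_top. survival D t z \<le> ?b t"
    using eventually_gt_at_top[of 0]
  proof eventually_elim
    case (elim t)
    have "ennreal (survival D t z) \<le> ennreal ((2 * pi * t) powr (- real DIM('a) / 2)) * (\<integral>\<^sup>+y. indicator D y * 1 \<partial>lborel)"
      unfolding killed_one[OF D(1), symmetric] by (rule killed_le_heat[OF D(1) elim]) simp
    also have "\<dots> = ennreal (?b t)" by (simp add: fin ennreal_mult)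
    finally show ?case by (simp add: ennreal_le_iff)
  qed
  have "filterlim (\<lambda>t. 2 * pi * t) at_top at_top"
    by (intro filterlim_tendsto_pos_mult_at_top[OF tendsto_const] filterlim_ident) simp
  then have "((\<lambda>t. (2 * pi * t) powr (- real DIM('a) / 2)) \<longlongrightarrow> 0) at_top"
    by (intro tendsto_neg_powr) auto
  from tendsto_mult_right[OF this] show "(?b \<longlongrightarrow> 0) at_top" by simp
qed (auto simp: survival_nonneg)

section \<open>Assembly of the limit theorem\<close>

theorem theorem1p2:
  fixes M :: "'w measure"
    and X :: "real \<Rightarrow> 'w \<Rightarrow> 'a::euclidean_space"
    and Y :: "real \<Rightarrow> 'w \<Rightarrow> real"
    and D :: "'a set"
    and lam :: real and psi :: "'a \<Rightarrow> real"
  assumes X_bm: "brownian_motion M X"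
    and Y_bm: "brownian_motion M Y"
    and XY_indep: "indep_processes M X Y"
    and D_domain: "open D" "connected D" "bounded D" "D \<noteq> {}"
    and eigen: "first_dirichlet_eigen D lam psi"
    and hyp: "\<forall>z\<in>D. ((\<lambda>t. exp (lam * t) *
                  measure M {\<omega>\<in>space M. exit_time (\<lambda>s. z + X s \<omega>) D > ereal t})
               \<longlongrightarrow> psi z * (LINT y:D|lborel. psi y)) at_top"
  defines "C \<equiv> pi powr (-1/6) * 2 powr (13/6) * 3 powr (-1/2) * lam powr (1/3)"
  defines "F \<equiv> (\<lambda>t z. t powr (-1/6) *
                 exp (3/2 * 2 powr (-2/3) * pi powr (2/3) * lam powr (2/3) * t powr (1/3)) *
                 measure M {\<omega>\<in>space M. exit_time (\<lambda>s. z + X \<bar>Y s \<omega>\<bar> \<omega>) D > ereal t})"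
  shows "(\<forall>z\<in>D. ((\<lambda>t. F t z) \<longlongrightarrow> C * psi z * (LINT y:D|lborel. psi y)) at_top) \<and>
         (\<forall>K. compact K \<and> K \<subseteq> D \<longrightarrow>
            uniform_limit K F (\<lambda>z. C * psi z * (LINT y:D|lborel. psi y)) at_top)"
proof -
  interpret X: brownian M X by unfold_locales (rule X_bm)
  interpret Y: real_brownian M Y by unfold_locales (rule Y_bm)
  define c where "c = (LINT y:D|lborel. psi y)"
  have c: "0 < c" unfolding c_def by (rule set_integral_eigenfunction_pos[OF D_domain(1,3) eigen])
  have psi: "0 < psi z" if "z \<in> D" for z
    using eigen that by (simp add: first_dirichlet_eigen_def)
  have lim: "((\<lambda>t. exp (lam * t) * X.survival D t z) \<longlongrightarrow> psi z * c) at_top" if z: "z \<in> D" for z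
  proof (rule Lim_transform_eventually)
    show "((\<lambda>t. exp (lam * t) * measure M {\<omega>\<in>space M. exit_time (\<lambda>s. z + X s \<omega>) D > ereal t})
        \<longlongrightarrow> psi z * c) at_top"
      using hyp z by (simp add: c_def)
    show "\<forall>\<^sub>F t in at_top. exp (lam * t) * measure M {\<omega>\<in>space M. exit_time (\<lambda>s. z + X s \<omega>) D > ereal t} =
        exp (lam * t) * X.survival D t z"
      using eventually_ge_at_top[of 0]
    proof eventually_elim
      case (elim t)
      have "{\<omega>\<in>space M. exit_time (\<lambda>s. z + X s \<omega>) D > ereal t} = X.stays D z t \<inter> space M"
        using exit_time_greater_iff[OF X.shifted_X_continuous D_domain(1) elim] by (auto simp: X.stays_def)
      then show ?case by (simp add: X.survival_def)
    qed
  qed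
  \<comment> \<open>For \<open>lam <= 0\<close> the factor \<open>exp (lam * t)\<close> is at most 1
    while survival tends to 0, against the strictly positive limit \<open>psi z * c\<close>.\<close>
  have lam: "0 < lam"
  proof (rule ccontr)
    assume neg: "\<not> 0 < lam"
    obtain z where z: "z \<in> D" using D_domain(4) by blast
    have "((\<lambda>t. exp (lam * t) * X.survival D t z) \<longlongrightarrow> 0) at_top"
    proof (rule tendsto_sandwich[where f="\<lambda>_. 0"])
      show "((\<lambda>t. X.survival D t z) \<longlongrightarrow> 0) at_top"
        by (rule X.survival_tendsto_0[OF D_domain(1,3)])
      show "\<forall>\<^sub>F t in at_top. exp (lam * t) * X.survival D t z \<le> X.survival D t z"
        using eventually_ge_at_top[of 0]
      proof eventually_elim
        case (elim t)
        have "exp (lam * t) \<le> 1" using neg elim by (simp add: mult_nonpos_nonneg)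
        then show ?case using X.survival_nonneg[of D t z] by (simp add: mult_left_le_one_le)
      qed
    qed (auto simp: X.survival_nonneg)
    with lim[OF z] have "psi z * c = 0" by (rule tendsto_unique[rotated]) simp
    with psi[OF z] c show False by simp
  qed
  define v0 where "v0 = pi powr (2/3) * 2 powr (-2/3) * lam powr (-1/3)"
  note const = btbm_constants[OF lam, folded v0_def]
  define g where "g t = t powr (-1/6) * exp (3 / 2 * lam * v0 * t powr (1/3))" for t
  obtain B where B: "\<And>z t. 0 \<le> t \<Longrightarrow> exp (lam * t) * X.survival D t z \<le> B"
    using X.survival_bounded_and_uniform(1)[OF D_domain(1,3) less_imp_le[OF lam] lim] by blast
  have "uniform_limit D (\<lambda>t z. g t * (\<integral>\<omega>. X.survival D (Y.Y_max t \<omega>) z \<partial>M)) (\<lambda>z. C * (psi z * c)) at_top"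
  proof (rule uniform_limit_of_max)
    show "uniform_limit D (\<lambda>m z. exp (lam * m) * X.survival D m z) (\<lambda>z. psi z * c) at_top"
      by (rule X.survival_bounded_and_uniform(2)[OF D_domain(1,3) less_imp_le[OF lam] lim])
    show "((\<lambda>t. g t * (\<integral>\<omega>. exp (- lam * Y.Y_max t \<omega>) \<partial>M)) \<longlongrightarrow> C) at_top"
      unfolding g_def C_def const(4)[symmetric] by (rule Y.expectation_exp_Y_max_limit[OF lam const(1,2)])
    fix m :: real assume m: "0 < m"
    define \<kappa> where "\<kappa> = 3 / 2 * lam * v0"
    define \<beta> where "\<beta> = pi\<^sup>2 / (8 * m\<^sup>2)"
    have pos: "0 < \<kappa>" "0 < \<beta>" using lam const(1) m by (auto simp: \<kappa>_def \<beta>_def)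
    show "((\<lambda>t. g t * measure M {\<omega>\<in>space M. Y.Y_max t \<omega> < m}) \<longlongrightarrow> 0) at_top"
    proof (rule tendsto_sandwich[where f="\<lambda>_. 0"])
      \<comment> \<open>Staying below a fixed level \<open>m\<close> costs
        \<open>exp (- \<beta> * t)\<close>, which beats the normalisation growing like
        \<open>exp (\<kappa> * t powr (1/3))\<close>.\<close>
      show "((\<lambda>t. t powr (-1/6) * exp (\<kappa> * t powr (1/3)) * (3 * exp (- (\<beta> * t)))) \<longlongrightarrow> 0) at_top"
        using pos by real_asymp
      show "\<forall>\<^sub>F t in at_top. g t * measure M {\<omega>\<in>space M. Y.Y_max t \<omega> < m} \<le>
          t powr (-1/6) * exp (\<kappa> * t powr (1/3)) * (3 * exp (- (\<beta> * t)))"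
        using eventually_gt_at_top[of 0]
      proof eventually_elim
        case (elim t)
        have "measure M {\<omega>\<in>space M. Y.Y_max t \<omega> < m} \<le> 3 * exp (- (\<beta> * t))"
          using Y.survival_interval_le[OF elim m] elim by (simp add: Y.prob_Y_max_less \<beta>_def)
        then show ?case unfolding g_def \<kappa>_def by (intro mult_left_mono) auto
      qed
    qed (auto simp: g_def)
  qed (use B lam X.prob_space_axioms Y.Y_max_borel Y.Y_max_nonneg X.survival_nonneg
        X.survival_time_borel[OF D_domain(1)] in \<open>auto simp: g_def\<close>)
  moreover have "\<forall>\<^sub>F t in at_top. \<forall>z\<in>D. g t * (\<integral>\<omega>. X.survival D (Y.Y_max t \<omega>) z \<partial>M) = F t z"
    using eventually_ge_at_top[of 0]
  proof eventually_elim
    case (elim t)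
    then show ?case
      unfolding F_def g_def const(3)
      by (simp only: time_changed_survival[OF X_bm Y_bm XY_indep D_domain(1)]) simp
  qed
  ultimately have "uniform_limit D F (\<lambda>z. C * (psi z * c)) at_top"
    by (rule uniform_limit_cong[THEN iffD1, rotated 2]) auto
  then have unif: "uniform_limit D F (\<lambda>z. C * psi z * (LINT y:D|lborel. psi y)) at_top"
    by (simp only: c_def mult.assoc)
  show ?thesis
    using tendsto_uniform_limitI[OF unif] uniform_limit_on_subset[OF unif] by blast
qed

end
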